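(* Let $H=H(\mathcal D)$ be a lifting of a quantum linear space (see context), with standard basis $\{v^{\underline i}g\}$. For every $\underline c=(c_1,\dots,c_n)$ with $0\le c_k<m_k$ for all $k$: (1) $\xi^{\underline c}(v^{\underline i}g)=(\underline c)!\,\delta_{\underline c,\underline i}$ for all standard basis elements $v^{\underline i}g$. (2) The set $$\{[(\underline c)!]^{-1}\xi^{\underline c}\epsilon_g\;|\;0\le c_k<m_k\text{ for all }k\in\underline n\text{ and }g\in G\}$$ is the basis of $H^*$ dual to the standard basis of $H$ (the element indexed by $(\underline c,g)$ being dual to $v^{\underline c}g$).
   Context: $\Bbbk$ is a field of characteristic $0$ containing all roots of $1$, $G$ a finite abelian group, $\widehat G=\mathrm{Hom}(G,\Bbbk^\times)$, $\epsilon$ the trivial character, $\underline n=\{1,\dots,n\}$. A datum $\mathcal D$ on a quantum linear space consists of $a_i\in G$, $\chi_i\in\widehat G$ ($i\in\underline n$) with $\chi_i(a_j)\chi_j(a_i)=1$ for $i\neq j$, and scalars $\mu_i$, $\lambda_{ij}$ ($i\ne j$) in $\Bbbk$. Put $q_{ij}=\chi_j(a_i)$ for $i\ne j$, $q_i=\chi_i(a_i)$, $m_i$ = the multiplicative order of $q_i$, with $m_i\ge2$. The scalars satisfy: $\mu_i=0$ if $a_i^{m_i}=1$ or $\chi_i^{m_i}\ne\epsilon$; $\lambda_{ij}=0$ if $a_ia_j=1$ or $\chi_i\chi_j\neq\epsilon$; $\lambda_{ji}=-q_{ji}\lambda_{ij}$. $H=H(\mathcal D)$ is the Hopf algebra generated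 by $G$ and $v_1,\dots,v_n$ with the relations of $G$ and $gv_ig^{-1}=\chi_i(g)v_i$, $v_i^{m_i}=\mu_i(a_i^{m_i}-1)$, $v_iv_j-q_{ij}v_jv_i=\lambda_{ij}(a_ia_j-1)$ ($i\ne j$); $g\in G$ is grouplike and $\Delta(v_i)=v_i\otimes1+a_i\otimes v_i$. The standard basis of $H$ is $\{v^{\underline i}g: 0\le i_k<m_k,\ g\in G\}$, where $v^{\underline i}=v_1^{i_1}\cdots v_n^{i_n}$. $H^*$ carries the convolution product. With $u_k$ the $k$th unit vector, $\xi_k\in H^*$ is defined by $\xi_k(v^{\underline i}g)=\delta_{u_k,\underline i}$ for every $g\in G$, and $\xi^{\underline c}=\xi_1^{c_1}\cdots\xi_n^{c_n}$. Each $\gamma\in\widehat G$ is regarded as an element of $H^*$ via $\gamma(v^{\underline i}g)=\delta_{\underline0,\underline i}\gamma(g)$, and $\epsilon_g=\frac1{|G|}\sum_{\gamma\in\widehat G}\gamma(g^{-1})\gamma$. Finally $(\underline c)!=\prod_{k=1}^n(c_k)_{q_k}!$ with $(c)_q=1+q+\dots+q^{c-1}$, $(c)_q!=(1)_q\cdots(c)_q$, and $\delta_{\underline c,\underline i}=\prod_k\delta_{c_k,i_k}$. *)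

theory Defs
  imports
    Complex_Main
    "HOL-Algebra.QuotRing"
    "HOL-Library.Poly_Mapping"
    "HOL-Library.Product_Plus"
    "HOL-Library.Function_Algebras"
    "HOL-Library.FuncSet"
begin

section \<open>Free algebras and their tensor squares\<close>

text \<open>
  The free monoid is written additively (addition is concatenation), so that the convolution
  product of \<^theory>\<open>HOL-Library.Poly_Mapping\<close> makes finitely supported functions on words into the
  free associative algebra, and finitely supported functions on pairs of words into its tensor
  square, a pair \<open>(u, v)\<close> standing for the pure tensor of \<open>u\<close> and \<open>v\<close>.
\<close>

datatype 'x word = Word (letters: "'x list")

instantiation word :: (type) monoid_add
begin
definition zero_word :: "'a word" where "zero_word = Word []"
definition plus_word :: "'a word \<Rightarrow> 'a word \<Rightarrow> 'a word"
  where "plus_word u v = Word (letters u @ letters v)"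
instance by standard (simp_all add: zero_word_def plus_word_def)
end

definition words :: "'x set \<Rightarrow> 'x word set"
  where "words X = {w. set (letters w) \<subseteq> X}"

definition mon_alg :: "'m::monoid_add set \<Rightarrow> ('m \<Rightarrow>\<^sub>0 'k::field) ring"
  where "mon_alg M =
    \<lparr>carrier = {p. Poly_Mapping.keys p \<subseteq> M}, mult = (*), one = 1, zero = 0, add = (+)\<rparr>"

definition gen :: "'x \<Rightarrow> 'x word \<Rightarrow>\<^sub>0 'k::field"
  where "gen x = Poly_Mapping.single (Word [x]) 1"

definition scal :: "'k \<Rightarrow> 'm::monoid_add \<Rightarrow>\<^sub>0 'k::field"
  where "scal c = Poly_Mapping.single 0 c"

definition ptens ::
  "('m \<Rightarrow>\<^sub>0 'k) \<Rightarrow> ('m \<Rightarrow>\<^sub>0 'k) \<Rightarrow> ('m::monoid_add \<times> 'm \<Rightarrow>\<^sub>0 'k::field)"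
  where "ptens x y = (\<Sum>u\<in>Poly_Mapping.keys x. \<Sum>v\<in>Poly_Mapping.keys y.
    Poly_Mapping.single (u, v) (Poly_Mapping.lookup x u * Poly_Mapping.lookup y v))"

text \<open>The algebra map from the free algebra that extends \<open>\<phi>\<close>; the map \<open>sc\<close> embeds the scalars in
  the target.\<close>

definition alg_ext :: "('k \<Rightarrow> 'r) \<Rightarrow> ('x \<Rightarrow> 'r) \<Rightarrow> ('x word \<Rightarrow>\<^sub>0 'k::field) \<Rightarrow> 'r::ring_1"
  where "alg_ext sc \<phi> p =
    (\<Sum>w\<in>Poly_Mapping.keys p. sc (Poly_Mapping.lookup p w) * prod_list (map \<phi> (letters w)))"

section \<open>Scalars and characters\<close>

text \<open>In characteristic \<open>0\<close> an algebraic closure has exactly \<open>d\<close> many \<open>d\<close>-th roots of \<open>1\<close>.\<close>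

definition all_roots_of_1 :: "'k::field_char_0 itself \<Rightarrow> bool"
  where "all_roots_of_1 _ \<longleftrightarrow> (\<forall>d::nat. d > 0 \<longrightarrow> card {z::'k. z ^ d = 1} = d)"

definition mult_order :: "'k::field \<Rightarrow> nat"
  where "mult_order q = (LEAST d. d > 0 \<and> q ^ d = 1)"

definition field_units :: "'k::field monoid"
  where "field_units = \<lparr>carrier = - {0}, mult = (*), one = 1\<rparr>"

definition char_group :: "'g monoid \<Rightarrow> ('g \<Rightarrow> 'k::field) monoid"
  where "char_group G =
    \<lparr>carrier = hom G field_units \<inter> extensional (carrier G),
     mult = (\<lambda>\<chi> \<psi>. \<lambda>g\<in>carrier G. \<chi> g * \<psi> g),
     one = (\<lambda>g\<in>carrier G. 1)\<rparr>"

definition qnum :: "'k::field \<Rightarrow> nat \<Rightarrow> 'k"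
  where "qnum q c = (\<Sum>j<c. q ^ j)"

definition qfact :: "'k::field \<Rightarrow> nat \<Rightarrow> 'k"
  where "qfact q c = (\<Prod>j=1..c. qnum q j)"

section \<open>Data on quantum linear spaces\<close>

record ('g, 'k) datum =
  grp :: "'g monoid"
  rank :: nat
  gel :: "nat \<Rightarrow> 'g"  \<comment> \<open>the group elements \<open>a\<^sub>i\<close>\<close>
  chr :: "nat \<Rightarrow> 'g \<Rightarrow> 'k"  \<comment> \<open>the characters \<open>\<chi>\<^sub>i\<close>\<close>
  mu :: "nat \<Rightarrow> 'k"
  lam :: "nat \<Rightarrow> nat \<Rightarrow> 'k"

abbreviation idx :: "('g, 'k) datum \<Rightarrow> nat set"
  where "idx D \<equiv> {1..rank D}"

text \<open>The scalar \<open>q\<^sub>i\<close> is \<open>qq D i i\<close>.\<close>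

definition qq :: "('g, 'k::field) datum \<Rightarrow> nat \<Rightarrow> nat \<Rightarrow> 'k"
  where "qq D i j = chr D j (gel D i)"

definition mm :: "('g, 'k::field) datum \<Rightarrow> nat \<Rightarrow> nat"
  where "mm D i = mult_order (qq D i i)"

definition qls_datum :: "('g, 'k::field) datum \<Rightarrow> bool"
  where "qls_datum D \<longleftrightarrow>
    comm_group (grp D) \<and> finite (carrier (grp D)) \<and>
    (\<forall>i\<in>idx D. gel D i \<in> carrier (grp D) \<and> chr D i \<in> carrier (char_group (grp D)) \<and>
      mm D i \<ge> 2 \<and>
      (gel D i [^]\<^bsub>grp D\<^esub> mm D i = \<one>\<^bsub>grp D\<^esub> \<or>
        chr D i [^]\<^bsub>char_group (grp D)\<^esub> mm D i \<noteq> \<one>\<^bsub>char_group (grp D)\<^esub> \<longrightarrow> mu D i = 0)) \<and>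
    (\<forall>i\<in>idx D. \<forall>j\<in>idx D. i \<noteq> j \<longrightarrow>
      chr D i (gel D j) * chr D j (gel D i) = 1 \<and>
      (gel D i \<otimes>\<^bsub>grp D\<^esub> gel D j = \<one>\<^bsub>grp D\<^esub> \<or>
        chr D i \<otimes>\<^bsub>char_group (grp D)\<^esub> chr D j \<noteq> \<one>\<^bsub>char_group (grp D)\<^esub> \<longrightarrow> lam D i j = 0) \<and>
      lam D j i = - qq D j i * lam D i j)"

section \<open>The Hopf algebra of a datum\<close>

datatype 'g hgen = Grp 'g | Var nat

type_synonym ('g, 'k) free = "'g hgen word \<Rightarrow>\<^sub>0 'k"
type_synonym ('g, 'k) free2 = "'g hgen word \<times> 'g hgen word \<Rightarrow>\<^sub>0 'k"

definition gens :: "('g, 'k) datum \<Rightarrow> 'g hgen set"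
  where "gens D = Grp ` carrier (grp D) \<union> Var ` idx D"

definition free_alg :: "('g, 'k::field) datum \<Rightarrow> ('g, 'k) free ring"
  where "free_alg D = mon_alg (words (gens D))"

definition rels :: "('g, 'k::field) datum \<Rightarrow> ('g, 'k) free set"
  where "rels D =
    {gen (Grp \<one>\<^bsub>grp D\<^esub>) - 1} \<union>
    {gen (Grp g) * gen (Grp h) - gen (Grp (g \<otimes>\<^bsub>grp D\<^esub> h)) | g h.
      g \<in> carrier (grp D) \<and> h \<in> carrier (grp D)} \<union>
    {gen (Grp g) * gen (Var i) * gen (Grp (inv\<^bsub>grp D\<^esub> g)) - scal (chr D i g) * gen (Var i) | g i.
      g \<in> carrier (grp D) \<and> i \<in> idx D} \<union>
    {gen (Var i) ^ mm D i - scal (mu D i) * (gen (Grp (gel D i [^]\<^bsub>grp D\<^esub> mm D i)) - 1) | i.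
      i \<in> idx D} \<union>
    {gen (Var i) * gen (Var j) - scal (qq D i j) * gen (Var j) * gen (Var i)
      - scal (lam D i j) * (gen (Grp (gel D i \<otimes>\<^bsub>grp D\<^esub> gel D j)) - 1) | i j.
      i \<in> idx D \<and> j \<in> idx D \<and> i \<noteq> j}"

definition rel_ideal :: "('g, 'k::field) datum \<Rightarrow> ('g, 'k) free set"
  where "rel_ideal D = Idl\<^bsub>free_alg D\<^esub> (rels D)"

definition HD :: "('g, 'k::field) datum \<Rightarrow> ('g, 'k) free set ring"
  where "HD D = free_alg D Quot rel_ideal D"

definition cls :: "('g, 'k::field) datum \<Rightarrow> ('g, 'k) free \<Rightarrow> ('g, 'k) free set"
  where "cls D x = rel_ideal D +>\<^bsub>free_alg D\<^esub> x"

definition hscale :: "('g, 'k::field) datum \<Rightarrow> 'k \<Rightarrow> ('g, 'k) free set \<Rightarrow> ('g, 'k) free set"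
  where "hscale D c X = cls D (scal c) \<otimes>\<^bsub>HD D\<^esub> X"

text \<open>
  The algebra \<open>H \<otimes> H\<close> is presented as the quotient of the tensor square of the free algebra by the
  kernel of the projection, the ideal generated by all \<open>x \<otimes> 1\<close> and \<open>1 \<otimes> x\<close> with \<open>x\<close> in
  the ideal of relations.
\<close>

definition free_alg2 :: "('g, 'k::field) datum \<Rightarrow> ('g, 'k) free2 ring"
  where "free_alg2 D = mon_alg (words (gens D) \<times> words (gens D))"

definition rel_ideal2 :: "('g, 'k::field) datum \<Rightarrow> ('g, 'k) free2 set"
  where "rel_ideal2 D =
    Idl\<^bsub>free_alg2 D\<^esub> ((\<lambda>x. ptens x 1) ` rel_ideal D \<union> (\<lambda>x. ptens 1 x) ` rel_ideal D)"

definition HD2 :: "('g, 'k::field) datum \<Rightarrow> ('g, 'k) free2 set ring"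
  where "HD2 D = free_alg2 D Quot rel_ideal2 D"

definition cls2 :: "('g, 'k::field) datum \<Rightarrow> ('g, 'k) free2 \<Rightarrow> ('g, 'k) free2 set"
  where "cls2 D t = rel_ideal2 D +>\<^bsub>free_alg2 D\<^esub> t"

text \<open>A map \<open>f\<close> on representatives that is constant on the coset \<open>X\<close> induces the value
  \<open>the_elem (f ` X)\<close>.\<close>

fun comult_gen :: "('g, 'k::field) datum \<Rightarrow> 'g hgen \<Rightarrow> ('g, 'k) free2"
  where
    "comult_gen D (Grp g) = ptens (gen (Grp g)) (gen (Grp g))"
  | "comult_gen D (Var i) = ptens (gen (Var i)) 1 + ptens (gen (Grp (gel D i))) (gen (Var i))"

definition comult :: "('g, 'k::field) datum \<Rightarrow> ('g, 'k) free set \<Rightarrow> ('g, 'k) free2 set"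
  where "comult D X = the_elem ((\<lambda>x. cls2 D (alg_ext scal (comult_gen D) x)) ` X)"

fun counit_gen :: "'g hgen \<Rightarrow> 'k::field"
  where
    "counit_gen (Grp g) = 1"
  | "counit_gen (Var i) = 0"

definition counit :: "('g, 'k::field) datum \<Rightarrow> ('g, 'k) free set \<Rightarrow> 'k"
  where "counit D X =
    (if X \<in> carrier (HD D) then the_elem (alg_ext (\<lambda>c. c) counit_gen ` X) else 0)"

section \<open>The standard basis\<close>

definition ord_prod :: "('a, 'b) monoid_scheme \<Rightarrow> nat \<Rightarrow> (nat \<Rightarrow> 'a) \<Rightarrow> 'a"
  where "ord_prod M n f = foldr (\<lambda>k x. f k \<otimes>\<^bsub>M\<^esub> x) [1..<Suc n] \<one>\<^bsub>M\<^esub>"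

definition exps :: "('g, 'k::field) datum \<Rightarrow> (nat \<Rightarrow> nat) set"
  where "exps D = (\<Pi>\<^sub>E k\<in>idx D. {..<mm D k})"

definition std :: "('g, 'k::field) datum \<Rightarrow> (nat \<Rightarrow> nat) \<Rightarrow> 'g \<Rightarrow> ('g, 'k) free set"
  where "std D i g =
    ord_prod (HD D) (rank D) (\<lambda>k. cls D (gen (Var k)) [^]\<^bsub>HD D\<^esub> i k) \<otimes>\<^bsub>HD D\<^esub> cls D (gen (Grp g))"

definition kdelta :: "('g, 'k::field) datum \<Rightarrow> (nat \<Rightarrow> nat) \<Rightarrow> (nat \<Rightarrow> nat) \<Rightarrow> 'k"
  where "kdelta D c i = (\<Prod>k\<in>idx D. if c k = i k then 1 else 0)"

definition unit_vec :: "nat \<Rightarrow> nat \<Rightarrow> nat"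
  where "unit_vec k = (\<lambda>j. if j = k then 1 else 0)"

definition mfact :: "('g, 'k::field) datum \<Rightarrow> (nat \<Rightarrow> nat) \<Rightarrow> 'k"
  where "mfact D c = (\<Prod>k\<in>idx D. qfact (qq D k k) (c k))"

section \<open>The dual algebra\<close>

type_synonym ('g, 'k) functional = "('g, 'k) free set \<Rightarrow> 'k"

text \<open>Functionals are total functions in HOL; taking the value \<open>0\<close> outside \<open>H\<close> makes them unique
  and makes \<open>H\<^sup>*\<close> a subspace of the vector space of all functions.\<close>

definition dual_space :: "('g, 'k::field) datum \<Rightarrow> ('g, 'k) functional set"
  where "dual_space D = {f.
    (\<forall>X\<in>carrier (HD D). \<forall>Y\<in>carrier (HD D). f (X \<oplus>\<^bsub>HD D\<^esub> Y) = f X + f Y) \<and>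
    (\<forall>c. \<forall>X\<in>carrier (HD D). f (hscale D c X) = c * f X) \<and>
    (\<forall>X. X \<notin> carrier (HD D) \<longrightarrow> f X = 0)}"

definition fscale :: "'k::field \<Rightarrow> ('a \<Rightarrow> 'k) \<Rightarrow> 'a \<Rightarrow> 'k"
  where "fscale c f = (\<lambda>x. c * f x)"

text \<open>The functional \<open>f \<otimes> g\<close> on \<open>H \<otimes> H\<close>.\<close>

definition tens_functional ::
  "('g, 'k::field) datum \<Rightarrow> ('g, 'k) functional \<Rightarrow> ('g, 'k) functional \<Rightarrow> ('g, 'k) free2 set \<Rightarrow> 'k"
  where "tens_functional D f g T = the_elem ((\<lambda>t.
    \<Sum>(u, v)\<in>Poly_Mapping.keys t. Poly_Mapping.lookup t (u, v) *
      (f (cls D (Poly_Mapping.single u 1)) * g (cls D (Poly_Mapping.single v 1)))) ` T)"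

definition conv ::
  "('g, 'k::field) datum \<Rightarrow> ('g, 'k) functional \<Rightarrow> ('g, 'k) functional \<Rightarrow> ('g, 'k) functional"
  where "conv D f g =
    (\<lambda>X. if X \<in> carrier (HD D) then tens_functional D f g (comult D X) else 0)"

definition dual_alg :: "('g, 'k::field) datum \<Rightarrow> ('g, 'k) functional ring"
  where "dual_alg D =
    \<lparr>carrier = dual_space D, mult = conv D, one = counit D, zero = (\<lambda>X. 0),
     add = (\<lambda>f g X. f X + g X)\<rparr>"

text \<open>The product \<open>\<xi>\<^sub>1\<^bsup>c\<^sub>1\<^esup> \<cdots> \<xi>\<^sub>n\<^bsup>c\<^sub>n\<^esup>\<close> in \<open>H\<^sup>*\<close>, for an arbitrary family of functionals.\<close>

definition xi_pow ::
  "('g, 'k::field) datum \<Rightarrow> (nat \<Rightarrow> ('g, 'k) functional) \<Rightarrow> (nat \<Rightarrow> nat) \<Rightarrow> ('g, 'k) functional"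
  where "xi_pow D \<xi> c = ord_prod (dual_alg D) (rank D) (\<lambda>k. \<xi> k [^]\<^bsub>dual_alg D\<^esub> c k)"

text \<open>The element \<open>\<epsilon>\<^sub>g\<close>, where \<open>\<iota> \<gamma>\<close> is the character \<open>\<gamma>\<close> regarded as an element of \<open>H\<^sup>*\<close>.\<close>

definition eps_el ::
  "('g, 'k::field) datum \<Rightarrow> (('g \<Rightarrow> 'k) \<Rightarrow> ('g, 'k) functional) \<Rightarrow> 'g \<Rightarrow> ('g, 'k) functional"
  where "eps_el D \<iota> g = fscale (1 / of_nat (card (carrier (grp D))))
    (\<Sum>\<gamma>\<in>carrier (char_group (grp D)). fscale (\<gamma> (inv\<^bsub>grp D\<^esub> g)) (\<iota> \<gamma>))"

definition dual_elem ::
  "('g, 'k::field) datum \<Rightarrow> (nat \<Rightarrow> ('g, 'k) functional) \<Rightarrow> (('g \<Rightarrow> 'k) \<Rightarrow> ('g, 'k) functional) \<Rightarrow>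
    (nat \<Rightarrow> nat) \<Rightarrow> 'g \<Rightarrow> ('g, 'k) functional"
  where "dual_elem D \<xi> \<iota> c g =
    fscale (inverse (mfact D c)) (xi_pow D \<xi> c \<otimes>\<^bsub>dual_alg D\<^esub> eps_el D \<iota> g)"

end

theory Submission
  imports Defs "HOL-Algebra.Multiplicative_Group" "HOL-Library.Multiset"
begin

text \<open>
  Write \<open>v\<^sub>L g\<close> for the monomial of a list \<open>L\<close> of generator indices, so that the standard basis
  consists of the \<open>v\<^sub>L g\<close> with \<open>L\<close> sorted and each index \<open>k\<close> occurring less than \<open>m\<^sub>k\<close> times, and
  let \<open>a\<^sub>L\<close> be the product of the group elements \<open>a\<^sub>l\<close> with \<open>l\<close> in \<open>L\<close>.  Expanding \<open>\<Delta>(v\<^sub>L g)\<close> letter by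
  letter and moving all group elements to the right gives

  \<^item> \<open>\<Delta>(v\<^sub>L g) = \<Sum> c\<^sub>A\<^sub>,\<^sub>B (v\<^sub>A a\<^sub>B g \<otimes> v\<^sub>B g)\<close>

  where \<open>(A, B)\<close> runs over the ways of dealing the letters of \<open>L\<close> to the two factors and \<open>c\<^sub>A\<^sub>,\<^sub>B\<close> is a
  product of character values.  The crucial point is that \<open>A\<close> and \<open>B\<close> are sublists of \<open>L\<close>: if \<open>L\<close> is
  standard so are they, and no lower terms arise from reordering or from powers.  Hence convolution
  products of functionals that are concentrated on a single standard monomial (where the values of
  the right factor may depend on the group element) are again of this kind; \<open>conv_concentratedI\<close> is the general rule.
  Two coefficients matter.  Splitting \<open>k\<^sup>N\<^sup>+\<^sup>1\<close> into \<open>k\<^sup>N\<close> and \<open>k\<close> has total weight \<open>(N + 1)\<close> in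
  base \<open>q\<^sub>k\<close>, which makes \<open>\<xi>\<^sub>k\<^sup>N\<close> take the value \<open>(N)!\<close>; splitting \<open>AB\<close> into \<open>A\<close> and \<open>B\<close> without
  common letters has weight \<open>1\<close>, so the powers for different \<open>k\<close>, and finally \<open>\<epsilon>\<^sub>g\<close>, multiply
  without further scalars.  The value of \<open>\<epsilon>\<^sub>g\<close> on group elements is the orthogonality relation for
  characters of \<open>G\<close>.

  Convolution is evaluated on representatives, which is legitimate because \<open>\<Delta>\<close> maps the ideal of
  relations into the corresponding ideal of the tensor square; for \<open>v\<^sub>i\<^sup>m = \<mu>(a\<^sub>i\<^sup>m - 1)\<close> this is the
  vanishing of the \<open>q\<close>-binomial coefficients at a root of unity of order \<open>m\<close>.

  The resulting functionals take the values of the Kronecker delta on standard monomials and are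
  therefore linearly independent.  They span \<open>H\<^sup>*\<close> because the standard monomials span \<open>H\<close>: sorting
  a monomial and removing full powers \<open>v\<^sub>k\<^sup>m\<close> changes it by a scalar and by shorter monomials, so a
  functional that vanishes on standard monomials is zero.
\<close>

section \<open>Characters of a finite abelian group\<close>

text \<open>The map \<open>z \<mapsto> z\<^sup>d\<close> sends the \<open>de\<close>-th roots of \<open>1\<close> to the \<open>e\<close>-th ones with fibres of size at most
  \<open>d\<close>; counting shows that it is onto.\<close>

lemma root_of_root_of_1:
  fixes w :: "'k::field_char_0"
  assumes roots: "all_roots_of_1 TYPE('k)" and "d > 0" "e > 0" and w: "w ^ e = 1"
  shows "\<exists>z. z ^ d = w"
proof -
  define A where "A = {z::'k. z ^ (d * e) = 1}"
  define B where "B = {z::'k. z ^ e = 1}"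
  have cA: "card A = d * e" and cB: "card B = e"
    using roots assms(2,3) unfolding all_roots_of_1_def A_def B_def by auto
  have fin: "finite A" "finite B"
    using cA cB assms(2,3) by (metis card.infinite mult_is_0 not_gr_zero)+
  have sub: "(\<lambda>z. z ^ d) ` A \<subseteq> B"
    by (auto simp: A_def B_def power_mult)
  have fib: "card {z \<in> A. z ^ d = v} \<le> d" if "v \<in> (\<lambda>z. z ^ d) ` A" for v
  proof -
    from that obtain z0 where z0: "z0 \<in> A" "v = z0 ^ d" by auto
    have nz: "z0 \<noteq> 0" using z0(1) assms(2,3) by (auto simp: A_def power_0_left)
    have c: "card {z::'k. z ^ d = 1} = d"
      using roots assms(2) by (auto simp: all_roots_of_1_def)
    have "card {z \<in> A. z ^ d = v} \<le> card {z::'k. z ^ d = 1}"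
    proof (rule card_inj_on_le[where f = "\<lambda>z. z / z0"])
      show "inj_on (\<lambda>z. z / z0) {z \<in> A. z ^ d = v}" using nz by (auto simp: inj_on_def)
      show "(\<lambda>z. z / z0) ` {z \<in> A. z ^ d = v} \<subseteq> {z. z ^ d = 1}"
        using z0 nz by (auto simp: power_divide)
      show "finite {z::'k. z ^ d = 1}" using c assms(2) by (metis card.infinite not_gr_zero)
    qed
    with c show ?thesis by simp
  qed
  have "card A = (\<Sum>v\<in>(\<lambda>z. z ^ d) ` A. card {z \<in> A. z ^ d = v})"
    using sum.image_gen[OF fin(1), of "\<lambda>_. 1::nat" "\<lambda>z. z ^ d"] by simp
  also have "\<dots> \<le> (\<Sum>v\<in>(\<lambda>z. z ^ d) ` A. d)"
    by (intro sum_mono fib)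
  also have "\<dots> = card ((\<lambda>z. z ^ d) ` A) * d" by simp
  finally have "e \<le> card ((\<lambda>z. z ^ d) ` A)" using cA assms(2) by simp
  then have "(\<lambda>z. z ^ d) ` A = B"
    using card_subset_eq[OF fin(2) sub] cB card_mono[OF fin(2) sub] by simp
  then have "w \<in> (\<lambda>z. z ^ d) ` A" using w by (simp add: B_def)
  then show ?thesis by auto
qed

text \<open>A character of a subgroup \<open>H\<close>; total functions whose values outside \<open>H\<close> are arbitrary keep
  extension arguments free of restrictions.\<close>

definition part_char :: "('g, 'b) monoid_scheme \<Rightarrow> 'g set \<Rightarrow> ('g \<Rightarrow> 'k::field) \<Rightarrow> bool"
  where "part_char G H \<chi> \<longleftrightarrow>
    (\<forall>x\<in>H. \<chi> x \<noteq> 0) \<and> (\<forall>x\<in>H. \<forall>y\<in>H. \<chi> (x \<otimes>\<^bsub>G\<^esub> y) = \<chi> x * \<chi> y)"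

locale finite_comm_group = comm_group G for G :: "'a monoid" (structure) +
  assumes fin: "finite (carrier G)"
begin

lemma part_char_one:
  assumes "subgroup H G" "part_char G H \<chi>" shows "\<chi> \<one> = 1"
proof -
  have "\<one> \<in> H" using assms(1) by (rule subgroup.one_closed)
  then have "\<chi> (\<one> \<otimes> \<one>) = \<chi> \<one> * \<chi> \<one>" "\<chi> \<one> \<noteq> 0" using assms(2) unfolding part_char_def by blast+
  then show ?thesis by simp
qed

lemma subgroup_pow_closed:
  assumes "subgroup H G" "x \<in> H" shows "x [^] (n::nat) \<in> H"
  using assms by (induction n) (auto simp: subgroup.one_closed subgroup.m_closed)

lemma part_char_pow:
  assumes "subgroup H G" "part_char G H \<chi>" "x \<in> H"
  shows "\<chi> (x [^] (n::nat)) = \<chi> x ^ n"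
proof (induction n)
  case 0 show ?case using part_char_one[OF assms(1,2)] by simp
next
  case (Suc n)
  have "\<chi> (x [^] n \<otimes> x) = \<chi> (x [^] n) * \<chi> x"
    using assms(2,3) subgroup_pow_closed[OF assms(1,3), of n] unfolding part_char_def by blast
  with Suc show ?case by simp
qed

text \<open>Inverses are powers in a finite group.\<close>

lemma mult_closed_imp_subgroup:
  assumes "K \<subseteq> carrier G" "\<one> \<in> K"
    and cl: "\<And>x y. x \<in> K \<Longrightarrow> y \<in> K \<Longrightarrow> x \<otimes> y \<in> K"
  shows "subgroup K G"
proof (rule subgroupI)
  show "K \<subseteq> carrier G" "K \<noteq> {}" using assms by auto
  show "x \<otimes> y \<in> K" if "x \<in> K" "y \<in> K" for x y using cl that .
  fix x assume x: "x \<in> K"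
  then have xG: "x \<in> carrier G" using assms(1) by auto
  have pw: "x [^] (n::nat) \<in> K" for n
    by (induction n) (auto simp: assms(2) cl x)
  have "order G > 0" using fin by (simp add: order_gt_0_iff_finite)
  then have "x [^] (order G - 1) \<otimes> x = x [^] order G"
    by (metis Suc_diff_1 nat_pow_Suc)
  also have "\<dots> = \<one>" using pow_order_eq_1[OF xG] .
  finally have "inv x = x [^] (order G - 1)"
    using xG by (metis inv_equality nat_pow_closed)
  then show "inv x \<in> K" using pw by simp
qed

text \<open>A character of \<open>H\<close> extends to the subgroup generated by \<open>H\<close> and \<open>x\<close> once a value \<open>z\<close> at \<open>x\<close>
  is chosen compatibly with the first power \<open>x\<^sup>d\<close> that lies in \<open>H\<close>: every coincidence
  \<open>h x\<^sup>i = h' x\<^sup>j\<close> is a consequence of \<open>x\<^sup>d \<in> H\<close>, so \<open>h x\<^sup>j \<mapsto> \<chi>(h) z\<^sup>j\<close> is well defined.\<close>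

lemma extend_part_char:
  fixes \<chi> :: "'a \<Rightarrow> 'k::field"
  assumes H: "subgroup H G" and \<chi>: "part_char G H \<chi>"
    and x: "x \<in> carrier G" and d: "d > 0" "x [^] (d::nat) \<in> H"
    and dmin: "\<And>e::nat. e > 0 \<Longrightarrow> x [^] e \<in> H \<Longrightarrow> d \<le> e"
    and z: "z ^ d = \<chi> (x [^] d)"
  shows "\<exists>K \<psi>. subgroup K G \<and> H \<subseteq> K \<and> x \<in> K \<and> part_char G K \<psi> \<and> (\<forall>h\<in>H. \<psi> h = \<chi> h) \<and> \<psi> x = z"
proof -
  have Hc: "h \<in> carrier G" if "h \<in> H" for h using H that by (meson subgroup.mem_carrier)
  have \<chi>m: "\<chi> (a \<otimes> b) = \<chi> a * \<chi> b" if "a \<in> H" "b \<in> H" for a b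
    using \<chi> that unfolding part_char_def by blast
  have znz: "z \<noteq> 0"
    using z \<chi> d by (auto simp: part_char_def power_0_left)
  have dvd: "d dvd e" if "x [^] (e::nat) \<in> H" for e
  proof (rule ccontr)
    assume "\<not> d dvd e"
    then have pos: "e mod d > 0" by (simp add: mod_greater_zero_iff_not_dvd)
    let ?y = "(x [^] d) [^] (e div d)"
    have y: "?y \<in> H" by (rule subgroup_pow_closed[OF H d(2)])
    have "x [^] e = ?y \<otimes> x [^] (e mod d)"
      using x by (simp add: nat_pow_pow nat_pow_mult)
    then have "x [^] (e mod d) = inv ?y \<otimes> x [^] e"
      using x y Hc by (simp add: m_assoc[symmetric])
    then have "x [^] (e mod d) \<in> H"
      using H y that by (simp add: subgroup.m_closed subgroup.m_inv_closed)
    from dmin[OF pos this] show False using mod_less_divisor[OF d(1), of e] by simp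
  qed
  have wd0: "\<chi> h * z ^ e = \<chi> h'" if "h \<in> H" "h' \<in> H" and eq: "h \<otimes> x [^] (e::nat) = h'" for h h' e
  proof -
    have "x [^] e = inv h \<otimes> h'" using that x Hc by (metis inv_solve_left nat_pow_closed)
    then have "x [^] e \<in> H" using that H by (simp add: subgroup.m_closed subgroup.m_inv_closed)
    then obtain f where f: "e = d * f" using dvd by blast
    have "h' = h \<otimes> (x [^] d) [^] f" using eq x by (simp add: f nat_pow_pow)
    then have "\<chi> h' = \<chi> h * \<chi> (x [^] d) ^ f"
      using \<chi>m[OF that(1) subgroup_pow_closed[OF H d(2)]] part_char_pow[OF H \<chi> d(2)] by simp
    then show ?thesis by (simp add: f power_mult z)
  qed
  have wd1: "\<chi> h * z ^ i = \<chi> h' * z ^ j"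
    if "h \<in> H" "h' \<in> H" "h \<otimes> x [^] i = h' \<otimes> x [^] j" "j \<le> i" for h h' and i j :: nat
  proof -
    have i: "i = (i - j) + j" using that(4) by simp
    have "(h \<otimes> x [^] (i - j)) \<otimes> x [^] j = h' \<otimes> x [^] j"
      using that(3) x Hc[OF that(1)] by (subst (asm) i) (simp add: nat_pow_mult[symmetric] m_assoc)
    then have "h \<otimes> x [^] (i - j) = h'"
      using x Hc[OF that(1)] Hc[OF that(2)] by simp
    from wd0[OF that(1,2) this] show ?thesis
      by (subst i) (simp add: power_add)
  qed
  have wd: "\<chi> h * z ^ i = \<chi> h' * z ^ j"
    if "h \<in> H" "h' \<in> H" "h \<otimes> x [^] i = h' \<otimes> x [^] j" for h h' and i j :: nat
    using wd1[OF that] wd1[OF that(2,1) that(3)[symmetric]] by (metis nle_le)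
  define K where "K = {h \<otimes> x [^] j | h j::nat. h \<in> H}"
  define \<psi> where "\<psi> k = (THE v. \<exists>h j::nat. h \<in> H \<and> k = h \<otimes> x [^] j \<and> v = \<chi> h * z ^ j)" for k
  have \<psi>: "\<psi> (h \<otimes> x [^] j) = \<chi> h * z ^ j" if "h \<in> H" for h and j :: nat
    unfolding \<psi>_def using that wd by (intro the_equality) (blast, metis)
  have mult: "(h \<otimes> x [^] i) \<otimes> (h' \<otimes> x [^] j) = (h \<otimes> h') \<otimes> x [^] (i + j)"
    if "h \<in> H" "h' \<in> H" for h h' and i j :: nat
    using that Hc x by (simp add: nat_pow_mult[symmetric] m_ac)
  have one: "\<one> \<in> H" using H by (rule subgroup.one_closed)
  have HK: "H \<subseteq> K"
  proof
    fix h assume "h \<in> H"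
    then have "h = h \<otimes> x [^] (0::nat)" using Hc by simp
    then show "h \<in> K" using \<open>h \<in> H\<close> unfolding K_def by blast
  qed
  have x1: "x = \<one> \<otimes> x [^] (1::nat)" using x by simp
  have xK: "x \<in> K" using x1 one unfolding K_def by blast
  have KK: "subgroup K G"
  proof (rule mult_closed_imp_subgroup)
    show "K \<subseteq> carrier G" using Hc x by (auto simp: K_def)
    show "\<one> \<in> K" using HK one by blast
    fix a b assume "a \<in> K" "b \<in> K"
    then obtain h h' and i j :: nat where "h \<in> H" "h' \<in> H" "a = h \<otimes> x [^] i" "b = h' \<otimes> x [^] j"
      unfolding K_def by blast
    then show "a \<otimes> b \<in> K"
      using mult[of h h' i j] subgroup.m_closed[OF H] unfolding K_def by blast
  qed
  have ch: "part_char G K \<psi>"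
    unfolding part_char_def
  proof (intro conjI ballI)
    fix a assume "a \<in> K"
    then obtain h and i :: nat where a: "h \<in> H" "a = h \<otimes> x [^] i" unfolding K_def by blast
    then show "\<psi> a \<noteq> 0" using \<psi> \<chi> znz by (simp add: part_char_def)
    fix b assume "b \<in> K"
    then obtain h' and j :: nat where b: "h' \<in> H" "b = h' \<otimes> x [^] j" unfolding K_def by blast
    show "\<psi> (a \<otimes> b) = \<psi> a * \<psi> b"
      unfolding a b mult[OF a(1) b(1)] using a(1) b(1) \<psi> subgroup.m_closed[OF H a(1) b(1)] \<chi>m
      by (simp add: power_add)
  qed
  have "\<psi> h = \<chi> h" if "h \<in> H" for h using \<psi>[OF that, of 0] Hc[OF that] by simp
  moreover have "\<psi> x = z" using \<psi>[OF one, of 1] part_char_one[OF H \<chi>] x by simp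
  ultimately show ?thesis using KK HK xK ch by blast
qed

lemma least_power_in_subgroup:
  assumes H: "subgroup H G" and x: "x \<in> carrier G"
  obtains d :: nat where "d > 0" "x [^] d \<in> H" "\<And>e::nat. e > 0 \<Longrightarrow> x [^] e \<in> H \<Longrightarrow> d \<le> e"
proof -
  let ?P = "\<lambda>d::nat. d > 0 \<and> x [^] d \<in> H"
  have "?P (order G)"
    using pow_order_eq_1[OF x] subgroup.one_closed[OF H] fin order_gt_0_iff_finite by simp
  then show ?thesis
    using LeastI[of ?P] Least_le[of ?P] by (intro that[of "Least ?P"]) auto
qed

text \<open>Characters separate points: a character of a maximal subgroup among those that carry a
  character nontrivial at \<open>h\<close> is defined on the whole group, and the subgroup generated by \<open>h\<close>
  already carries one.\<close>

lemma char_separates: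
  assumes roots: "all_roots_of_1 TYPE('k::field_char_0)"
    and h: "h \<in> carrier G" "h \<noteq> \<one>"
  shows "\<exists>\<gamma>\<in>carrier (char_group G). \<gamma> h \<noteq> (1::'k)"
proof -
  define Q where "Q = (\<lambda>(H, \<chi>::'a \<Rightarrow> 'k). subgroup H G \<and> h \<in> H \<and> part_char G H \<chi> \<and> \<chi> h \<noteq> 1)"
  have triv: "subgroup {\<one>} G" by (rule triv_subgroup)
  have base: "\<exists>p. Q p"
  proof -
    obtain d :: nat where d: "d > 0" "h [^] d \<in> {\<one>}" "\<And>e::nat. e > 0 \<Longrightarrow> h [^] e \<in> {\<one>} \<Longrightarrow> d \<le> e"
      using least_power_in_subgroup[OF triv h(1)] by blast
    have "d \<noteq> 1" using d(2) h by (auto simp: nat_pow_one)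
    then have "card {z::'k. z ^ d = 1} > card {1::'k}"
      using roots d(1) by (auto simp: all_roots_of_1_def)
    then have "\<not> {z::'k. z ^ d = 1} \<subseteq> {1}"
      by (metis card_mono finite.emptyI finite.insertI not_le)
    then obtain z :: 'k where z: "z ^ d = 1" "z \<noteq> 1" by blast
    have pc: "part_char G {\<one>} (\<lambda>_. 1::'k)" by (simp add: part_char_def)
    from extend_part_char[OF triv pc h(1) d, of z] z
    obtain K \<psi> where "subgroup K G" "h \<in> K" "part_char G K \<psi>" "\<psi> h = z" by auto
    then show ?thesis using z by (intro exI[of _ "(K, \<psi>)"]) (simp add: Q_def)
  qed
  have bd: "card (fst p) < Suc (order G)" if "Q p" for p
    using that fin card_mono[OF fin, of "fst p"] subgroup.subset[of "fst p" G]
    by (auto simp: Q_def order_def less_Suc_eq_le)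
  obtain p where p: "Q p" "\<And>p'. Q p' \<Longrightarrow> card (fst p') \<le> card (fst p)"
    using ex_has_greatest_nat[of Q _ "\<lambda>p. card (fst p)" "Suc (order G)"] base bd by (metis less_imp_le)
  obtain H \<chi> where Hc: "p = (H, \<chi>)" by (cases p)
  have H: "subgroup H G" "h \<in> H" "part_char G H \<chi>" "\<chi> h \<noteq> 1" using p(1) by (auto simp: Hc Q_def)
  have "H = carrier G"
  proof (rule ccontr)
    assume "H \<noteq> carrier G"
    then obtain x where x: "x \<in> carrier G" "x \<notin> H" using subgroup.subset[OF H(1)] by blast
    obtain d :: nat where d: "d > 0" "x [^] d \<in> H" "\<And>e::nat. e > 0 \<Longrightarrow> x [^] e \<in> H \<Longrightarrow> d \<le> e"
      using least_power_in_subgroup[OF H(1) x(1)] by blast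
    have "\<chi> (x [^] d) ^ order G = 1"
      using part_char_pow[OF H(1,3) d(2), of "order G"] pow_order_eq_1[of "x [^] d"] x(1)
        part_char_one[OF H(1,3)] by simp
    then obtain z where z: "z ^ d = \<chi> (x [^] d)"
      using root_of_root_of_1[OF roots d(1)] fin order_gt_0_iff_finite by blast
    from extend_part_char[OF H(1,3) x(1) d z] obtain K \<psi> where
      K: "subgroup K G" "H \<subseteq> K" "x \<in> K" "part_char G K \<psi>" "\<forall>h\<in>H. \<psi> h = \<chi> h" by auto
    then have "Q (K, \<psi>)" using H by (auto simp: Q_def)
    then have "card K \<le> card H" using p(2) Hc by fastforce
    moreover have "card H < card K"
      using K x subgroup.subset[OF K(1)] fin by (intro psubset_card_mono) (auto intro: finite_subset)
    ultimately show False by simp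
  qed
  with H have pc: "part_char G (carrier G) \<chi>" by simp
  let ?\<gamma> = "restrict \<chi> (carrier G)"
  have "?\<gamma> \<in> carrier (char_group G)"
    using pc by (auto simp: char_group_def hom_def field_units_def part_char_def)
  moreover have "?\<gamma> h \<noteq> 1" using H h by simp
  ultimately show ?thesis by blast
qed

lemma char_groupD:
  assumes "\<gamma> \<in> carrier (char_group G)"
  shows "x \<in> carrier G \<Longrightarrow> \<gamma> x \<noteq> 0" "x \<in> carrier G \<Longrightarrow> y \<in> carrier G \<Longrightarrow> \<gamma> (x \<otimes> y) = \<gamma> x * \<gamma> y"
    "\<gamma> \<one> = 1" "\<gamma> \<in> extensional (carrier G)"
proof -
  show a: "\<gamma> x \<noteq> 0" if "x \<in> carrier G" for x
    using assms that by (auto simp: char_group_def hom_def field_units_def)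
  show b: "\<gamma> (x \<otimes> y) = \<gamma> x * \<gamma> y" if "x \<in> carrier G" "y \<in> carrier G" for x y
    using assms that by (auto simp: char_group_def hom_def field_units_def)
  show "\<gamma> \<one> = 1" using a[of \<one>] b[of \<one> \<one>] by simp
  show "\<gamma> \<in> extensional (carrier G)" using assms by (auto simp: char_group_def)
qed

lemma char_pow:
  assumes "\<gamma> \<in> carrier (char_group G)" "x \<in> carrier G"
  shows "\<gamma> (x [^] (n::nat)) = \<gamma> x ^ n"
  using assms by (induction n) (auto simp: char_groupD)

lemma char_groupI:
  assumes "\<And>x. x \<in> carrier G \<Longrightarrow> \<gamma> x \<noteq> 0"
    "\<And>x y. x \<in> carrier G \<Longrightarrow> y \<in> carrier G \<Longrightarrow> \<gamma> (x \<otimes> y) = \<gamma> x * \<gamma> y"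
    "\<gamma> \<in> extensional (carrier G)"
  shows "\<gamma> \<in> carrier (char_group G)"
  using assms by (auto simp: char_group_def hom_def field_units_def)

lemma finite_chars:
  assumes "all_roots_of_1 TYPE('k::field_char_0)"
  shows "finite (carrier (char_group G :: ('a \<Rightarrow> 'k) monoid))"
proof (rule finite_subset)
  show "carrier (char_group G :: ('a \<Rightarrow> 'k) monoid) \<subseteq> carrier G \<rightarrow>\<^sub>E {z. z ^ order G = 1}"
  proof
    fix \<gamma> :: "'a \<Rightarrow> 'k" assume g: "\<gamma> \<in> carrier (char_group G)"
    have "\<gamma> x ^ order G = 1" if "x \<in> carrier G" for x
      using char_pow[OF g that, of "order G"] pow_order_eq_1[OF that] char_groupD(3)[OF g] by simp
    then show "\<gamma> \<in> carrier G \<rightarrow>\<^sub>E {z. z ^ order G = 1}"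
      using char_groupD(4)[OF g] by (auto simp: PiE_def)
  qed
  have "order G > 0" using fin order_gt_0_iff_finite by blast
  then have "card {z::'k. z ^ order G = 1} > 0" using assms(1) by (simp add: all_roots_of_1_def)
  then show "finite (carrier G \<rightarrow>\<^sub>E {z::'k. z ^ order G = 1})"
    using fin by (intro finite_PiE) (auto simp: card_gt_0_iff)
qed

text \<open>Both orthogonality relations come from the same observation: a sum over a group is invariant
  under translation, so it vanishes as soon as translation multiplies it by a scalar other
  than \<open>1\<close>.\<close>

lemma sum_char_eq_0:
  assumes \<gamma>: "\<gamma> \<in> carrier (char_group G)" and x: "x \<in> carrier G" "\<gamma> x \<noteq> 1"
  shows "(\<Sum>h\<in>carrier G. \<gamma> h) = 0"
proof -
  have "(\<Sum>h\<in>carrier G. \<gamma> h) = (\<Sum>h\<in>carrier G. \<gamma> (x \<otimes> h))"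
    using x by (intro sum.reindex_bij_witness[of _ "\<lambda>h. x \<otimes> h" "\<lambda>h. inv x \<otimes> h"])
      (auto simp: m_assoc[symmetric])
  also have "\<dots> = \<gamma> x * (\<Sum>h\<in>carrier G. \<gamma> h)"
    using x char_groupD(2)[OF \<gamma>] by (simp add: sum_distrib_left)
  finally have "(1 - \<gamma> x) * (\<Sum>h\<in>carrier G. \<gamma> h) = 0" by (simp add: algebra_simps)
  then show ?thesis using x by simp
qed

lemma sum_chars_eq_0:
  assumes roots: "all_roots_of_1 TYPE('k::field_char_0)"
    and h: "h \<in> carrier G" "h \<noteq> \<one>"
  shows "(\<Sum>\<gamma>\<in>carrier (char_group G). \<gamma> h) = (0::'k)"
proof -
  obtain \<gamma>0 :: "'a \<Rightarrow> 'k" where g0: "\<gamma>0 \<in> carrier (char_group G)" "\<gamma>0 h \<noteq> 1"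
    using char_separates[OF roots h] by blast
  let ?C = "carrier (char_group G) :: ('a \<Rightarrow> 'k) set"
  have ext: "\<gamma> x = undefined" if "\<gamma> \<in> ?C" "x \<notin> carrier G" for \<gamma> x
    using char_groupD(4)[OF that(1)] that(2) by (auto simp: extensional_def)
  have "(\<Sum>\<gamma>\<in>?C. \<gamma> h) = (\<Sum>\<gamma>\<in>?C. \<gamma>0 h * \<gamma> h)"
  proof (rule sum.reindex_bij_witness[of _ "\<lambda>\<gamma>. \<lambda>x\<in>carrier G. \<gamma>0 x * \<gamma> x" "\<lambda>\<gamma>. \<lambda>x\<in>carrier G. \<gamma> x / \<gamma>0 x"])
    fix \<gamma> assume g: "\<gamma> \<in> ?C"
    show "(\<lambda>x\<in>carrier G. \<gamma>0 x * (\<lambda>x\<in>carrier G. \<gamma> x / \<gamma>0 x) x) = \<gamma>"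
      "(\<lambda>x\<in>carrier G. (\<lambda>x\<in>carrier G. \<gamma>0 x * \<gamma> x) x / \<gamma>0 x) = \<gamma>"
      using g g0 by (auto simp: fun_eq_iff char_groupD ext)
    show "(\<lambda>x\<in>carrier G. \<gamma>0 x * \<gamma> x) \<in> ?C" "(\<lambda>x\<in>carrier G. \<gamma> x / \<gamma>0 x) \<in> ?C"
      using g g0 by (auto intro!: char_groupI simp: char_groupD)
    show "\<gamma>0 h * (\<lambda>x\<in>carrier G. \<gamma> x / \<gamma>0 x) h = \<gamma> h"
      using g g0 h by (auto simp: char_groupD)
  qed
  also have "\<dots> = \<gamma>0 h * (\<Sum>\<gamma>\<in>?C. \<gamma> h)" by (simp add: sum_distrib_left)
  finally have "(1 - \<gamma>0 h) * (\<Sum>\<gamma>\<in>?C. \<gamma> h) = 0" by (simp add: algebra_simps)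
  then show ?thesis using g0 by simp
qed

text \<open>Summing all values \<open>\<gamma>(h)\<close> in both orders gives the number of characters on one side and the
  number of group elements on the other.\<close>

lemma card_chars:
  assumes roots: "all_roots_of_1 TYPE('k::field_char_0)"
  shows "card (carrier (char_group G :: ('a \<Rightarrow> 'k) monoid)) = card (carrier G)"
proof -
  let ?C = "carrier (char_group G) :: ('a \<Rightarrow> 'k) set"
  let ?one = "\<lambda>x\<in>carrier G. (1::'k)"
  have finC: "finite ?C" by (rule finite_chars[OF roots])
  have one: "?one \<in> ?C" by (auto intro!: char_groupI)
  have inner: "(\<Sum>h\<in>carrier G. \<gamma> h) = 0" if "\<gamma> \<in> ?C" "\<gamma> \<noteq> ?one" for \<gamma>
  proof -
    have "\<exists>x\<in>carrier G. \<gamma> x \<noteq> 1"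
      using that char_groupD(4)[OF that(1)] by (auto simp: fun_eq_iff extensional_def split: if_splits)
    then show ?thesis using sum_char_eq_0[OF that(1)] by blast
  qed
  have "(of_nat (card ?C)::'k) = (\<Sum>\<gamma>\<in>?C. \<gamma> \<one>)"
    by (simp add: char_groupD(3))
  also have "\<dots> = (\<Sum>h\<in>carrier G. \<Sum>\<gamma>\<in>?C. \<gamma> h)"
    using fin sum_chars_eq_0[OF roots]
    by (subst sum.remove[of "carrier G" \<one>]) auto
  also have "\<dots> = (\<Sum>\<gamma>\<in>?C. \<Sum>h\<in>carrier G. \<gamma> h)" by (rule sum.swap)
  also have "\<dots> = (\<Sum>h\<in>carrier G. ?one h)"
    using finC one inner by (subst sum.remove[of ?C ?one]) auto
  also have "\<dots> = of_nat (card (carrier G))" by simp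
  finally show ?thesis using of_nat_eq_iff by blast
qed

text \<open>This relation makes \<open>\<epsilon>\<^sub>g\<close> the indicator of \<open>g\<close> on \<open>G\<close>.\<close>

lemma char_orthogonality:
  assumes roots: "all_roots_of_1 TYPE('k::field_char_0)"
    and g: "g \<in> carrier G" and h: "h \<in> carrier G"
  shows "(\<Sum>\<gamma>\<in>carrier (char_group G). \<gamma> (inv g) * \<gamma> h)
    = (if g = h then of_nat (card (carrier G)) else (0::'k))"
proof -
  have "(\<Sum>\<gamma>\<in>carrier (char_group G). \<gamma> (inv g) * \<gamma> h)
    = (\<Sum>\<gamma>\<in>carrier (char_group G). (\<gamma> (inv g \<otimes> h) :: 'k))"
    using g h by (intro sum.cong) (auto simp: char_groupD)
  also have "\<dots> = (if g = h then of_nat (card (carrier G)) else (0::'k))"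
  proof (cases "g = h")
    case True
    then show ?thesis using g h card_chars[OF roots] by (simp add: char_groupD(3))
  next
    case False
    then have "inv g \<otimes> h \<noteq> \<one>" using g h by (metis inv_inv inv_equality inv_closed r_inv inv_solve_left' r_one)
    then show ?thesis using sum_chars_eq_0[OF roots] g h False by simp
  qed
  finally show ?thesis .
qed

end

section \<open>Finitely supported functions as linear combinations\<close>

lemma poly_mapping_eq_sum_single:
  "p = (\<Sum>w\<in>Poly_Mapping.keys p. Poly_Mapping.single w (Poly_Mapping.lookup p w))"
proof (rule poly_mapping_eqI)
  fix v
  have "(\<Sum>w\<in>Poly_Mapping.keys p. Poly_Mapping.lookup (Poly_Mapping.single w (Poly_Mapping.lookup p w)) v)
      = (\<Sum>w\<in>Poly_Mapping.keys p. if w = v then Poly_Mapping.lookup p w else 0)"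
    by (intro sum.cong) (auto simp: lookup_single)
  also have "\<dots> = Poly_Mapping.lookup p v"
    by (simp add: sum.delta in_keys_iff)
  finally show "Poly_Mapping.lookup p v = Poly_Mapping.lookup
      (\<Sum>w\<in>Poly_Mapping.keys p. Poly_Mapping.single w (Poly_Mapping.lookup p w)) v"
    by (simp add: lookup_sum)
qed

text \<open>Linear statements about combinations of elements of \<open>M\<close> follow from the case of a single
  element; the support condition is how carriers of monoid algebras are described.\<close>

lemma supported_induct [consumes 1, case_names zero single add]:
  assumes "Poly_Mapping.keys p \<subseteq> M" and "P 0"
    and s: "\<And>w c. w \<in> M \<Longrightarrow> P (Poly_Mapping.single w c)"
    and a: "\<And>p q. Poly_Mapping.keys p \<subseteq> M \<Longrightarrow> Poly_Mapping.keys q \<subseteq> M \<Longrightarrow> P p \<Longrightarrow> P q \<Longrightarrow> P (p + q)"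
  shows "P (p :: 'm \<Rightarrow>\<^sub>0 'k::comm_monoid_add)"
proof -
  have "P (\<Sum>w\<in>A. Poly_Mapping.single w (g w)) \<and>
      Poly_Mapping.keys (\<Sum>w\<in>A. Poly_Mapping.single w (g w)) \<subseteq> M"
    if "finite A" "A \<subseteq> M" for A and g :: "'m \<Rightarrow> 'k"
    using that
  proof (induction A)
    case empty
    then show ?case using assms(2) by simp
  next
    case (insert w A)
    have k: "Poly_Mapping.keys (Poly_Mapping.single w (g w)) \<subseteq> M" using insert by simp
    with insert a[OF k _ s] keys_add[of "Poly_Mapping.single w (g w)" "\<Sum>w\<in>A. Poly_Mapping.single w (g w)"]
    show ?case by auto
  qed
  from this[of "Poly_Mapping.keys p" "Poly_Mapping.lookup p"] assms(1)
  show ?thesis using poly_mapping_eq_sum_single[of p] by simp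
qed

definition lin_ext :: "('m \<Rightarrow> 'k) \<Rightarrow> ('m \<Rightarrow>\<^sub>0 'k) \<Rightarrow> 'k::field"
  where "lin_ext \<phi> p = (\<Sum>w\<in>Poly_Mapping.keys p. Poly_Mapping.lookup p w * \<phi> w)"

lemma lin_ext_zero [simp]: "lin_ext \<phi> 0 = 0"
  by (simp add: lin_ext_def)

lemma lin_ext_single [simp]: "lin_ext \<phi> (Poly_Mapping.single w c) = c * \<phi> w"
  by (simp add: lin_ext_def)

lemma lin_ext_add: "lin_ext \<phi> (p + q) = lin_ext \<phi> p + lin_ext \<phi> q"
  unfolding lin_ext_def by (rule setsum_keys_plus_distrib) (auto simp: algebra_simps)

lemma lin_ext_uminus: "lin_ext \<phi> (- p) = - lin_ext \<phi> p"
  using lin_ext_add[of \<phi> p "- p"] by (simp add: eq_neg_iff_add_eq_0 add.commute)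

lemma lin_ext_diff: "lin_ext \<phi> (p - q) = lin_ext \<phi> p - lin_ext \<phi> q"
  using lin_ext_add[of \<phi> p "- q"] by (simp add: lin_ext_uminus)

lemma scal_zero [simp]: "scal 0 = 0" by (simp add: scal_def)
lemma scal_one [simp]: "scal 1 = 1" by (simp add: scal_def)
lemma scal_add: "scal (a + b) = scal a + scal b" by (simp add: scal_def single_add)
lemma scal_mult: "scal (a * b) = scal a * scal b" by (simp add: scal_def mult_single)

lemma scal_mult_single: "scal c * Poly_Mapping.single w d = Poly_Mapping.single w (c * d)"
  by (simp add: scal_def mult_single)

lemma scal_commute: "scal c * p = p * scal c"
proof -
  have "Poly_Mapping.keys p \<subseteq> UNIV" by simp
  then show ?thesis
    by (induction rule: supported_induct) (auto simp: scal_def mult_single algebra_simps)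
qed

lemma lin_ext_scal: "lin_ext \<phi> (scal c * p) = c * lin_ext \<phi> p"
proof -
  have "Poly_Mapping.keys p \<subseteq> UNIV" by simp
  then show ?thesis
    by (induction rule: supported_induct)
      (auto simp: scal_mult_single distrib_left lin_ext_add mult.assoc)
qed

subsection \<open>Algebra maps out of the free algebra\<close>

text \<open>Scalars have to become central in the target, or the extension would not be multiplicative.\<close>

locale scalar_embedding =
  fixes sc :: "'k::field \<Rightarrow> 'r::ring_1"
  assumes sc_zero: "sc 0 = 0" and sc_one: "sc 1 = 1" and sc_add: "sc (a + b) = sc a + sc b"
    and sc_mult: "sc (a * b) = sc a * sc b" and sc_central: "sc a * r = r * sc a"
begin

lemma alg_ext_zero [simp]: "alg_ext sc \<phi> 0 = 0"
  by (simp add: alg_ext_def)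

lemma alg_ext_single: "alg_ext sc \<phi> (Poly_Mapping.single w c) = sc c * prod_list (map \<phi> (letters w))"
  by (simp add: alg_ext_def sc_zero)

lemma alg_ext_add: "alg_ext sc \<phi> (p + q) = alg_ext sc \<phi> p + alg_ext sc \<phi> q"
  unfolding alg_ext_def by (rule setsum_keys_plus_distrib) (auto simp: sc_zero sc_add algebra_simps)

lemma alg_ext_uminus: "alg_ext sc \<phi> (- p) = - alg_ext sc \<phi> p"
  using alg_ext_add[of \<phi> p "- p"] by (simp add: eq_neg_iff_add_eq_0 add.commute)

lemma alg_ext_diff: "alg_ext sc \<phi> (p - q) = alg_ext sc \<phi> p - alg_ext sc \<phi> q"
  using alg_ext_add[of \<phi> p "- q"] by (simp add: alg_ext_uminus)

lemma alg_ext_mult: "alg_ext sc \<phi> (p * q) = alg_ext sc \<phi> p * alg_ext sc \<phi> q"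
proof -
  have pU: "Poly_Mapping.keys p \<subseteq> UNIV" and qU: "Poly_Mapping.keys q \<subseteq> UNIV" by simp_all
  have 1: "alg_ext sc \<phi> (Poly_Mapping.single u a * q) = alg_ext sc \<phi> (Poly_Mapping.single u a) * alg_ext sc \<phi> q"
    for u a
    using qU
  proof (induction rule: supported_induct)
    case (single v b)
    let ?U = "prod_list (map \<phi> (letters u))" and ?V = "prod_list (map \<phi> (letters v))"
    have "alg_ext sc \<phi> (Poly_Mapping.single u a * Poly_Mapping.single v b) = sc a * (sc b * ?U) * ?V"
      by (simp add: mult_single alg_ext_single sc_mult plus_word_def mult.assoc)
    also have "\<dots> = sc a * (?U * sc b) * ?V" by (simp only: sc_central)
    finally show ?case by (simp add: alg_ext_single mult.assoc)
  qed (auto simp: alg_ext_add distrib_left)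
  show ?thesis
    using pU by (induction rule: supported_induct) (auto simp: 1 alg_ext_add distrib_right)
qed

lemma alg_ext_one: "alg_ext sc \<phi> 1 = 1"
  by (simp add: single_one[symmetric] alg_ext_single sc_one zero_word_def del: single_one)

lemma alg_ext_power: "alg_ext sc \<phi> (p ^ n) = alg_ext sc \<phi> p ^ n"
  by (induction n) (auto simp: alg_ext_one alg_ext_mult)

lemma alg_ext_gen: "alg_ext sc \<phi> (gen x) = \<phi> x"
  by (simp add: gen_def alg_ext_single sc_one)

lemma alg_ext_scal: "alg_ext sc \<phi> (scal c) = sc c"
  by (simp add: scal_def alg_ext_single zero_word_def)

end

interpretation scal_emb: scalar_embedding "scal :: 'k::field \<Rightarrow> 'm::monoid_add \<Rightarrow>\<^sub>0 'k"
  by unfold_locales (simp, simp, rule scal_add, rule scal_mult, rule scal_commute)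

interpretation id_emb: scalar_embedding "\<lambda>c::'k::field. c"
  by unfold_locales auto

subsection \<open>Pure tensors\<close>

lemma ptens_single [simp]:
  "ptens (Poly_Mapping.single u a) (Poly_Mapping.single v b) = Poly_Mapping.single (u, v) (a * b)"
  by (cases "a = 0"; cases "b = 0") (auto simp: ptens_def)

lemma ptens_add_left: "ptens (x + x') y = ptens x y + ptens x' y"
  unfolding ptens_def
  by (rule setsum_keys_plus_distrib) (auto simp: distrib_right single_add sum.distrib)

lemma ptens_add_right: "ptens x (y + y') = ptens x y + ptens x y'"
proof -
  have "(\<Sum>v\<in>Poly_Mapping.keys (y + y'). Poly_Mapping.single (u, v) (Poly_Mapping.lookup x u * Poly_Mapping.lookup (y + y') v))
      = (\<Sum>v\<in>Poly_Mapping.keys y. Poly_Mapping.single (u, v) (Poly_Mapping.lookup x u * Poly_Mapping.lookup y v)) +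
        (\<Sum>v\<in>Poly_Mapping.keys y'. Poly_Mapping.single (u, v) (Poly_Mapping.lookup x u * Poly_Mapping.lookup y' v))" for u
    by (rule setsum_keys_plus_distrib) (auto simp: distrib_left single_add)
  then show ?thesis unfolding ptens_def by (simp add: sum.distrib)
qed

lemma ptens_zero [simp]: "ptens 0 y = 0" "ptens x 0 = 0"
  by (auto simp: ptens_def)

lemma ptens_uminus_left: "ptens (- x) y = - ptens x y"
  using ptens_add_left[of x "- x" y] by (simp add: eq_neg_iff_add_eq_0 add.commute)

lemma ptens_uminus_right: "ptens x (- y) = - ptens x y"
  using ptens_add_right[of x y "- y"] by (simp add: eq_neg_iff_add_eq_0 add.commute)

lemma ptens_diff_left: "ptens (x - x') y = ptens x y - ptens x' y"
  using ptens_add_left[of x "- x'" y] by (simp add: ptens_uminus_left)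

lemma ptens_diff_right: "ptens x (y - y') = ptens x y - ptens x y'"
  using ptens_add_right[of x y "- y'"] by (simp add: ptens_uminus_right)

text \<open>Bilinearity reduces this to pure words, one tensor factor at a time.\<close>

lemma ptens_mult: "ptens x y * ptens x' y' = ptens (x * x') (y * y')"
proof -
  have U: "Poly_Mapping.keys p \<subseteq> UNIV" for p :: "'a \<Rightarrow>\<^sub>0 'b" by simp
  let ?s = "Poly_Mapping.single"
  have 1: "ptens (?s u a) (?s v b) * ptens (?s u' a') y' = ptens (?s u a * ?s u' a') (?s v b * y')"
    for u v u' a b a' using U[of y']
    by (induction rule: supported_induct) (auto simp: mult_single ptens_add_right distrib_left mult_ac)
  have 2: "ptens (?s u a) (?s v b) * ptens x' y' = ptens (?s u a * x') (?s v b * y')" for u v a b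
    using U[of x'] by (induction rule: supported_induct)
      (auto simp: 1[unfolded ptens_single] ptens_add_left distrib_left)
  have 3: "ptens (?s u a) y * ptens x' y' = ptens (?s u a * x') (y * y')" for u a
    using U[of y] by (induction rule: supported_induct)
      (auto simp: 2[unfolded ptens_single] ptens_add_right distrib_right)
  show ?thesis
    using U[of x] by (induction rule: supported_induct) (auto simp: 3 ptens_add_left distrib_right)
qed

lemma ptens_one: "ptens 1 1 = 1"
  using ptens_single[of 0 1 0 1] by (simp add: zero_prod_def[symmetric])

lemma ptens_scal: "ptens (scal c * x) y = scal c * ptens x y" "ptens x (scal c * y) = scal c * ptens x y"
proof -
  have "ptens (scal c) 1 = scal c" "ptens 1 (scal c) = (scal c :: 'a \<times> 'a \<Rightarrow>\<^sub>0 'b)"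
    using ptens_single[of 0 c 0 1] ptens_single[of 0 1 0 c]
    by (auto simp: zero_prod_def[symmetric] scal_def)
  then show "ptens (scal c * x) y = scal c * ptens x y" "ptens x (scal c * y) = scal c * ptens x y"
    by (metis ptens_mult mult_1_left)+
qed

lemma ptens_scal_unit: "ptens (scal c) y = scal c * ptens 1 y" "ptens x (scal c) = scal c * ptens x 1"
  using ptens_scal(1)[of c 1 y] ptens_scal(2)[of x c 1] by simp_all

lemma ptens_power: "ptens x y ^ n = ptens (x ^ n) (y ^ n)"
  by (induction n) (auto simp: ptens_one ptens_mult)

lemma keys_ptens: "Poly_Mapping.keys (ptens x y) \<subseteq> Poly_Mapping.keys x \<times> Poly_Mapping.keys y"
proof -
  have "Poly_Mapping.lookup (ptens x y) w = 0" if "w \<notin> Poly_Mapping.keys x \<times> Poly_Mapping.keys y" for w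
    using that unfolding ptens_def
    by (auto simp: lookup_sum lookup_single when_def intro!: sum.neutral)
  then show ?thesis by (auto simp: in_keys_iff)
qed

lemma lin_ext_ptens:
  fixes x y :: "'m::monoid_add \<Rightarrow>\<^sub>0 'k::field"
  shows "lin_ext (\<lambda>(u, v). \<phi> u * \<psi> v) (ptens x y) = lin_ext \<phi> x * lin_ext \<psi> y"
proof -
  have U: "Poly_Mapping.keys p \<subseteq> UNIV" for p :: "'m \<Rightarrow>\<^sub>0 'k" by simp
  have 1: "lin_ext (\<lambda>(u, v). \<phi> u * \<psi> v) (ptens (Poly_Mapping.single u a) y) = a * \<phi> u * lin_ext \<psi> y" for u a
    using U[of y] by (induction rule: supported_induct) (auto simp: ptens_add_right lin_ext_add distrib_left)
  show ?thesis
    using U[of x] by (induction rule: supported_induct) (auto simp: 1 ptens_add_left lin_ext_add distrib_right)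
qed

section \<open>Congruence modulo an ideal of a subring\<close>

text \<open>The free algebras are subsets of rings that are types, but their ideals are ideals of the subset
  only.  A congruence that includes membership in the subring allows calculations with
  representatives in the ambient ring instead of with cosets.\<close>

locale subring_ideal =
  fixes S I :: "'a::ring_1 set"
  assumes S_one: "1 \<in> S" and S_diff: "x \<in> S \<Longrightarrow> y \<in> S \<Longrightarrow> x - y \<in> S"
    and S_mult: "x \<in> S \<Longrightarrow> y \<in> S \<Longrightarrow> x * y \<in> S"
    and I_sub: "I \<subseteq> S" and I_zero: "0 \<in> I" and I_diff: "x \<in> I \<Longrightarrow> y \<in> I \<Longrightarrow> x - y \<in> I"
    and I_left: "x \<in> S \<Longrightarrow> y \<in> I \<Longrightarrow> x * y \<in> I" and I_right: "x \<in> I \<Longrightarrow> y \<in> S \<Longrightarrow> x * y \<in> I"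
begin

lemma S_zero: "0 \<in> S" using S_diff[OF S_one S_one] by simp
lemma S_uminus: "x \<in> S \<Longrightarrow> - x \<in> S" using S_diff[OF S_zero] by force
lemma S_add: "x \<in> S \<Longrightarrow> y \<in> S \<Longrightarrow> x + y \<in> S" using S_diff[of x "- y"] S_uminus by simp
lemma S_power: "x \<in> S \<Longrightarrow> x ^ n \<in> S" by (induction n) (auto simp: S_one S_mult)
lemma I_uminus: "x \<in> I \<Longrightarrow> - x \<in> I" using I_diff[OF I_zero] by force
lemma I_add: "x \<in> I \<Longrightarrow> y \<in> I \<Longrightarrow> x + y \<in> I" using I_diff[of x "- y"] I_uminus by simp

definition cong (infix \<open>\<approx>\<close> 50) where "x \<approx> y \<longleftrightarrow> x \<in> S \<and> y \<in> S \<and> x - y \<in> I"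

lemma congD: "x \<approx> y \<Longrightarrow> x \<in> S" "x \<approx> y \<Longrightarrow> y \<in> S" "x \<approx> y \<Longrightarrow> x - y \<in> I"
  by (auto simp: cong_def)

lemma cong_refl [intro]: "x \<in> S \<Longrightarrow> x \<approx> x" by (simp add: cong_def I_zero)

lemma cong_sym: "x \<approx> y \<Longrightarrow> y \<approx> x"
  unfolding cong_def using I_uminus[of "x - y"] by auto

lemma cong_trans [trans]: "x \<approx> y \<Longrightarrow> y \<approx> z \<Longrightarrow> x \<approx> z"
  unfolding cong_def using I_add[of "x - y" "y - z"] by auto

lemma cong_add: "x \<approx> x' \<Longrightarrow> y \<approx> y' \<Longrightarrow> x + y \<approx> x' + y'"
  unfolding cong_def using I_add[of "x - x'" "y - y'"] S_add by (auto simp: algebra_simps)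

lemma cong_mult: "x \<approx> x' \<Longrightarrow> y \<approx> y' \<Longrightarrow> x * y \<approx> x' * y'"
proof -
  assume a: "x \<approx> x'" "y \<approx> y'"
  have "x * y - x' * y' = (x - x') * y + x' * (y - y')" by (simp add: algebra_simps)
  then show ?thesis
    using a I_add[OF I_right[of "x - x'" y] I_left[of x' "y - y'"]] S_mult by (auto simp: cong_def)
qed

lemma cong_sum: "(\<And>k. k \<in> A \<Longrightarrow> f k \<approx> g k) \<Longrightarrow> sum f A \<approx> sum g A"
  by (induction A rule: infinite_finite_induct) (auto intro: cong_add cong_refl S_zero)

end

section \<open>The \<open>q\<close>-binomial formula\<close>

text \<open>The Gaussian binomial coefficients by their Pascal recursion, which is the form in which they
  arise from \<open>(x + y)\<^sup>n\<^sup>+\<^sup>1 = (x + y)(x + y)\<^sup>n\<close> and makes sense when \<open>q\<close> is a root of unity, where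
  the quotient of \<open>q\<close>-factorials does not.\<close>

fun qbin :: "'k::field \<Rightarrow> nat \<Rightarrow> nat \<Rightarrow> 'k"
  where
    "qbin q n 0 = 1"
  | "qbin q 0 (Suc k) = 0"
  | "qbin q (Suc n) (Suc k) = qbin q n k + q ^ Suc k * qbin q n (Suc k)"

lemma qbin_eq_0: "n < k \<Longrightarrow> qbin q n k = 0"
  by (induction q n k rule: qbin.induct) auto

lemma qnum_add: "qnum q (a + b) = qnum q a + q ^ a * qnum q b"
  by (induction b) (auto simp: qnum_def power_add algebra_simps)

lemma qfact_Suc: "qfact q (Suc n) = qfact q n * qnum q (Suc n)"
  by (simp add: qfact_def)

lemma qfact_0 [simp]: "qfact q 0 = 1"
  by (simp add: qfact_def)

lemma qbin_qfact: "k \<le> n \<Longrightarrow> qbin q n k * (qfact q k * qfact q (n - k)) = qfact q n"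
proof (induction q n k rule: qbin.induct)
  case (3 q n k)
  have 1: "qbin q n k * (qfact q (Suc k) * qfact q (n - k)) = qfact q n * qnum q (Suc k)"
    using 3 by (simp add: qfact_Suc mult_ac)
  have 2: "qbin q n (Suc k) * (qfact q (Suc k) * qfact q (n - k)) = qfact q n * qnum q (n - k)"
  proof (cases "k = n")
    case True then show ?thesis by (simp add: qbin_eq_0 qnum_def)
  next
    case False
    then obtain l where l: "n - k = Suc l" "n - Suc k = l" using 3(3) by (metis Suc_diff_Suc Suc_leD Suc_le_mono le_neq_implies_less)
    then show ?thesis using 3 False by (simp add: qfact_Suc[of q l] mult_ac)
  qed
  have "qbin q (Suc n) (Suc k) * (qfact q (Suc k) * qfact q (Suc n - Suc k))
     = qbin q n k * (qfact q (Suc k) * qfact q (n - k))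
       + q ^ Suc k * (qbin q n (Suc k) * (qfact q (Suc k) * qfact q (n - k)))"
    by (simp add: algebra_simps)
  also have "\<dots> = qfact q n * (qnum q (Suc k) + q ^ Suc k * qnum q (n - k))"
    unfolding 1 2 by (simp add: algebra_simps)
  also have "\<dots> = qfact q (Suc n)"
    using 3(3) qnum_add[of q "Suc k" "n - k"] by (simp add: qfact_Suc)
  finally show ?case .
qed auto

lemma qnum_mult: "(1 - q) * qnum q n = 1 - q ^ n"
  by (simp add: qnum_def one_diff_power_eq)

text \<open>The order is defined as a least exponent, so it is attained only for roots of unity, which \<open>e\<close>
  witnesses; an order of at least \<open>2\<close> excludes \<open>q = 1\<close>, where \<open>(m)\<close> would be \<open>m\<close>.\<close>

lemma qnum_mult_order_eq_0:
  assumes "q ^ e = 1" "e > 0" "mult_order q \<ge> 2"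
  shows "q ^ mult_order q = 1" "q \<noteq> 1" "qnum q (mult_order q) = 0"
proof -
  let ?P = "\<lambda>d. d > 0 \<and> q ^ d = 1"
  have "?P (mult_order q)" unfolding mult_order_def using assms by (intro LeastI[of ?P e]) auto
  then show 1: "q ^ mult_order q = 1" by simp
  show 2: "q \<noteq> 1"
    using Least_le[of ?P 1] assms(3) unfolding mult_order_def by auto
  show "qnum q (mult_order q) = 0" using qnum_mult[of q "mult_order q"] 1 2 by simp
qed

lemma qfact_nonzero:
  assumes "c < mult_order q" "mult_order q \<ge> 2" shows "qfact q c \<noteq> 0"
proof -
  have "qnum q j \<noteq> 0" if "j \<ge> 1" "j \<le> c" for j
  proof
    assume "qnum q j = 0"
    then have "q ^ j = 1" using qnum_mult[of q j] by simp
    then have "mult_order q \<le> j"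
      unfolding mult_order_def using that by (intro Least_le) auto
    then show False using that assms by simp
  qed
  then show ?thesis by (auto simp: qfact_def)
qed

text \<open>In the product formula \<open>qbin_qfact\<close> the right-hand side contains the factor \<open>(m) = 0\<close>, while the
  factorials of smaller numbers are nonzero.\<close>

lemma qbin_mult_order_eq_0:
  assumes "q ^ e = 1" "e > 0" "mult_order q \<ge> 2" "0 < k" "k < mult_order q"
  shows "qbin q (mult_order q) k = 0"
proof -
  let ?m = "mult_order q"
  obtain l where l: "?m = Suc l" using assms(3) by (cases ?m) auto
  have "qfact q ?m = 0" using qnum_mult_order_eq_0(3)[OF assms(1-3)] unfolding l by (simp add: qfact_Suc)
  then have "qbin q ?m k * (qfact q k * qfact q (?m - k)) = 0" using qbin_qfact[of k ?m q] assms by simp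
  then show ?thesis using qfact_nonzero[of _ q] assms by auto
qed

locale scalar_subring_ideal = subring_ideal S I + scalar_embedding sc
  for S I :: "'r::ring_1 set" and sc :: "'k::field \<Rightarrow> 'r" +
  assumes S_sc: "sc c \<in> S"
begin

lemma q_commute_power:
  assumes xy: "y * x \<approx> sc q * (x * y)" and S: "x \<in> S" "y \<in> S"
  shows "y * x ^ k \<approx> sc (q ^ k) * (x ^ k * y)"
proof (induction k)
  case 0
  then show ?case using S by (simp add: sc_one cong_refl)
next
  case (Suc k)
  have "y * x ^ Suc k = (y * x ^ k) * x" by (simp add: power_Suc2 mult.assoc del: power_Suc)
  also have "\<dots> \<approx> sc (q ^ k) * (x ^ k * y) * x"
    by (intro cong_mult Suc cong_refl S)
  also have "sc (q ^ k) * (x ^ k * y) * x = sc (q ^ k) * (x ^ k * (y * x))" by (simp add: mult.assoc)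
  also have "\<dots> \<approx> sc (q ^ k) * (x ^ k * (sc q * (x * y)))"
    by (intro cong_mult xy cong_refl S_sc S_power S)
  also have "\<dots> = sc (q ^ k) * ((x ^ k * sc q) * (x * y))" by (simp add: mult.assoc)
  also have "\<dots> = sc (q ^ k) * ((sc q * x ^ k) * (x * y))" by (simp only: sc_central)
  also have "\<dots> = sc (q ^ Suc k) * (x ^ Suc k * y)"
    by (simp add: mult.assoc power_Suc2 sc_mult del: power_Suc)
  finally show ?case .
qed

lemma q_binomial:
  assumes xy: "y * x \<approx> sc q * (x * y)" and S: "x \<in> S" "y \<in> S"
  shows "(x + y) ^ n \<approx> (\<Sum>k\<le>n. sc (qbin q n k) * (x ^ k * y ^ (n - k)))"
proof (induction n)
  case 0
  then show ?case by (simp add: sc_one cong_refl S_one)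
next
  case (Suc n)
  let ?B = "\<lambda>k. sc (qbin q n k)"
  have "(x + y) ^ Suc n \<approx> (x + y) * (\<Sum>k\<le>n. ?B k * (x ^ k * y ^ (n - k)))"
    by (simp, intro cong_mult Suc cong_refl S_add S)
  also have "\<dots> = (\<Sum>k\<le>n. ?B k * (x ^ Suc k * y ^ (n - k)) + ?B k * ((y * x ^ k) * y ^ (n - k)))"
    unfolding sum_distrib_left
  proof (intro sum.cong refl)
    fix k
    have "(x + y) * (?B k * (x ^ k * y ^ (n - k))) = ((x + y) * ?B k) * (x ^ k * y ^ (n - k))"
      by (simp add: mult.assoc)
    also have "\<dots> = ?B k * ((x + y) * (x ^ k * y ^ (n - k)))"
      by (simp only: sc_central[symmetric] mult.assoc)
    finally show "(x + y) * (?B k * (x ^ k * y ^ (n - k)))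
        = ?B k * (x ^ Suc k * y ^ (n - k)) + ?B k * ((y * x ^ k) * y ^ (n - k))"
      by (simp add: algebra_simps)
  qed
  also have "\<dots> \<approx> (\<Sum>k\<le>n. ?B k * (x ^ Suc k * y ^ (n - k)) + ?B k * ((sc (q ^ k) * (x ^ k * y)) * y ^ (n - k)))"
    by (intro cong_sum cong_add cong_mult q_commute_power xy S cong_refl S_sc S_mult S_power)
  also have "\<dots> = (\<Sum>k\<le>n. ?B k * (x ^ Suc k * y ^ (n - k)))
      + (\<Sum>k\<le>n. sc (q ^ k * qbin q n k) * (x ^ k * y ^ (Suc n - k)))"
    by (subst sum.distrib[symmetric], rule sum.cong)
      (auto simp: sc_mult mult.assoc Suc_diff_le mult.commute[of "q ^ _"])
  also have "(\<Sum>k\<le>n. sc (q ^ k * qbin q n k) * (x ^ k * y ^ (Suc n - k)))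
      = (\<Sum>k\<le>Suc n. sc (q ^ k * qbin q n k) * (x ^ k * y ^ (Suc n - k)))"
    by (simp add: qbin_eq_0 sc_zero)
  also have "\<dots> = y ^ Suc n + (\<Sum>k\<le>n. sc (q ^ Suc k * qbin q n (Suc k)) * (x ^ Suc k * y ^ (n - k)))"
    by (subst sum.atMost_Suc_shift) (simp add: sc_one)
  also have "(\<Sum>k\<le>n. ?B k * (x ^ Suc k * y ^ (n - k))) + \<dots>
      = y ^ Suc n + (\<Sum>k\<le>n. sc (qbin q (Suc n) (Suc k)) * (x ^ Suc k * y ^ (n - k)))"
    by (simp add: sc_add distrib_right sum.distrib del: power_Suc)
  also have "\<dots> = (\<Sum>k\<le>Suc n. sc (qbin q (Suc n) k) * (x ^ k * y ^ (Suc n - k)))"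
    by (subst sum.atMost_Suc_shift[of "\<lambda>k. sc (qbin q (Suc n) k) * (x ^ k * y ^ (Suc n - k))"])
      (simp add: sc_one del: power_Suc qbin.simps(3))
  finally show ?case .
qed

text \<open>The mixed terms of the \<open>q\<close>-binomial formula have coefficient \<open>0\<close>.\<close>

lemma q_freshman:
  assumes xy: "y * x \<approx> sc q * (x * y)" and S: "x \<in> S" "y \<in> S"
    and q: "q ^ e = 1" "e > 0" "mult_order q \<ge> 2"
  shows "(x + y) ^ mult_order q \<approx> x ^ mult_order q + y ^ mult_order q"
proof -
  let ?m = "mult_order q"
  let ?f = "\<lambda>k. sc (qbin q ?m k) * (x ^ k * y ^ (?m - k))"
  have mm: "qbin q ?m ?m = 1"
    using qbin_qfact[of ?m ?m q]
  proof -
    have "qbin q n n = 1" for n by (induction n) (auto simp: qbin_eq_0)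
    then show ?thesis .
  qed
  have "(\<Sum>k\<le>?m. ?f k) = (\<Sum>k\<in>{0, ?m}. ?f k)"
  proof (rule sum.mono_neutral_right)
    have "qbin q ?m k = 0" if "k \<in> {..?m} - {0, ?m}" for k
      using that by (intro qbin_mult_order_eq_0[OF q]) auto
    then show "\<forall>k\<in>{..?m} - {0, ?m}. ?f k = 0" by (simp add: sc_zero)
  qed auto
  also have "\<dots> = x ^ ?m + y ^ ?m" using q(3) mm by (simp add: sc_one add.commute)
  finally show ?thesis using q_binomial[OF xy S, of ?m] by simp
qed

end

section \<open>Monoid algebras and their quotients\<close>

locale submonoid_words =
  fixes M :: "'m::monoid_add set"
  assumes M_zero: "0 \<in> M" and M_add: "u \<in> M \<Longrightarrow> v \<in> M \<Longrightarrow> u + v \<in> M"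
begin

lemma mon_alg_simps:
  "carrier (mon_alg M) = {p. Poly_Mapping.keys p \<subseteq> M}"
  "x \<otimes>\<^bsub>mon_alg M\<^esub> y = x * y" "x \<oplus>\<^bsub>mon_alg M\<^esub> y = x + y"
  "\<one>\<^bsub>mon_alg M\<^esub> = 1" "\<zero>\<^bsub>mon_alg M\<^esub> = 0"
  by (auto simp: mon_alg_def)

lemma mon_alg_uminus:
  "z \<in> carrier (mon_alg M) \<Longrightarrow> - (z :: 'm \<Rightarrow>\<^sub>0 'k::field) \<in> carrier (mon_alg M)"
  by (auto simp: mon_alg_simps in_keys_iff)

lemma mon_alg_closed:
  fixes x y :: "'m \<Rightarrow>\<^sub>0 'k::field"
  assumes "x \<in> carrier (mon_alg M)" "y \<in> carrier (mon_alg M)"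
  shows "x + y \<in> carrier (mon_alg M)" "x - y \<in> carrier (mon_alg M)" "x * y \<in> carrier (mon_alg M)"
proof -
  have a: "x + z \<in> carrier (mon_alg M)" if "z \<in> carrier (mon_alg M)" for z
    using assms that keys_add[of x z] by (auto simp: mon_alg_simps)
  show "x + y \<in> carrier (mon_alg M)" using a assms by auto
  show "x - y \<in> carrier (mon_alg M)" using a[OF mon_alg_uminus[OF assms(2)]] by simp
  show "x * y \<in> carrier (mon_alg M)"
    using assms keys_mult[of x y] M_add by (fastforce simp: mon_alg_simps)
qed

lemma mon_alg_one: "1 \<in> carrier (mon_alg M)" "0 \<in> carrier (mon_alg M)"
  using M_zero by (auto simp: mon_alg_simps)

lemma mon_alg_scal: "scal c \<in> carrier (mon_alg M)"
  using M_zero by (auto simp: mon_alg_simps scal_def)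

lemma ring_mon_alg: "ring (mon_alg M :: ('m \<Rightarrow>\<^sub>0 'k::field) ring)"
proof (rule ringI)
  show "abelian_group (mon_alg M :: ('m \<Rightarrow>\<^sub>0 'k) ring)"
  proof (rule abelian_groupI)
    fix x :: "'m \<Rightarrow>\<^sub>0 'k" assume x: "x \<in> carrier (mon_alg M)"
    have "- x \<oplus>\<^bsub>mon_alg M\<^esub> x = \<zero>\<^bsub>mon_alg M\<^esub>" by (simp add: mon_alg_simps)
    then show "\<exists>y\<in>carrier (mon_alg M). y \<oplus>\<^bsub>mon_alg M\<^esub> x = \<zero>\<^bsub>mon_alg M\<^esub>"
      using mon_alg_uminus[OF x] by blast
  qed (auto simp: mon_alg_simps(2-5) mon_alg_closed mon_alg_one add_ac)
  show "Group.monoid (mon_alg M :: ('m \<Rightarrow>\<^sub>0 'k) ring)"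
    by (rule monoidI) (auto simp: mon_alg_simps(2-5) mon_alg_closed mon_alg_one mult.assoc)
qed (auto simp: mon_alg_simps(2-5) algebra_simps)

lemma mon_alg_minus:
  assumes "x \<in> carrier (mon_alg M)" "y \<in> carrier (mon_alg M :: ('m \<Rightarrow>\<^sub>0 'k::field) ring)"
  shows "x \<ominus>\<^bsub>mon_alg M\<^esub> y = x - y"
proof -
  interpret R: ring "mon_alg M :: ('m \<Rightarrow>\<^sub>0 'k) ring" by (rule ring_mon_alg)
  have "\<ominus>\<^bsub>mon_alg M\<^esub> y = - y"
    using assms mon_alg_uminus by (intro R.minus_equality) (auto simp: mon_alg_simps(2-5))
  then show ?thesis by (simp add: a_minus_def mon_alg_simps)
qed

lemma mon_alg_idealI:
  assumes "I \<subseteq> carrier (mon_alg M :: ('m \<Rightarrow>\<^sub>0 'k::field) ring)" "0 \<in> I"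
    and d: "\<And>x y. x \<in> I \<Longrightarrow> y \<in> I \<Longrightarrow> x - y \<in> I"
    and "\<And>x a. a \<in> I \<Longrightarrow> x \<in> carrier (mon_alg M) \<Longrightarrow> x * a \<in> I"
    and "\<And>x a. a \<in> I \<Longrightarrow> x \<in> carrier (mon_alg M) \<Longrightarrow> a * x \<in> I"
  shows "ideal I (mon_alg M)"
proof -
  interpret R: ring "mon_alg M :: ('m \<Rightarrow>\<^sub>0 'k) ring" by (rule ring_mon_alg)
  have u: "- x \<in> I" if "x \<in> I" for x using d[OF assms(2) that] by simp
  have a: "x + y \<in> I" if "x \<in> I" "y \<in> I" for x y using d[OF that(1) u[OF that(2)]] by simp
  have "subgroup I (add_monoid (mon_alg M))"
  proof (rule R.add.subgroupI)
    fix x assume x: "x \<in> I"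
    then have xc: "x \<in> carrier (mon_alg M)" using assms(1) by blast
    have "\<ominus>\<^bsub>mon_alg M\<^esub> x = - x"
      using mon_alg_minus[OF mon_alg_one(2) xc] xc R.a_inv_closed[OF xc]
      by (simp add: a_minus_def mon_alg_simps)
    then show "\<ominus>\<^bsub>mon_alg M\<^esub> x \<in> I" using u[OF x] by simp
  qed (use assms a in \<open>auto simp: mon_alg_simps\<close>)
  then show ?thesis
    using assms by (intro idealI ring_mon_alg) (auto simp: mon_alg_simps(2-5))
qed

end

locale mon_alg_ideal = submonoid_words M for M :: "'m::monoid_add set" +
  fixes I :: "('m \<Rightarrow>\<^sub>0 'k::field) set"
  assumes ideal: "ideal I (mon_alg M)"
begin

sublocale I: ideal I "mon_alg M" by (rule ideal)

lemma coset_diff_iff: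
  assumes "x \<in> carrier (mon_alg M)" "y \<in> carrier (mon_alg M)"
  shows "I +>\<^bsub>mon_alg M\<^esub> x = I +>\<^bsub>mon_alg M\<^esub> y \<longleftrightarrow> x - y \<in> I"
  using I.quotient_eq_iff_same_a_r_cos[OF ideal assms] mon_alg_minus[OF assms] by simp

sublocale scalar_subring_ideal "carrier (mon_alg M)" I scal
proof unfold_locales
  show z: "0 \<in> I" using additive_subgroup.zero_closed[OF I.is_additive_subgroup] unfolding mon_alg_simps(5) .
  show "I \<subseteq> carrier (mon_alg M)" by (rule I.a_subset)
  show "x - y \<in> I" if "x \<in> I" "y \<in> I" for x y
  proof -
    have c: "x \<in> carrier (mon_alg M)" "y \<in> carrier (mon_alg M)" using that I.Icarr by auto
    have "x \<ominus>\<^bsub>mon_alg M\<^esub> y \<in> I"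
      unfolding a_minus_def
      by (intro additive_subgroup.a_closed[OF I.is_additive_subgroup] that
          additive_subgroup.a_inv_closed[OF I.is_additive_subgroup])
    then show ?thesis using mon_alg_minus[OF c] by simp
  qed
  show "x * y \<in> I" if "x \<in> carrier (mon_alg M)" "y \<in> I" for x y
    using I.I_l_closed[OF that(2,1)] by (simp add: mon_alg_simps)
  show "x * y \<in> I" if "x \<in> I" "y \<in> carrier (mon_alg M)" for x y
    using I.I_r_closed[OF that] by (simp add: mon_alg_simps)
qed (simp_all only: mon_alg_closed mon_alg_one mon_alg_scal)

lemma coset_eq_iff:
  assumes "x \<in> carrier (mon_alg M)" "y \<in> carrier (mon_alg M)"
  shows "I +>\<^bsub>mon_alg M\<^esub> x = I +>\<^bsub>mon_alg M\<^esub> y \<longleftrightarrow> cong x y"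
  using coset_diff_iff[OF assms] assms by (simp add: cong_def)

lemma mem_coset_iff:
  assumes "x \<in> carrier (mon_alg M)"
  shows "y \<in> I +>\<^bsub>mon_alg M\<^esub> x \<longleftrightarrow> cong y x"
proof
  assume "y \<in> I +>\<^bsub>mon_alg M\<^esub> x"
  then obtain i where "i \<in> I" "y = i + x" by (auto simp: a_r_coset_def' mon_alg_simps)
  then show "cong y x" using assms I_sub S_add by (auto simp: cong_def)
next
  assume "cong y x"
  then have "y - x \<in> I" by (simp add: cong_def)
  moreover have "y = (y - x) + x" by simp
  ultimately show "y \<in> I +>\<^bsub>mon_alg M\<^esub> x" unfolding a_r_coset_def' mon_alg_simps(3) by blast
qed

lemma carrier_quot: "carrier (mon_alg M Quot I) = (\<lambda>x. I +>\<^bsub>mon_alg M\<^esub> x) ` carrier (mon_alg M)"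
  by (auto simp: FactRing_def A_RCOSETS_def RCOSETS_def a_r_coset_def)

lemma quot_mult:
  assumes "x \<in> carrier (mon_alg M)" "y \<in> carrier (mon_alg M)"
  shows "(I +>\<^bsub>mon_alg M\<^esub> x) \<otimes>\<^bsub>mon_alg M Quot I\<^esub> (I +>\<^bsub>mon_alg M\<^esub> y) = I +>\<^bsub>mon_alg M\<^esub> (x * y)"
  using ring_hom_mult[OF I.rcos_ring_hom assms] by (simp add: mon_alg_simps)

lemma quot_add:
  assumes "x \<in> carrier (mon_alg M)" "y \<in> carrier (mon_alg M)"
  shows "(I +>\<^bsub>mon_alg M\<^esub> x) \<oplus>\<^bsub>mon_alg M Quot I\<^esub> (I +>\<^bsub>mon_alg M\<^esub> y) = I +>\<^bsub>mon_alg M\<^esub> (x + y)"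
  using ring_hom_add[OF I.rcos_ring_hom assms] by (simp add: mon_alg_simps)

lemma quot_one: "\<one>\<^bsub>mon_alg M Quot I\<^esub> = I +>\<^bsub>mon_alg M\<^esub> 1"
  by (simp add: FactRing_def mon_alg_simps)

end

section \<open>The Hopf algebra of a datum\<close>

locale qls =
  fixes D :: "('g, 'k::field) datum"
  assumes datum: "qls_datum D"
begin

sublocale grp: finite_comm_group "grp D"
  using datum by (simp add: qls_datum_def finite_comm_group_def finite_comm_group_axioms_def)

abbreviation "Gcar \<equiv> carrier (grp D)"
abbreviation "F \<equiv> carrier (free_alg D)"
abbreviation "F2 \<equiv> carrier (free_alg2 D)"
abbreviation gG :: "'g \<Rightarrow> ('g, 'k) free" where "gG g \<equiv> gen (Grp g)"
abbreviation gV :: "nat \<Rightarrow> ('g, 'k) free" where "gV i \<equiv> gen (Var i)"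
abbreviation a where "a i \<equiv> gel D i"
abbreviation chi where "chi i \<equiv> chr D i"

lemma gel_in: "i \<in> idx D \<Longrightarrow> a i \<in> Gcar"
  and chr_in: "i \<in> idx D \<Longrightarrow> chi i \<in> carrier (char_group (grp D))"
  and mm_ge: "i \<in> idx D \<Longrightarrow> mm D i \<ge> 2"
  using datum by (auto simp: qls_datum_def)

lemma qq_inverse: "i \<in> idx D \<Longrightarrow> j \<in> idx D \<Longrightarrow> i \<noteq> j \<Longrightarrow> qq D i j * qq D j i = 1"
  using datum by (auto simp: qls_datum_def qq_def mult.commute)

lemma qq_order: "i \<in> idx D \<Longrightarrow> qq D i i ^ order (grp D) = 1" "order (grp D) > 0"
proof -
  show "order (grp D) > 0" using grp.fin grp.order_gt_0_iff_finite by blast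
  assume i: "i \<in> idx D"
  show "qq D i i ^ order (grp D) = 1"
    using grp.char_pow[OF chr_in[OF i] gel_in[OF i], of "order (grp D)"]
      grp.pow_order_eq_1[OF gel_in[OF i]] grp.char_groupD(3)[OF chr_in[OF i]]
    by (simp add: qq_def)
qed

sublocale W: submonoid_words "words (gens D)"
  by unfold_locales (auto simp: words_def zero_word_def plus_word_def)

sublocale W2: submonoid_words "words (gens D) \<times> words (gens D)"
  using W.M_zero W.M_add by unfold_locales (auto simp: zero_prod_def plus_prod_def)

lemma F_eq: "F = {p. Poly_Mapping.keys p \<subseteq> words (gens D)}"
  by (simp add: free_alg_def mon_alg_def)

lemma F2_eq: "F2 = {p. Poly_Mapping.keys p \<subseteq> words (gens D) \<times> words (gens D)}"
  by (simp add: free_alg2_def mon_alg_def)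

lemma gen_in: "x \<in> gens D \<Longrightarrow> gen x \<in> F"
  by (auto simp: F_eq gen_def words_def)

lemma gG_in: "g \<in> Gcar \<Longrightarrow> gG g \<in> F" and gV_in: "i \<in> idx D \<Longrightarrow> gV i \<in> F"
  by (rule gen_in, simp add: gens_def)+

lemma ring_free_alg: "ring (free_alg D)"
  unfolding free_alg_def by (rule W.ring_mon_alg)

lemma F_closed:
  "x \<in> F \<Longrightarrow> y \<in> F \<Longrightarrow> x + y \<in> F" "x \<in> F \<Longrightarrow> y \<in> F \<Longrightarrow> x - y \<in> F"
  "x \<in> F \<Longrightarrow> y \<in> F \<Longrightarrow> x * y \<in> F" "1 \<in> F" "0 \<in> F" "scal c \<in> F"
  unfolding free_alg_def by (fact W.mon_alg_closed W.mon_alg_one W.mon_alg_scal)+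

lemma F_power: "x \<in> F \<Longrightarrow> x ^ n \<in> F"
  by (induction n) (auto intro: F_closed)

lemma rels_subset: "rels D \<subseteq> F"
  unfolding rels_def
  by (auto intro!: F_closed F_power gG_in gV_in gel_in)

lemma rel_ideal: "ideal (rel_ideal D) (free_alg D)"
  unfolding rel_ideal_def using ring.genideal_ideal[OF ring_free_alg rels_subset] .

sublocale H: mon_alg_ideal "words (gens D)" "rel_ideal D"
  using rel_ideal unfolding free_alg_def
  by (intro mon_alg_ideal.intro W.submonoid_words_axioms mon_alg_ideal_axioms.intro)

lemma ring_free_alg2: "ring (free_alg2 D)"
  unfolding free_alg2_def by (rule W2.ring_mon_alg)

lemma F2_closed:
  "x \<in> F2 \<Longrightarrow> y \<in> F2 \<Longrightarrow> x + y \<in> F2" "x \<in> F2 \<Longrightarrow> y \<in> F2 \<Longrightarrow> x - y \<in> F2"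
  "x \<in> F2 \<Longrightarrow> y \<in> F2 \<Longrightarrow> x * y \<in> F2" "1 \<in> F2" "0 \<in> F2" "scal c \<in> F2"
  unfolding free_alg2_def by (fact W2.mon_alg_closed W2.mon_alg_one W2.mon_alg_scal)+

lemma ptens_in: "x \<in> F \<Longrightarrow> y \<in> F \<Longrightarrow> ptens x y \<in> F2"
  using keys_ptens[of x y] by (fastforce simp: F_eq F2_eq)

lemma rel_ideal_sub: "rel_ideal D \<subseteq> F"
  using H.I_sub by (simp add: free_alg_def)

lemma rel_ideal2: "ideal (rel_ideal2 D) (free_alg2 D)"
  unfolding rel_ideal2_def
  by (rule ring.genideal_ideal[OF ring_free_alg2])
    (use rel_ideal_sub ptens_in F_closed in blast)

sublocale H2: mon_alg_ideal "words (gens D) \<times> words (gens D)" "rel_ideal2 D"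
  using rel_ideal2 unfolding free_alg2_def
  by (intro mon_alg_ideal.intro W2.submonoid_words_axioms mon_alg_ideal_axioms.intro)

abbreviation Hcong (infix \<open>\<approx>\<close> 50) where "x \<approx> y \<equiv> H.cong x y"
abbreviation H2cong (infix \<open>\<approx>\<^sub>2\<close> 50) where "x \<approx>\<^sub>2 y \<equiv> H2.cong x y"

lemma Hrefl: "x \<in> F \<Longrightarrow> x \<approx> x" by (rule H.cong_refl) (simp add: free_alg_def)
lemma H2refl: "x \<in> F2 \<Longrightarrow> x \<approx>\<^sub>2 x" by (rule H2.cong_refl) (simp add: free_alg2_def)

lemma HcongI: "x - y \<in> rel_ideal D \<Longrightarrow> x \<in> F \<Longrightarrow> y \<in> F \<Longrightarrow> x \<approx> y"
  by (simp add: H.cong_def free_alg_def)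

lemma H2congI: "x - y \<in> rel_ideal2 D \<Longrightarrow> x \<in> F2 \<Longrightarrow> y \<in> F2 \<Longrightarrow> x \<approx>\<^sub>2 y"
  by (simp add: H2.cong_def free_alg2_def)

lemma Hcong_in: "x \<approx> y \<Longrightarrow> x \<in> F" "x \<approx> y \<Longrightarrow> y \<in> F"
  by (auto simp: H.cong_def free_alg_def)

lemma rels_in_ideal: "rels D \<subseteq> rel_ideal D"
  unfolding rel_ideal_def
  by (rule ring.genideal_self[OF ring_free_alg rels_subset])

subsection \<open>The defining relations as congruences\<close>

lemma HcongR: "x - y \<in> rels D \<Longrightarrow> x \<in> F \<Longrightarrow> y \<in> F \<Longrightarrow> x \<approx> y"
  using rels_in_ideal by (blast intro: HcongI)

lemma rel_one: "gG \<one>\<^bsub>grp D\<^esub> \<approx> 1"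
  by (rule HcongR) (unfold rels_def, blast, auto intro!: gG_in F_closed)

lemma rel_mult: "g \<in> Gcar \<Longrightarrow> h \<in> Gcar \<Longrightarrow> gG g * gG h \<approx> gG (g \<otimes>\<^bsub>grp D\<^esub> h)"
  by (rule HcongR) (unfold rels_def, blast, auto intro!: gG_in F_closed)

lemma rel_pow: "i \<in> idx D \<Longrightarrow> gV i ^ mm D i \<approx> scal (mu D i) * (gG (a i [^]\<^bsub>grp D\<^esub> mm D i) - 1)"
  by (rule HcongR) (unfold rels_def, blast, auto intro!: gG_in gV_in F_closed F_power gel_in)

lemma rel_conj: "g \<in> Gcar \<Longrightarrow> i \<in> idx D \<Longrightarrow>
    gG g * gV i * gG (inv\<^bsub>grp D\<^esub> g) \<approx> scal (chi i g) * gV i"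
  by (rule HcongR) (unfold rels_def, blast, auto intro!: gG_in gV_in F_closed)

lemma rel_link:
  assumes "i \<in> idx D" "j \<in> idx D" "i \<noteq> j"
  shows "gV i * gV j \<approx> scal (qq D i j) * gV j * gV i + scal (lam D i j) * (gG (a i \<otimes>\<^bsub>grp D\<^esub> a j) - 1)"
proof (rule HcongR)
  show "gV i * gV j - (scal (qq D i j) * gV j * gV i + scal (lam D i j) * (gG (a i \<otimes>\<^bsub>grp D\<^esub> a j) - 1)) \<in> rels D"
    unfolding rels_def diff_diff_eq[symmetric] using assms by blast
qed (use assms in \<open>auto intro!: gG_in gV_in F_closed gel_in\<close>)

text \<open>The conjugation relation in the form used for moving group elements to the right.\<close>

lemma rel_comm:
  assumes g: "g \<in> Gcar" and i: "i \<in> idx D"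
  shows "gG g * gV i \<approx> scal (chi i g) * (gV i * gG g)"
proof -
  have ig: "inv\<^bsub>grp D\<^esub> g \<in> Gcar" using g by simp
  have "gG (inv\<^bsub>grp D\<^esub> g) * gG g \<approx> gG \<one>\<^bsub>grp D\<^esub>" using rel_mult[OF ig g] g by simp
  then have 1: "gG (inv\<^bsub>grp D\<^esub> g) * gG g \<approx> 1" using rel_one by (rule H.cong_trans)
  have "gG g * gV i = gG g * gV i * 1" by simp
  also have "\<dots> \<approx> gG g * gV i * (gG (inv\<^bsub>grp D\<^esub> g) * gG g)"
    by (intro H.cong_mult Hrefl gG_in gV_in g i H.cong_sym[OF 1])
  also have "\<dots> = (gG g * gV i * gG (inv\<^bsub>grp D\<^esub> g)) * gG g" by (simp add: mult.assoc)
  also have "\<dots> \<approx> (scal (chi i g) * gV i) * gG g"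
    by (intro H.cong_mult Hrefl gG_in g rel_conj i)
  finally show ?thesis by (simp add: mult.assoc)
qed

lemma gG_power: "g \<in> Gcar \<Longrightarrow> gG g ^ n \<approx> gG (g [^]\<^bsub>grp D\<^esub> (n::nat))"
proof (induction n)
  case 0 then show ?case using rel_one by (simp add: H.cong_sym)
next
  case (Suc n)
  have "gG g ^ Suc n = gG g ^ n * gG g" by (rule power_Suc2)
  also have "\<dots> \<approx> gG (g [^]\<^bsub>grp D\<^esub> n) * gG g" using Suc by (intro H.cong_mult Hrefl gG_in) auto
  also have "\<dots> \<approx> gG (g [^]\<^bsub>grp D\<^esub> n \<otimes>\<^bsub>grp D\<^esub> g)" using Suc by (intro rel_mult) auto
  finally show ?case by simp
qed

subsection \<open>Comultiplication and counit respect the relations\<close>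

lemma ptens_ideal:
  assumes "x \<in> rel_ideal D" shows "ptens x 1 \<in> rel_ideal2 D" "ptens 1 x \<in> rel_ideal2 D"
proof -
  have "(\<lambda>x. ptens x 1) ` rel_ideal D \<union> (\<lambda>x. ptens 1 x) ` rel_ideal D \<subseteq> rel_ideal2 D"
    unfolding rel_ideal2_def
    by (rule ring.genideal_self[OF ring_free_alg2])
      (use rel_ideal_sub ptens_in F_closed in blast)
  then show "ptens x 1 \<in> rel_ideal2 D" "ptens 1 x \<in> rel_ideal2 D" using assms by blast+
qed

lemma ptens_cong:
  assumes "x \<approx> x'" "y \<approx> y'" shows "ptens x y \<approx>\<^sub>2 ptens x' y'"
proof -
  have "ptens x 1 \<approx>\<^sub>2 ptens x' 1" "ptens 1 y \<approx>\<^sub>2 ptens 1 y'"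
    using assms ptens_ideal[of "x - x'"] ptens_ideal[of "y - y'"]
      ptens_in[of x 1] ptens_in[of x' 1] ptens_in[of 1 y] ptens_in[of 1 y'] F_closed
    by (auto simp: H2.cong_def H.cong_def ptens_diff_left ptens_diff_right free_alg2_def free_alg_def)
  from H2.cong_mult[OF this] show ?thesis by (simp add: ptens_mult)
qed

abbreviation Delta :: "('g, 'k) free \<Rightarrow> ('g, 'k) free2" where
  "Delta x \<equiv> alg_ext scal (comult_gen D) x"

lemma comult_gen_in: "x \<in> gens D \<Longrightarrow> comult_gen D x \<in> F2"
  by (auto simp: gens_def intro!: ptens_in gG_in gV_in gel_in F_closed F2_closed)

lemma Delta_in: "x \<in> F \<Longrightarrow> Delta x \<in> F2"
proof -
  have w: "prod_list (map (comult_gen D) xs) \<in> F2" if "set xs \<subseteq> gens D" for xs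
    using that by (induction xs) (auto intro: F2_closed comult_gen_in)
  assume "x \<in> F"
  then have "Poly_Mapping.keys x \<subseteq> words (gens D)" by (simp add: F_eq)
  then show ?thesis
    by (induction rule: supported_induct)
      (auto simp: scal_emb.alg_ext_single scal_emb.alg_ext_add words_def intro!: F2_closed w)
qed

lemma Delta_gens:
  "Delta (gG g) = ptens (gG g) (gG g)"
  "Delta (gV i) = ptens (gV i) 1 + ptens (gG (a i)) (gV i)"
  by (simp_all add: scal_emb.alg_ext_gen)

lemmas Delta_simps = scal_emb.alg_ext_add scal_emb.alg_ext_mult scal_emb.alg_ext_diff
  scal_emb.alg_ext_one scal_emb.alg_ext_scal scal_emb.alg_ext_power Delta_gens

text \<open>The commutativity of \<open>G\<close> enters here: conjugation must fix the group element \<open>a\<^sub>i\<close>.\<close>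

lemma Delta_conj:
  assumes g: "g \<in> Gcar" and i: "i \<in> idx D"
  shows "Delta (gG g * gV i * gG (inv\<^bsub>grp D\<^esub> g)) \<approx>\<^sub>2 Delta (scal (chi i g) * gV i)"
proof -
  let ?g' = "inv\<^bsub>grp D\<^esub> g"
  have ig: "?g' \<in> Gcar" using g by simp
  have gg: "gG g * gG ?g' \<approx> 1"
    using rel_mult[OF g ig] rel_one g by (auto intro: H.cong_trans)
  have "gG g * gG (a i) * gG ?g' \<approx> gG (g \<otimes>\<^bsub>grp D\<^esub> a i) * gG ?g'"
    by (intro H.cong_mult rel_mult Hrefl gG_in g ig gel_in i)
  also have "\<dots> \<approx> gG (g \<otimes>\<^bsub>grp D\<^esub> a i \<otimes>\<^bsub>grp D\<^esub> ?g')"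
    by (intro rel_mult grp.m_closed g ig gel_in i)
  also have "g \<otimes>\<^bsub>grp D\<^esub> a i \<otimes>\<^bsub>grp D\<^esub> ?g' = a i"
    using g gel_in[OF i] by (metis grp.m_comm grp.inv_closed grp.m_assoc grp.r_inv grp.r_one)
  finally have ga: "gG g * gG (a i) * gG ?g' \<approx> gG (a i)" .
  have "Delta (gG g * gV i * gG ?g') =
      ptens (gG g * gV i * gG ?g') (gG g * gG ?g') + ptens (gG g * gG (a i) * gG ?g') (gG g * gV i * gG ?g')"
    by (simp add: Delta_simps ptens_mult distrib_left distrib_right)
  also have "\<dots> \<approx>\<^sub>2 ptens (scal (chi i g) * gV i) 1 + ptens (gG (a i)) (scal (chi i g) * gV i)"
    by (intro H2.cong_add ptens_cong gg ga rel_conj g i)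
  also have "\<dots> = Delta (scal (chi i g) * gV i)"
    by (simp add: Delta_simps ptens_scal distrib_left)
  finally show ?thesis .
qed

text \<open>In \<open>H \<otimes> H\<close> the elements \<open>v\<^sub>i \<otimes> 1\<close> and \<open>a\<^sub>i \<otimes> v\<^sub>i\<close> commute up to \<open>q\<^sub>i\<close>, so the power of their sum
  has no mixed terms.\<close>

lemma Delta_pow:
  assumes i: "i \<in> idx D"
  shows "Delta (gV i ^ mm D i) \<approx>\<^sub>2 Delta (scal (mu D i) * (gG (a i [^]\<^bsub>grp D\<^esub> mm D i) - 1))"
proof -
  let ?X = "ptens (gV i) 1" and ?Y = "ptens (gG (a i)) (gV i)" and ?b = "gG (a i [^]\<^bsub>grp D\<^esub> mm D i)"
  have ai: "a i \<in> Gcar" using gel_in[OF i] .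
  have yx: "?Y * ?X \<approx>\<^sub>2 scal (qq D i i) * (?X * ?Y)"
  proof -
    have "?Y * ?X = ptens (gG (a i) * gV i) (gV i)" by (simp add: ptens_mult)
    also have "\<dots> \<approx>\<^sub>2 ptens (scal (qq D i i) * (gV i * gG (a i))) (gV i)"
      unfolding qq_def by (intro ptens_cong rel_comm ai i Hrefl gV_in)
    also have "\<dots> = scal (qq D i i) * (?X * ?Y)" by (simp add: ptens_scal ptens_mult)
    finally show ?thesis .
  qed
  have in2: "?X \<in> F2" "?Y \<in> F2" by (auto intro!: ptens_in gV_in gG_in ai i F_closed)
  have "Delta (gV i ^ mm D i) = (?X + ?Y) ^ mm D i" by (simp add: Delta_simps)
  also have "\<dots> \<approx>\<^sub>2 ?X ^ mm D i + ?Y ^ mm D i"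
    unfolding mm_def
    by (rule H2.q_freshman[OF yx _ _ qq_order(1)[OF i] qq_order(2)])
      (use in2 mm_ge[OF i] in \<open>auto simp: free_alg2_def mm_def\<close>)
  also have "\<dots> = ptens (gV i ^ mm D i) 1 + ptens (gG (a i) ^ mm D i) (gV i ^ mm D i)"
    by (simp add: ptens_power)
  also have "\<dots> \<approx>\<^sub>2 ptens (scal (mu D i) * (?b - 1)) 1 + ptens ?b (scal (mu D i) * (?b - 1))"
    by (intro H2.cong_add ptens_cong rel_pow i gG_power ai Hrefl F_closed)
  also have "\<dots> = Delta (scal (mu D i) * (?b - 1))"
    by (simp add: Delta_simps ptens_scal ptens_scal_unit ptens_diff_left ptens_diff_right ptens_one
        right_diff_distrib)
  finally show ?thesis .
qed

text \<open>The mixed terms of \<open>\<Delta>(v\<^sub>i)\<Delta>(v\<^sub>j) - q\<^sub>i\<^sub>j \<Delta>(v\<^sub>j)\<Delta>(v\<^sub>i)\<close> cancel: those in \<open>_ \<otimes> v\<^sub>i\<close> because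
  \<open>a\<^sub>i v\<^sub>j = q\<^sub>i\<^sub>j v\<^sub>j a\<^sub>i\<close>, those in \<open>_ \<otimes> v\<^sub>j\<close> because also \<open>q\<^sub>i\<^sub>j q\<^sub>j\<^sub>i = 1\<close>.  What remains telescopes to
  \<open>\<lambda>\<^sub>i\<^sub>j(b \<otimes> b - 1 \<otimes> 1)\<close> with \<open>b = a\<^sub>i a\<^sub>j\<close>.\<close>

lemma Delta_link:
  assumes i: "i \<in> idx D" and j: "j \<in> idx D" and ij: "i \<noteq> j"
  shows "Delta (gV i * gV j) \<approx>\<^sub>2
    Delta (scal (qq D i j) * gV j * gV i + scal (lam D i j) * (gG (a i \<otimes>\<^bsub>grp D\<^esub> a j) - 1))"
proof -
  let ?q = "qq D i j" and ?l = "lam D i j" and ?b = "gG (a i \<otimes>\<^bsub>grp D\<^esub> a j)"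
  have ai: "a i \<in> Gcar" and aj: "a j \<in> Gcar" using gel_in i j by auto
  note F = gG_in[OF ai] gG_in[OF aj] gV_in[OF i] gV_in[OF j]
  have rl: "gV i * gV j \<approx> scal ?q * (gV j * gV i) + scal ?l * (?b - 1)"
    using rel_link[OF i j ij] by (simp add: mult.assoc)
  have c1: "gG (a i) * gV j \<approx> scal ?q * (gV j * gG (a i))"
    using rel_comm[OF ai j] by (simp add: qq_def)
  have c2: "gV i * gG (a j) \<approx> scal ?q * (gG (a j) * gV i)"
  proof -
    have "gG (a j) * gV i \<approx> scal (qq D j i) * (gV i * gG (a j))"
      using rel_comm[OF aj i] by (simp add: qq_def)
    then have "scal ?q * (gG (a j) * gV i) \<approx> scal ?q * (scal (qq D j i) * (gV i * gG (a j)))"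
      by (rule H.cong_mult[OF Hrefl[OF F_closed(6)]])
    also have "\<dots> = gV i * gG (a j)"
      using qq_inverse[OF i j ij] by (simp add: mult.assoc[symmetric] scal_mult[symmetric])
    finally show ?thesis by (rule H.cong_sym)
  qed
  have c3: "gG (a i) * gG (a j) \<approx> ?b" by (rule rel_mult[OF ai aj])
  have c4: "gG (a j) * gG (a i) \<approx> ?b" using rel_mult[OF aj ai] ai aj by (simp add: grp.m_comm)
  let ?P = "ptens (gV j * gV i) 1" and ?Q = "ptens (gV j * gG (a i)) (gV i)"
    and ?R = "ptens (gG (a j) * gV i) (gV j)" and ?S = "ptens ?b (gV j * gV i)"
    and ?S' = "ptens (gG (a j) * gG (a i)) (gV j * gV i)" and ?E = "scal ?l * (ptens ?b ?b - 1)"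
  have 1: "Delta (gV i * gV j) = ptens (gV i * gV j) 1 + ptens (gV i * gG (a j)) (gV j)
      + ptens (gG (a i) * gV j) (gV i) + ptens (gG (a i) * gG (a j)) (gV i * gV j)"
    by (simp add: Delta_simps ptens_mult distrib_left distrib_right add.assoc)
  have 2: "\<dots> \<approx>\<^sub>2 ptens (scal ?q * (gV j * gV i) + scal ?l * (?b - 1)) 1
      + ptens (scal ?q * (gG (a j) * gV i)) (gV j) + ptens (scal ?q * (gV j * gG (a i))) (gV i)
      + ptens ?b (scal ?q * (gV j * gV i) + scal ?l * (?b - 1))"
    by (intro H2.cong_add ptens_cong rl c1 c2 c3 Hrefl F F_closed)
  have e1: "ptens (scal ?q * (gV j * gV i) + scal ?l * (?b - 1)) 1
      = scal ?q * ?P + scal ?l * (ptens ?b 1 - 1)"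
    by (simp only: ptens_add_left ptens_scal ptens_diff_left ptens_one)
  have e2: "ptens ?b (scal ?q * (gV j * gV i) + scal ?l * (?b - 1))
      = scal ?q * ?S + scal ?l * (ptens ?b ?b - ptens ?b 1)"
    by (simp only: ptens_add_right ptens_scal ptens_diff_right)
  have e3: "(Q * P + L * (B - 1)) + Q * R + Q * T + (Q * U + L * (C - B)) = Q * (P + T + R + U) + L * (C - 1)"
    for P Q R T U B C L :: "('g, 'k) free2"
    by (simp add: algebra_simps)
  have 3: "Delta (gV i * gV j) \<approx>\<^sub>2 scal ?q * (?P + ?Q + ?R + ?S) + ?E"
    using 2 unfolding 1 ptens_scal e1 e2 e3 .
  have Fs: "gV j * gV i \<in> F" "gV j * gG (a i) \<in> F" "gG (a j) * gV i \<in> F" "?b \<in> F"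
    using F by (auto intro: F_closed(3) gG_in ai aj)
  have "?S \<approx>\<^sub>2 ?S'" by (rule ptens_cong[OF H.cong_sym[OF c4] Hrefl[OF Fs(1)]])
  moreover have "?P + ?Q + ?R \<in> F2" "?E \<in> F2"
    using F Fs by (auto intro!: ptens_in F2_closed F_closed(4))
  ultimately have 4: "scal ?q * (?P + ?Q + ?R + ?S) + ?E \<approx>\<^sub>2 scal ?q * (?P + ?Q + ?R + ?S') + ?E"
    by (metis H2.cong_add H2.cong_mult H2refl F2_closed(6))
  have e4: "(ptens (gV j) 1 + ptens (gG (a j)) (gV j)) * (ptens (gV i) 1 + ptens (gG (a i)) (gV i))
      = ?P + ?Q + ?R + ?S'"
    by (simp only: distrib_left distrib_right ptens_mult) (simp add: add_ac)
  have "Delta (scal ?q * gV j * gV i + scal ?l * (?b - 1)) = scal ?q * (?P + ?Q + ?R + ?S') + ?E"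
    unfolding e4[symmetric] by (simp only: Delta_simps mult.assoc)
  then show ?thesis using H2.cong_trans[OF 3 4] by (simp only:)
qed

lemma Delta_rels: "r \<in> rels D \<Longrightarrow> Delta r \<in> rel_ideal2 D"
proof -
  have D: "Delta (x - y) \<in> rel_ideal2 D" if "Delta x \<approx>\<^sub>2 Delta y" for x y
    using that by (simp add: H2.cong_def scal_emb.alg_ext_diff)
  assume "r \<in> rels D"
  then consider "r = gG \<one>\<^bsub>grp D\<^esub> - 1"
    | g h where "r = gG g * gG h - gG (g \<otimes>\<^bsub>grp D\<^esub> h)" "g \<in> Gcar" "h \<in> Gcar"
    | g i where "r = gG g * gV i * gG (inv\<^bsub>grp D\<^esub> g) - scal (chi i g) * gV i" "g \<in> Gcar" "i \<in> idx D"
    | i where "r = gV i ^ mm D i - scal (mu D i) * (gG (a i [^]\<^bsub>grp D\<^esub> mm D i) - 1)" "i \<in> idx D"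
    | i j where "r = gV i * gV j - scal (qq D i j) * gV j * gV i
      - scal (lam D i j) * (gG (a i \<otimes>\<^bsub>grp D\<^esub> a j) - 1)" "i \<in> idx D" "j \<in> idx D" "i \<noteq> j"
    unfolding rels_def by blast
  then show ?thesis
  proof cases
    case 1
    show ?thesis unfolding 1
      by (rule D) (use ptens_cong[OF rel_one rel_one] in \<open>simp add: Delta_simps ptens_one\<close>)
  next
    case 2
    show ?thesis unfolding 2(1)
      by (rule D) (use ptens_cong[OF rel_mult rel_mult] 2 in \<open>simp add: Delta_simps ptens_mult\<close>)
  next
    case 3 then show ?thesis using D Delta_conj by simp
  next
    case 4 then show ?thesis using D Delta_pow by simp
  next
    case 5 then show ?thesis using D[OF Delta_link] by (simp add: diff_diff_eq)
  qed
qed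

lemma Delta_ideal: "x \<in> rel_ideal D \<Longrightarrow> Delta x \<in> rel_ideal2 D"
proof -
  let ?J = "{x \<in> F. Delta x \<in> rel_ideal2 D}"
  have "ideal ?J (mon_alg (words (gens D)))"
    by (rule W.mon_alg_idealI)
      (auto simp: Delta_simps free_alg_def[symmetric] F_closed H2.I_zero H2.I_diff H2.I_left H2.I_right
        Delta_in[unfolded free_alg2_def])
  then have "rel_ideal D \<subseteq> ?J"
    unfolding rel_ideal_def using rels_subset Delta_rels
    by (intro ring.genideal_minimal[OF ring_free_alg]) (auto simp: free_alg_def)
  then show "x \<in> rel_ideal D \<Longrightarrow> Delta x \<in> rel_ideal2 D" by blast
qed

lemma Delta_cong: "x \<approx> y \<Longrightarrow> Delta x \<approx>\<^sub>2 Delta y"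
  using Delta_ideal[OF H.congD(3)] by (intro H2congI Delta_in) (auto simp: Delta_simps Hcong_in)

abbreviation eps :: "('g, 'k) free \<Rightarrow> 'k" where
  "eps x \<equiv> alg_ext (\<lambda>c. c) counit_gen x"

lemma eps_gens: "eps (gG g) = 1" "eps (gV i) = 0"
  by (simp_all add: id_emb.alg_ext_gen)

lemmas eps_simps = id_emb.alg_ext_add id_emb.alg_ext_mult id_emb.alg_ext_diff
  id_emb.alg_ext_one id_emb.alg_ext_scal id_emb.alg_ext_power eps_gens

lemma eps_ideal: "x \<in> rel_ideal D \<Longrightarrow> eps x = 0"
proof -
  let ?J = "{x \<in> F. eps x = 0}"
  have "ideal ?J (mon_alg (words (gens D)))"
    by (rule W.mon_alg_idealI) (auto simp: eps_simps free_alg_def[symmetric] F_closed)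
  moreover have "eps r = 0" if "r \<in> rels D" for r
    using that mm_ge unfolding rels_def by (fastforce simp: eps_simps power_0_left)
  ultimately have "rel_ideal D \<subseteq> ?J"
    unfolding rel_ideal_def using rels_subset
    by (intro ring.genideal_minimal[OF ring_free_alg]) (auto simp: free_alg_def)
  then show "x \<in> rel_ideal D \<Longrightarrow> eps x = 0" by blast
qed

end

section \<open>Functionals and convolution\<close>

lemma the_elem_image_const:
  assumes "x \<in> A" "\<And>y. y \<in> A \<Longrightarrow> \<phi> y = c"
  shows "the_elem (\<phi> ` A) = c"
proof -
  have "\<phi> ` A = (\<lambda>_. c) ` A" by (rule image_cong[OF refl assms(2)])
  also have "\<dots> = {c}" using assms(1) by auto
  finally show ?thesis by simp
qed

context qls
begin

lemma carrier_HD: "carrier (HD D) = cls D ` F"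
  unfolding HD_def cls_def free_alg_def by (rule H.carrier_quot)

lemma cls_in [simp]: "x \<in> F \<Longrightarrow> cls D x \<in> carrier (HD D)"
  by (simp add: carrier_HD)

lemma cls_mult: "x \<in> F \<Longrightarrow> y \<in> F \<Longrightarrow> cls D x \<otimes>\<^bsub>HD D\<^esub> cls D y = cls D (x * y)"
  unfolding HD_def cls_def free_alg_def by (rule H.quot_mult)

lemma cls_add: "x \<in> F \<Longrightarrow> y \<in> F \<Longrightarrow> cls D x \<oplus>\<^bsub>HD D\<^esub> cls D y = cls D (x + y)"
  unfolding HD_def cls_def free_alg_def by (rule H.quot_add)

lemma cls_one: "\<one>\<^bsub>HD D\<^esub> = cls D 1"
  unfolding HD_def cls_def free_alg_def by (rule H.quot_one)

lemma cls_cong: "x \<approx> y \<Longrightarrow> cls D x = cls D y"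
  unfolding cls_def free_alg_def by (simp add: H.coset_eq_iff H.cong_def)

lemma mem_cls_iff: "x \<in> F \<Longrightarrow> y \<in> cls D x \<longleftrightarrow> y \<approx> x"
  unfolding cls_def free_alg_def by (rule H.mem_coset_iff)

lemma mem_cls2_iff: "x \<in> F2 \<Longrightarrow> y \<in> cls2 D x \<longleftrightarrow> y \<approx>\<^sub>2 x"
  unfolding cls2_def free_alg2_def by (rule H2.mem_coset_iff)

lemma cls2_cong: "x \<approx>\<^sub>2 y \<Longrightarrow> cls2 D x = cls2 D y"
  unfolding cls2_def free_alg2_def by (simp add: H2.coset_eq_iff H2.cong_def)

lemma hscale_cls: "x \<in> F \<Longrightarrow> hscale D c (cls D x) = cls D (scal c * x)"
  by (simp add: hscale_def cls_mult F_closed)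

lemma dual_spaceI:
  assumes "\<And>x y. x \<in> F \<Longrightarrow> y \<in> F \<Longrightarrow> f (cls D (x + y)) = f (cls D x) + f (cls D y)"
    "\<And>c x. x \<in> F \<Longrightarrow> f (cls D (scal c * x)) = c * f (cls D x)"
    "\<And>X. X \<notin> carrier (HD D) \<Longrightarrow> f X = 0"
  shows "f \<in> dual_space D"
  using assms by (auto simp: dual_space_def carrier_HD cls_add hscale_cls)

lemma dual_outside: "f \<in> dual_space D \<Longrightarrow> X \<notin> carrier (HD D) \<Longrightarrow> f X = 0"
  by (auto simp: dual_space_def)

lemma dual_add:
  assumes "f \<in> dual_space D" "x \<in> F" "y \<in> F"
  shows "f (cls D (x + y)) = f (cls D x) + f (cls D y)"
proof -
  have "\<forall>X\<in>carrier (HD D). \<forall>Y\<in>carrier (HD D). f (X \<oplus>\<^bsub>HD D\<^esub> Y) = f X + f Y"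
    using assms(1) unfolding dual_space_def by blast
  from this[rule_format, OF cls_in[OF assms(2)] cls_in[OF assms(3)]] show ?thesis
    by (simp only: cls_add assms)
qed

lemma dual_scal:
  assumes "f \<in> dual_space D" "x \<in> F"
  shows "f (cls D (scal c * x)) = c * f (cls D x)"
proof -
  have "\<forall>c. \<forall>X\<in>carrier (HD D). f (hscale D c X) = c * f X"
    using assms(1) unfolding dual_space_def by blast
  from this[rule_format, OF cls_in[OF assms(2)]] show ?thesis
    by (simp only: hscale_cls assms)
qed

lemma dual_zero: "f \<in> dual_space D \<Longrightarrow> f (cls D 0) = 0"
  using dual_scal[of f 0 0] F_closed by simp

lemma dual_diff: "f \<in> dual_space D \<Longrightarrow> x \<in> F \<Longrightarrow> y \<in> F \<Longrightarrow> f (cls D (x - y)) = f (cls D x) - f (cls D y)"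
  using dual_add[of f "x - y" y] F_closed(2)[of x y] by simp

lemma cls_ideal: "x \<in> rel_ideal D \<Longrightarrow> cls D x = cls D 0"
  using rel_ideal_sub F_closed by (intro cls_cong HcongI) auto

text \<open>Evaluating \<open>f \<otimes> h\<close> on a product with a pure tensor amounts to evaluating a tensor product of
  translated functionals, so statements about all \<open>f \<otimes> h\<close> are stable under multiplication.  The value
  \<open>0\<close> outside \<open>H\<close> keeps translates in the dual space.\<close>

definition left_translate :: "('g, 'k) free \<Rightarrow> ('g, 'k) functional \<Rightarrow> ('g, 'k) functional"
  where "left_translate w f = (\<lambda>X. if X \<in> carrier (HD D) then f (cls D w \<otimes>\<^bsub>HD D\<^esub> X) else 0)"

definition right_translate :: "('g, 'k) free \<Rightarrow> ('g, 'k) functional \<Rightarrow> ('g, 'k) functional"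
  where "right_translate w f = (\<lambda>X. if X \<in> carrier (HD D) then f (X \<otimes>\<^bsub>HD D\<^esub> cls D w) else 0)"

lemma left_translate_cls: "w \<in> F \<Longrightarrow> x \<in> F \<Longrightarrow> left_translate w f (cls D x) = f (cls D (w * x))"
  by (simp add: left_translate_def cls_mult)

lemma right_translate_cls: "w \<in> F \<Longrightarrow> x \<in> F \<Longrightarrow> right_translate w f (cls D x) = f (cls D (x * w))"
  by (simp add: right_translate_def cls_mult)

lemma left_translate_dual: "w \<in> F \<Longrightarrow> f \<in> dual_space D \<Longrightarrow> left_translate w f \<in> dual_space D"
proof (rule dual_spaceI)
  fix c x assume "w \<in> F" "f \<in> dual_space D" "x \<in> F"
  moreover have "w * (scal c * x) = scal c * (w * x)"
    by (simp only: mult.assoc[symmetric] scal_commute[of c w])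
  ultimately show "left_translate w f (cls D (scal c * x)) = c * left_translate w f (cls D x)"
    by (simp add: left_translate_cls F_closed dual_scal)
qed (simp_all add: left_translate_cls F_closed distrib_left dual_add, simp add: left_translate_def)

lemma right_translate_dual: "w \<in> F \<Longrightarrow> f \<in> dual_space D \<Longrightarrow> right_translate w f \<in> dual_space D"
  by (rule dual_spaceI)
    (simp_all add: right_translate_cls F_closed distrib_right dual_add mult.assoc dual_scal, simp add: right_translate_def)

lemma dual_lin_ext:
  assumes "f \<in> dual_space D" "x \<in> F"
  shows "lin_ext (\<lambda>u. f (cls D (Poly_Mapping.single u 1))) x = f (cls D x)"
proof -
  have "Poly_Mapping.keys x \<subseteq> words (gens D)" using assms(2) by (simp add: F_eq)
  then show ?thesis
  proof (induction rule: supported_induct)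
    case (single w c)
    then have "Poly_Mapping.single w 1 \<in> F" by (simp add: F_eq)
    then show ?case
      using dual_scal[OF assms(1), of "Poly_Mapping.single w 1" c] by (simp add: scal_mult_single)
  qed (auto simp: lin_ext_add dual_zero[OF assms(1)] dual_add[OF assms(1)] F_eq)
qed

text \<open>The functional \<open>f \<otimes> h\<close> on representatives, before passing to the quotient.\<close>

definition tens_eval :: "('g, 'k) functional \<Rightarrow> ('g, 'k) functional \<Rightarrow> ('g, 'k) free2 \<Rightarrow> 'k"
  where "tens_eval f h = lin_ext (\<lambda>(u, v). f (cls D (Poly_Mapping.single u 1)) * h (cls D (Poly_Mapping.single v 1)))"

lemma tens_eval_add: "tens_eval f h (s + t) = tens_eval f h s + tens_eval f h t"
  and tens_eval_diff: "tens_eval f h (s - t) = tens_eval f h s - tens_eval f h t"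
  and tens_eval_scal: "tens_eval f h (scal c * t) = c * tens_eval f h t"
  and tens_eval_zero [simp]: "tens_eval f h 0 = 0"
  by (simp_all add: tens_eval_def lin_ext_add lin_ext_diff lin_ext_scal)

lemma tens_eval_ptens:
  assumes "f \<in> dual_space D" "h \<in> dual_space D" "x \<in> F" "y \<in> F"
  shows "tens_eval f h (ptens x y) = f (cls D x) * h (cls D y)"
  unfolding tens_eval_def
  using lin_ext_ptens[of "\<lambda>u. f (cls D (Poly_Mapping.single u 1))" "\<lambda>v. h (cls D (Poly_Mapping.single v 1))" x y]
  by (simp add: dual_lin_ext assms)

lemma F2_induct [consumes 1, case_names zero ptens add]:
  assumes "t \<in> F2" "P 0"
    and "\<And>c x y. x \<in> F \<Longrightarrow> y \<in> F \<Longrightarrow> P (scal c * ptens x y)"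
    and "\<And>s t. s \<in> F2 \<Longrightarrow> t \<in> F2 \<Longrightarrow> P s \<Longrightarrow> P t \<Longrightarrow> P (s + t)"
  shows "P t"
proof -
  have "Poly_Mapping.keys t \<subseteq> words (gens D) \<times> words (gens D)" using assms(1) by (simp add: F2_eq)
  then show ?thesis
  proof (induction rule: supported_induct)
    case (single w c)
    obtain u v where w: "w = (u, v)" by (cases w)
    have "P (scal c * ptens (Poly_Mapping.single u 1) (Poly_Mapping.single v 1))"
      using single w by (intro assms(3)) (auto simp: F_eq)
    then show ?case by (simp add: w scal_mult_single)
  qed (auto simp: F2_eq assms)
qed

lemma tens_eval_left:
  assumes "f \<in> dual_space D" "h \<in> dual_space D" "x \<in> F" "y \<in> F" "t \<in> F2"
  shows "tens_eval f h (ptens x y * t) = tens_eval (left_translate x f) (left_translate y h) t"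
  using assms(5)
proof (induction rule: F2_induct)
  case (ptens c u v)
  have "ptens x y * (scal c * ptens u v) = scal c * ptens (x * u) (y * v)"
    by (simp only: mult.assoc[symmetric] scal_commute[of c "ptens x y", symmetric])
      (simp only: mult.assoc ptens_mult)
  then show ?case using ptens assms by (simp add: tens_eval_scal tens_eval_ptens F_closed left_translate_dual left_translate_cls)
qed (auto simp: distrib_left tens_eval_add)

lemma tens_eval_right:
  assumes "f \<in> dual_space D" "h \<in> dual_space D" "x \<in> F" "y \<in> F" "t \<in> F2"
  shows "tens_eval f h (t * ptens x y) = tens_eval (right_translate x f) (right_translate y h) t"
  using assms(5)
proof (induction rule: F2_induct)
  case (ptens c u v)
  then show ?case using assms by (simp add: tens_eval_scal tens_eval_ptens F_closed right_translate_dual right_translate_cls mult.assoc ptens_mult)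
qed (auto simp: distrib_right tens_eval_add)

text \<open>The tensors on which all \<open>f \<otimes> h\<close> vanish form an ideal, because one-sided multiplication by
  pure tensors turns \<open>f \<otimes> h\<close> into another functional of the same form.\<close>

lemma tens_eval_ideal:
  assumes "f \<in> dual_space D" "h \<in> dual_space D" "t \<in> rel_ideal2 D" shows "tens_eval f h t = 0"
proof -
  let ?K = "{t \<in> F2. \<forall>f\<in>dual_space D. \<forall>h\<in>dual_space D. tens_eval f h t = 0}"
  have L: "tens_eval f h (s * t) = 0" and R: "tens_eval f h (t * s) = 0"
    if t: "t \<in> ?K" and s: "s \<in> F2" and f: "f \<in> dual_space D" and h: "h \<in> dual_space D" for s t f h
  proof -
    have tF: "t \<in> F2" using t by simp
    have t0: "tens_eval f h t = 0" if "f \<in> dual_space D" "h \<in> dual_space D" for f h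
      using t that by simp
    show "tens_eval f h (s * t) = 0"
      using s
    proof (induction rule: F2_induct)
      case (ptens c u v)
      then show ?case
        using tF by (simp add: mult.assoc tens_eval_scal tens_eval_left f h t0 left_translate_dual)
    qed (simp_all add: distrib_right tens_eval_add)
    show "tens_eval f h (t * s) = 0"
      using s
    proof (induction rule: F2_induct)
      case (ptens c u v)
      have "t * (scal c * ptens u v) = scal c * (t * ptens u v)"
        by (simp only: mult.assoc[symmetric] scal_commute[of c t])
      with ptens show ?case
        using tF by (simp add: tens_eval_scal tens_eval_right f h t0 right_translate_dual)
    qed (simp_all add: distrib_left tens_eval_add)
  qed
  have "ideal ?K (mon_alg (words (gens D) \<times> words (gens D)))"
  proof (rule W2.mon_alg_idealI; (unfold free_alg2_def[symmetric])?)
    show "x * t \<in> ?K" "t * x \<in> ?K" if "t \<in> ?K" "x \<in> F2" for x t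
      by (intro CollectI conjI ballI F2_closed(3) L[OF that] R[OF that], use that in simp_all)+
    show "s - t \<in> ?K" if "s \<in> ?K" "t \<in> ?K" for s t
      using that F2_closed(2) by (auto simp only: tens_eval_diff mem_Collect_eq diff_self)
  qed (use F2_closed in auto)
  moreover have "ptens x 1 \<in> ?K" "ptens 1 x \<in> ?K" if "x \<in> rel_ideal D" for x
  proof -
    have x: "x \<in> F" "1 \<in> F" using that rel_ideal_sub F_closed(4) by auto
    have z: "f (cls D x) = 0" if "f \<in> dual_space D" for f
      using dual_zero[OF that] cls_ideal[OF \<open>x \<in> rel_ideal D\<close>] by simp
    show "ptens x 1 \<in> ?K" "ptens 1 x \<in> ?K"
      using x by (simp_all add: ptens_in tens_eval_ptens z)
  qed
  ultimately have "rel_ideal2 D \<subseteq> ?K"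
    unfolding rel_ideal2_def
    by (intro ring.genideal_minimal[OF ring_free_alg2] Un_least image_subsetI)
      (simp only: free_alg2_def)
  then have "t \<in> ?K" using assms(3) by (rule subsetD)
  then show ?thesis using assms(1,2) by simp
qed

lemma comult_cls:
  assumes "x \<in> F" shows "comult D (cls D x) = cls2 D (Delta x)"
  unfolding comult_def
proof (rule the_elem_image_const)
  show "x \<in> cls D x" using assms by (simp only: mem_cls_iff Hrefl)
  show "cls2 D (Delta y) = cls2 D (Delta x)" if "y \<in> cls D x" for y
    using that assms by (intro cls2_cong Delta_cong) (simp only: mem_cls_iff)
qed

lemma tens_functional_cls2:
  assumes f: "f \<in> dual_space D" "h \<in> dual_space D" and t: "t \<in> F2"
  shows "tens_functional D f h (cls2 D t) = tens_eval f h t"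
proof -
  have T: "(\<Sum>(u, v)\<in>Poly_Mapping.keys s. Poly_Mapping.lookup s (u, v) *
      (f (cls D (Poly_Mapping.single u 1)) * h (cls D (Poly_Mapping.single v 1)))) = tens_eval f h s" for s
    unfolding tens_eval_def lin_ext_def by (intro sum.cong refl) (simp add: case_prod_unfold)
  show ?thesis
    unfolding tens_functional_def T
  proof (rule the_elem_image_const)
    show "t \<in> cls2 D t" using t by (simp only: mem_cls2_iff H2refl)
    fix s assume "s \<in> cls2 D t"
    then have "s - t \<in> rel_ideal2 D" using t H2.congD(3) by (simp only: mem_cls2_iff)
    then have "tens_eval f h s - tens_eval f h t = 0" using tens_eval_ideal[OF f] tens_eval_diff by metis
    then show "tens_eval f h s = tens_eval f h t" by simp
  qed
qed

lemma conv_cls: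
  "f \<in> dual_space D \<Longrightarrow> h \<in> dual_space D \<Longrightarrow> x \<in> F \<Longrightarrow> conv D f h (cls D x) = tens_eval f h (Delta x)"
  by (simp add: conv_def comult_cls tens_functional_cls2 Delta_in)

lemma conv_dual: "f \<in> dual_space D \<Longrightarrow> h \<in> dual_space D \<Longrightarrow> conv D f h \<in> dual_space D"
  by (rule dual_spaceI) (simp_all add: conv_cls F_closed Delta_simps tens_eval_add tens_eval_scal, simp add: conv_def)

lemma counit_cls: "x \<in> F \<Longrightarrow> counit D (cls D x) = eps x"
proof -
  assume x: "x \<in> F"
  have "the_elem (alg_ext (\<lambda>c. c) counit_gen ` cls D x) = eps x"
  proof (rule the_elem_image_const)
    show "x \<in> cls D x" using x by (simp only: mem_cls_iff Hrefl)
    fix y assume "y \<in> cls D x"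
    then have "y - x \<in> rel_ideal D" using x H.congD(3) by (simp only: mem_cls_iff)
    from eps_ideal[OF this] show "eps y = eps x" by (simp add: eps_simps)
  qed
  then show ?thesis using x by (simp add: counit_def)
qed

lemma counit_dual: "counit D \<in> dual_space D"
  by (rule dual_spaceI) (simp_all add: counit_cls F_closed eps_simps, simp add: counit_def)

section \<open>Convolution on ordered monomials\<close>

text \<open>Monomials are indexed by lists of generator indices rather than by exponents, because lists record
  the order of the letters and admit the recursion that the comultiplication follows.\<close>

definition var_mon :: "nat list \<Rightarrow> ('g, 'k) free"
  where "var_mon L = prod_list (map gV L)"

definition gel_prod :: "nat list \<Rightarrow> 'g"
  where "gel_prod L = foldr (\<lambda>l x. a l \<otimes>\<^bsub>grp D\<^esub> x) L \<one>\<^bsub>grp D\<^esub>"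

definition chr_prod :: "nat list \<Rightarrow> 'g \<Rightarrow> 'k"
  where "chr_prod A g = prod_list (map (\<lambda>k. chi k g) A)"

lemma var_mon_simps: "var_mon [] = 1" "var_mon (l # L) = gV l * var_mon L" "var_mon (L @ L') = var_mon L * var_mon L'"
  by (simp_all add: var_mon_def)

lemma var_mon_replicate: "var_mon (replicate n k) = gV k ^ n"
  by (induction n) (auto simp: var_mon_simps)

lemma var_mon_in: "set L \<subseteq> idx D \<Longrightarrow> var_mon L \<in> F"
  by (induction L) (auto simp: var_mon_simps intro!: F_closed gV_in)

lemma gel_prod_simps: "gel_prod [] = \<one>\<^bsub>grp D\<^esub>" "gel_prod (l # L) = a l \<otimes>\<^bsub>grp D\<^esub> gel_prod L"
  by (simp_all add: gel_prod_def)

lemma gel_prod_in: "set L \<subseteq> idx D \<Longrightarrow> gel_prod L \<in> Gcar"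
  by (induction L) (auto simp: gel_prod_simps gel_in)

lemma comm_var_mon: "g \<in> Gcar \<Longrightarrow> set A \<subseteq> idx D \<Longrightarrow> gG g * var_mon A \<approx> scal (chr_prod A g) * (var_mon A * gG g)"
proof (induction A)
  case Nil
  then show ?case by (auto simp: var_mon_simps chr_prod_def intro!: Hrefl gG_in)
next
  case (Cons k A)
  then have k: "k \<in> idx D" and A: "set A \<subseteq> idx D" and g: "g \<in> Gcar" by auto
  note in' = gG_in[OF g] gV_in[OF k] var_mon_in[OF A]
  have 1: "gG g * var_mon (k # A) \<approx> scal (chi k g) * (gV k * gG g) * var_mon A"
    unfolding var_mon_simps mult.assoc[of "gG g", symmetric]
    by (intro H.cong_mult rel_comm g k Hrefl in')
  have 2: "scal (chi k g) * gV k * (gG g * var_mon A) \<approx> scal (chi k g) * gV k * (scal (chr_prod A g) * (var_mon A * gG g))"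
    by (intro H.cong_mult Cons.IH g A Hrefl in' F_closed)
  have 3: "scal (chi k g) * gV k * (scal (chr_prod A g) * (var_mon A * gG g)) = scal (chr_prod (k # A) g) * (var_mon (k # A) * gG g)"
  proof -
    have "scal (chi k g) * gV k * (scal (chr_prod A g) * (var_mon A * gG g))
        = scal (chi k g) * (gV k * scal (chr_prod A g)) * (var_mon A * gG g)" by (simp only: mult.assoc)
    also have "gV k * scal (chr_prod A g) = scal (chr_prod A g) * gV k" by (rule scal_commute[symmetric])
    finally show ?thesis by (simp add: chr_prod_def var_mon_simps scal_mult mult.assoc)
  qed
  show ?case using H.cong_trans[OF 1[unfolded mult.assoc] 2[unfolded mult.assoc]] 3[unfolded mult.assoc]
    by (simp add: mult.assoc)
qed

text \<open>Functionals do not see which representative is chosen, so a group element inside a monomial can be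
  merged with the one at its end at the cost of a character value.\<close>

lemma move_group:
  assumes f: "f \<in> dual_space D" and b: "b \<in> Gcar" and g: "g \<in> Gcar" and P: "set P \<subseteq> idx D" and R: "set R \<subseteq> idx D"
  shows "f (cls D (var_mon P * gG b * var_mon R * gG g)) = chr_prod R b * f (cls D (var_mon (P @ R) * gG (b \<otimes>\<^bsub>grp D\<^esub> g)))"
proof -
  note in' = gG_in[OF g] gG_in[OF b] var_mon_in[OF P] var_mon_in[OF R]
  have 1: "var_mon P * (gG b * var_mon R) * gG g \<approx> var_mon P * (scal (chr_prod R b) * (var_mon R * gG b)) * gG g"
    by (intro H.cong_mult comm_var_mon b R Hrefl in')
  have 2: "var_mon P * (scal (chr_prod R b) * (var_mon R * gG b)) * gG g = scal (chr_prod R b) * (var_mon (P @ R) * (gG b * gG g))"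
    unfolding var_mon_simps mult.assoc[of "var_mon P", symmetric] scal_commute[of _ "var_mon P", symmetric]
    by (simp only: mult.assoc)
  have 3: "scal (chr_prod R b) * (var_mon (P @ R) * (gG b * gG g)) \<approx> scal (chr_prod R b) * (var_mon (P @ R) * gG (b \<otimes>\<^bsub>grp D\<^esub> g))"
    using P R by (intro H.cong_mult rel_mult b g Hrefl var_mon_in F_closed) auto
  have "cls D (var_mon P * gG b * var_mon R * gG g) = cls D (scal (chr_prod R b) * (var_mon (P @ R) * gG (b \<otimes>\<^bsub>grp D\<^esub> g)))"
    using cls_cong[OF H.cong_trans[OF 1[unfolded 2] 3]] by (simp only: mult.assoc)
  then show ?thesis
    using P R b g by (simp add: dual_scal[OF f] F_closed var_mon_in gG_in)
qed

text \<open>The terms of the expanded \<open>\<Delta>(v\<^sub>L)\<close>.  A letter \<open>l\<close> either goes to the left factor, or it goes to the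
  right one and leaves \<open>a\<^sub>l\<close> on the left, which then has to pass the later letters \<open>A\<close> there.\<close>

fun splits :: "nat list \<Rightarrow> ('k \<times> nat list \<times> nat list) list"
  where
    "splits [] = [(1, [], [])]"
  | "splits (l # L) = map (\<lambda>(c, A, B). (c, l # A, B)) (splits L) @
      map (\<lambda>(c, A, B). (c * chr_prod A (a l), A, l # B)) (splits L)"

lemma splits_props:
  "(c, A, B) \<in> set (splits L) \<Longrightarrow>
    mset L = mset A + mset B \<and> set A \<subseteq> set L \<and> set B \<subseteq> set L \<and> (sorted L \<longrightarrow> sorted A \<and> sorted B)"
proof (induction L arbitrary: c A B)
  case (Cons l L)
  from Cons.prems obtain c' A' B' where *: "(c', A', B') \<in> set (splits L)"
    and **: "A = l # A' \<and> B = B' \<or> A = A' \<and> B = l # B'" by auto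
  from Cons.IH[OF *] ** show ?case by (auto simp: subset_iff)
qed simp

text \<open>Splitting off the first letter replaces \<open>f\<close> and \<open>h\<close> by translates, so the induction has to range
  over all pairs of functionals.\<close>

lemma tens_eval_Delta_monomial:
  assumes "f \<in> dual_space D" "h \<in> dual_space D" "set L \<subseteq> idx D" and g: "g \<in> Gcar"
  shows "tens_eval f h (Delta (var_mon L * gG g)) = (\<Sum>(c, A, B)\<leftarrow>splits L.
    c * (f (cls D (var_mon A * gG (gel_prod B \<otimes>\<^bsub>grp D\<^esub> g))) * h (cls D (var_mon B * gG g))))"
  using assms(1-3)
proof (induction L arbitrary: f h)
  case Nil
  then show ?case using g by (simp add: var_mon_simps gel_prod_simps Delta_simps tens_eval_ptens gG_in)
next
  case (Cons l L)
  then have l: "l \<in> idx D" and L: "set L \<subseteq> idx D" and f: "f \<in> dual_space D" and h: "h \<in> dual_space D"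
    by auto
  have al: "a l \<in> Gcar" by (rule gel_in[OF l])
  let ?X = "var_mon L * gG g"
  have X: "?X \<in> F" using L g by (intro F_closed var_mon_in gG_in)
  note in' = gV_in[OF l] gG_in[OF al] F_closed(4)
  have "Delta (var_mon (l # L) * gG g) = ptens (gV l) 1 * Delta ?X + ptens (gG (a l)) (gV l) * Delta ?X"
    by (simp add: var_mon_simps mult.assoc Delta_simps distrib_right)
  then have "tens_eval f h (Delta (var_mon (l # L) * gG g))
      = tens_eval (left_translate (gV l) f) (left_translate 1 h) (Delta ?X) + tens_eval (left_translate (gG (a l)) f) (left_translate (gV l) h) (Delta ?X)"
    using f h X in' by (simp add: tens_eval_add tens_eval_left Delta_in)
  also have "tens_eval (left_translate (gV l) f) (left_translate 1 h) (Delta ?X) = (\<Sum>(c, A, B)\<leftarrow>splits L.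
      c * (f (cls D (var_mon (l # A) * gG (gel_prod B \<otimes>\<^bsub>grp D\<^esub> g))) * h (cls D (var_mon B * gG g))))"
    unfolding Cons.IH[OF left_translate_dual[OF in'(1) f] left_translate_dual[OF in'(3) h] L]
  proof (intro arg_cong[of _ _ sum_list] map_cong refl, clarify)
    fix c A B assume "(c, A, B) \<in> set (splits L)"
    then have A: "set A \<subseteq> idx D" and B: "set B \<subseteq> idx D" using splits_props L by blast+
    have "var_mon A * gG (gel_prod B \<otimes>\<^bsub>grp D\<^esub> g) \<in> F" "var_mon B * gG g \<in> F"
      by (intro F_closed var_mon_in gG_in grp.m_closed gel_prod_in A B g)+
    then show "c * (left_translate (gV l) f (cls D (var_mon A * gG (gel_prod B \<otimes>\<^bsub>grp D\<^esub> g))) * left_translate 1 h (cls D (var_mon B * gG g)))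
        = c * (f (cls D (var_mon (l # A) * gG (gel_prod B \<otimes>\<^bsub>grp D\<^esub> g))) * h (cls D (var_mon B * gG g)))"
      using in' by (simp add: left_translate_cls var_mon_simps mult.assoc)
  qed
  also have "tens_eval (left_translate (gG (a l)) f) (left_translate (gV l) h) (Delta ?X) = (\<Sum>(c, A, B)\<leftarrow>splits L.
      c * chr_prod A (a l) * (f (cls D (var_mon A * gG (gel_prod (l # B) \<otimes>\<^bsub>grp D\<^esub> g))) * h (cls D (var_mon (l # B) * gG g))))"
    unfolding Cons.IH[OF left_translate_dual[OF in'(2) f] left_translate_dual[OF in'(1) h] L]
  proof (intro arg_cong[of _ _ sum_list] map_cong refl, clarify)
    fix c A B assume "(c, A, B) \<in> set (splits L)"
    then have A: "set A \<subseteq> idx D" and B: "set B \<subseteq> idx D" using splits_props L by blast+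
    have gb: "gel_prod B \<otimes>\<^bsub>grp D\<^esub> g \<in> Gcar" using B g by (simp add: gel_prod_in)
    have 1: "var_mon A * gG (gel_prod B \<otimes>\<^bsub>grp D\<^esub> g) \<in> F" "var_mon B * gG g \<in> F"
      using A B g gb by (auto intro!: F_closed var_mon_in gG_in)
    have "f (cls D (gG (a l) * (var_mon A * gG (gel_prod B \<otimes>\<^bsub>grp D\<^esub> g))))
        = chr_prod A (a l) * f (cls D (var_mon A * gG (a l \<otimes>\<^bsub>grp D\<^esub> (gel_prod B \<otimes>\<^bsub>grp D\<^esub> g))))"
      using move_group[OF f al gb, of "[]" A] A by (simp add: var_mon_simps mult.assoc)
    also have "a l \<otimes>\<^bsub>grp D\<^esub> (gel_prod B \<otimes>\<^bsub>grp D\<^esub> g) = gel_prod (l # B) \<otimes>\<^bsub>grp D\<^esub> g"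
      using al B g by (simp add: gel_prod_simps gel_prod_in grp.m_assoc)
    finally show "c * (left_translate (gG (a l)) f (cls D (var_mon A * gG (gel_prod B \<otimes>\<^bsub>grp D\<^esub> g))) * left_translate (gV l) h (cls D (var_mon B * gG g)))
        = c * chr_prod A (a l) * (f (cls D (var_mon A * gG (gel_prod (l # B) \<otimes>\<^bsub>grp D\<^esub> g))) * h (cls D (var_mon (l # B) * gG g)))"
      using in' 1 by (simp add: left_translate_cls var_mon_simps mult.assoc)
  qed
  finally show ?case by (simp add: case_prod_unfold comp_def)
qed

definition coef :: "nat list \<Rightarrow> nat list \<Rightarrow> nat list \<Rightarrow> 'k"
  where "coef L A B = (\<Sum>(c, A', B')\<leftarrow>splits L. if A' = A \<and> B' = B then c else 0)"

lemma coef_Nil: "coef [] A B = (if A = [] \<and> B = [] then 1 else 0)"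
  by (simp add: coef_def)

lemma coef_Cons:
  "coef (l # L) A B = (if A \<noteq> [] \<and> hd A = l then coef L (tl A) B else 0) +
    (if B \<noteq> [] \<and> hd B = l then chr_prod A (a l) * coef L A (tl B) else 0)"
proof -
  have c: "l # A' = A \<longleftrightarrow> (A \<noteq> [] \<and> hd A = l) \<and> A' = tl A" for A' A :: "nat list"
    by (cases A) auto
  have 1: "(\<Sum>(c, A', B')\<leftarrow>S. if l # A' = A \<and> B' = B then c else 0)
      = (if A \<noteq> [] \<and> hd A = l then (\<Sum>(c, A', B')\<leftarrow>S. if A' = tl A \<and> B' = B then c else 0) else 0)"
    for S :: "('k \<times> nat list \<times> nat list) list"
    unfolding c by (induction S) auto
  have 2: "(\<Sum>(c, A', B')\<leftarrow>S. if A' = A \<and> l # B' = B then c * chr_prod A' (a l) else 0)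
      = (if B \<noteq> [] \<and> hd B = l
         then chr_prod A (a l) * (\<Sum>(c, A', B')\<leftarrow>S. if A' = A \<and> B' = tl B then c else 0) else 0)"
    for S :: "('k \<times> nat list \<times> nat list) list"
    unfolding c by (induction S) (auto simp: algebra_simps)
  show ?thesis unfolding coef_def 1[symmetric] 2[symmetric]
    by (simp add: case_prod_unfold comp_def cong: if_cong)
qed

lemma coef_eq_0:
  assumes "mset L \<noteq> mset A + mset B" shows "coef L A B = 0"
proof -
  have "coef L A B = (\<Sum>_\<leftarrow>splits L. 0)"
    unfolding coef_def
    by (intro arg_cong[of _ _ sum_list] map_cong refl) (use splits_props assms in \<open>auto split: if_splits\<close>)
  then show ?thesis by simp
qed

text \<open>If \<open>A\<close> and \<open>B\<close> have no letter in common, \<open>AB\<close> splits into them in one way only, and no group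
  element has to pass a letter.\<close>

lemma coef_append: "set A \<inter> set B = {} \<Longrightarrow> coef (A @ B) A B = 1"
proof (induction A)
  case Nil
  have "coef B [] B = 1" by (induction B) (auto simp: coef_Nil coef_Cons chr_prod_def)
  then show ?case by simp
next
  case (Cons x A)
  then have "\<not> (B \<noteq> [] \<and> hd B = x)" by (cases B) auto
  with Cons show ?case by (auto simp: coef_Cons)
qed

text \<open>If the single letter on the right has \<open>j\<close> letters after it, its group element passes \<open>j\<close> copies of
  \<open>v\<^sub>k\<close>; the weights \<open>q\<^sub>k\<^sup>j\<close> for \<open>j \<le> n\<close> add up to \<open>(n + 1)\<close>.\<close>

lemma coef_replicate:
  "coef (replicate (Suc n) k) (replicate n k) [k] = qnum (qq D k k) (Suc n)"
proof (induction n)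
  case 0
  show ?case by (simp add: coef_Cons coef_Nil chr_prod_def qnum_def)
next
  case (Suc n)
  have 1: "coef (replicate (Suc n) k) (replicate (Suc n) k) [] = 1"
    using coef_append[of "replicate (Suc n) k" "[]"] by simp
  have 2: "chr_prod (replicate (Suc n) k) (a k) = qq D k k ^ Suc n"
    by (simp add: chr_prod_def qq_def)
  have "coef (replicate (Suc (Suc n)) k) (replicate (Suc n) k) [k]
      = coef (replicate (Suc n) k) (replicate n k) [k] + qq D k k ^ Suc n"
    by (subst replicate_Suc, subst coef_Cons, subst 2) (use 1 in simp)
  then show ?case using Suc by (simp add: qnum_def)
qed

end

section \<open>Ordered monomials span the algebra\<close>

lemma sorted_mset_eqI: "sorted L \<Longrightarrow> sorted K \<Longrightarrow> mset L = mset K \<Longrightarrow> L = K"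
  for L K :: "nat list"
  by (metis properties_for_sort)

lemma sum_fun_apply: "(\<Sum>x\<in>A. F x) y = (\<Sum>x\<in>A. F x (y :: 'y) :: 'k::comm_monoid_add)"
  by (induction A rule: infinite_finite_induct) auto

context qls
begin

definition std_lists :: "nat list set"
  where "std_lists = {L. sorted L \<and> set L \<subseteq> idx D \<and> (\<forall>k\<in>idx D. count (mset L) k < mm D k)}"

text \<open>Both the power relations and the relations between different \<open>v\<^sub>i\<close> have the form
  \<open>X = cY + d(b - 1)\<close> with a group element \<open>b\<close>, where \<open>Y\<close> is \<open>0\<close> or the product of the two letters of
  \<open>X\<close> in the opposite order.  The second summand only contributes monomials without the letters
  of \<open>X\<close>.\<close>

lemma rewrite_in_monomial:
  assumes f: "f \<in> dual_space D" and X: "X \<approx> scal c * Y + scal d * (gG b - 1)" and Y: "Y \<in> F"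
    and b: "b \<in> Gcar" and g: "g \<in> Gcar" and P: "set P \<subseteq> idx D" and R: "set R \<subseteq> idx D"
  shows "f (cls D (var_mon P * X * (var_mon R * gG g))) = c * f (cls D (var_mon P * Y * (var_mon R * gG g))) +
    d * (chr_prod R b * f (cls D (var_mon (P @ R) * gG (b \<otimes>\<^bsub>grp D\<^esub> g))) - f (cls D (var_mon (P @ R) * gG g)))"
proof -
  note in' = gG_in[OF g] gG_in[OF b] var_mon_in[OF P] var_mon_in[OF R] Y
  let ?Z = "var_mon R * gG g"
  have s: "p * (scal e * y) * z = scal e * (p * y * z)" for p y z :: "('g, 'k) free" and e
    by (simp only: mult.assoc[symmetric] scal_commute[of e p])
  have 1: "cls D (var_mon P * X * ?Z) = cls D (var_mon P * (scal c * Y + scal d * (gG b - 1)) * ?Z)"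
    by (intro cls_cong H.cong_mult X Hrefl in' F_closed)
  have 2: "var_mon P * (scal c * Y + scal d * (gG b - 1)) * ?Z
      = scal c * (var_mon P * Y * ?Z) + scal d * (var_mon P * gG b * var_mon R * gG g - var_mon (P @ R) * gG g)"
    unfolding distrib_left distrib_right s var_mon_simps
    by (simp only: right_diff_distrib left_diff_distrib mult.assoc mult_1_right mult_1_left)
  have F: "var_mon P * Y * ?Z \<in> F" "var_mon P * gG b * var_mon R * gG g \<in> F" "var_mon (P @ R) * gG g \<in> F"
    unfolding var_mon_simps by (intro F_closed in')+
  show ?thesis
    unfolding 1 2 using F move_group[OF f b g P R]
    by (simp add: dual_add[OF f] dual_scal[OF f] dual_diff[OF f] F_closed)
qed

text \<open>Swapping two letters or deleting a full power changes a monomial by a scalar and by shorter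
  monomials, so induction on the length reduces every monomial to an ordered one with small
  exponents.\<close>

lemma vanish_on_monomials:
  assumes f: "f \<in> dual_space D"
    and z: "\<And>L g. L \<in> std_lists \<Longrightarrow> g \<in> Gcar \<Longrightarrow> f (cls D (var_mon L * gG g)) = 0"
  shows "set L \<subseteq> idx D \<Longrightarrow> g \<in> Gcar \<Longrightarrow> f (cls D (var_mon L * gG g)) = 0"
proof (induction "length L" arbitrary: L g rule: less_induct)
  case less
  define v where "v L = f (cls D (var_mon L * gG g))" for L
  let ?n = "length L"
  have g: "g \<in> Gcar" by (rule less.prems(2))
  have short: "f (cls D (var_mon K * gG h)) = 0" if "length K < ?n" "set K \<subseteq> idx D" "h \<in> Gcar" for K h
    using less.hyps that by blast
  have tail: "chr_prod R b * f (cls D (var_mon (P @ R) * gG (b \<otimes>\<^bsub>grp D\<^esub> g))) - f (cls D (var_mon (P @ R) * gG g)) = 0"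
    if "length (P @ R) < ?n" "set P \<subseteq> idx D" "set R \<subseteq> idx D" "b \<in> Gcar" for P R b
    using short[of "P @ R"] that g by simp
  have swap: "v (P @ i # j # R) = qq D i j * v (P @ j # i # R)"
    if "i \<in> idx D" "j \<in> idx D" "i \<noteq> j" "set P \<subseteq> idx D" "set R \<subseteq> idx D" "length (P @ i # j # R) = ?n"
    for P R i j
  proof -
    let ?b = "a i \<otimes>\<^bsub>grp D\<^esub> a j"
    have b: "?b \<in> Gcar" using that gel_in by simp
    have X: "gV i * gV j \<approx> scal (qq D i j) * (gV j * gV i) + scal (lam D i j) * (gG ?b - 1)"
      using rel_link[OF that(1-3)] by (simp only: mult.assoc)
    have Y: "gV j * gV i \<in> F" using that by (intro F_closed gV_in)
    have l: "length (P @ R) < ?n" using that by simp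
    show ?thesis
      using rewrite_in_monomial[OF f X Y b g that(4,5), unfolded tail[OF l that(4,5) b]]
      by (simp add: v_def var_mon_simps mult.assoc)
  qed
  have pow: "v (P @ replicate (mm D i) i @ R) = 0"
    if "i \<in> idx D" "set P \<subseteq> idx D" "set R \<subseteq> idx D" "length (P @ replicate (mm D i) i @ R) = ?n" for P R i
  proof -
    let ?b = "a i [^]\<^bsub>grp D\<^esub> mm D i"
    have b: "?b \<in> Gcar" using that gel_in by simp
    have X: "gV i ^ mm D i \<approx> scal 0 * 0 + scal (mu D i) * (gG ?b - 1)"
      using rel_pow[OF that(1)] by simp
    have l: "length (P @ R) < ?n" using that mm_ge[OF that(1)] by simp
    show ?thesis
      using rewrite_in_monomial[OF f X F_closed(5) b g that(2,3), unfolded tail[OF l that(2,3) b]]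
      by (simp add: v_def var_mon_simps var_mon_replicate mult.assoc)
  qed
  (* insertion sort from the right; the prefix P is the part that has not been sorted yet *)
  have ins: "v (P @ insort x R) = 0 \<Longrightarrow> v (P @ x # R) = 0"
    if "set (P @ x # R) \<subseteq> idx D" "length (P @ x # R) = ?n" for P x R
    using that
  proof (induction R arbitrary: P)
    case (Cons y R)
    show ?case
    proof (cases "x \<le> y")
      case True
      then show ?thesis using Cons.prems by simp
    next
      case False
      then have "v ((P @ [y]) @ insort x R) = 0" using Cons.prems by simp
      then have "v ((P @ [y]) @ x # R) = 0" using Cons.prems by (intro Cons.IH) auto
      moreover have "v (P @ x # y # R) = qq D x y * v (P @ y # x # R)"
        using Cons.prems False by (intro swap) auto
      ultimately show ?thesis by simp
    qed
  qed simp
  have srt: "v (P @ sort R) = 0 \<Longrightarrow> v (P @ R) = 0"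
    if "set (P @ R) \<subseteq> idx D" "length (P @ R) = ?n" for P R
    using that
  proof (induction R arbitrary: P)
    case (Cons x R)
    then have "v (P @ x # sort R) = 0" by (intro ins) auto
    then have "v ((P @ [x]) @ sort R) = 0" by simp
    then have "v ((P @ [x]) @ R) = 0" using Cons.prems by (intro Cons.IH) auto
    then show ?case by simp
  qed simp
  have "v (sort L) = 0"
  proof (cases "sort L \<in> std_lists")
    case True
    then show ?thesis using z[OF _ g] by (simp add: v_def)
  next
    case False
    then obtain k where k: "k \<in> idx D" "count (mset L) k \<ge> mm D k"
      using less.prems(1) by (auto simp: std_lists_def not_less)
    let ?P = "sort (filter (\<lambda>x. x < k) L)" and ?Q = "sort (filter (\<lambda>x. x > k) L)"
    let ?c = "count (mset L) k"
    have "sort L = ?P @ replicate ?c k @ ?Q"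
    proof (rule properties_for_sort)
      show "mset (?P @ replicate ?c k @ ?Q) = mset L"
        by (rule multiset_eqI) (auto simp: not_less_iff_gr_or_eq)
      show "sorted (?P @ replicate ?c k @ ?Q)" by (auto simp: sorted_append)
    qed
    also have "replicate ?c k = replicate (mm D k) k @ replicate (?c - mm D k) k"
      using k(2) by (simp add: replicate_add[symmetric])
    finally have eq: "sort L = ?P @ replicate (mm D k) k @ (replicate (?c - mm D k) k @ ?Q)" by simp
    show ?thesis
      unfolding eq
    proof (rule pow)
      show "length (?P @ replicate (mm D k) k @ (replicate (?c - mm D k) k @ ?Q)) = ?n"
        unfolding eq[symmetric] by simp
    qed (use k less.prems(1) in auto)
  qed
  then show ?case using srt[of "[]" L] less.prems(1) by (simp add: v_def)
qed

text \<open>Collecting group elements on the right turns every word into a multiple of a monomial \<open>v\<^sub>L g\<close>, where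
  \<open>L\<close> need not be sorted.\<close>

lemma word_to_monomial:
  "set xs \<subseteq> gens D \<Longrightarrow> \<exists>c L g. set L \<subseteq> idx D \<and> g \<in> Gcar \<and>
    prod_list (map gen xs) \<approx> scal c * (var_mon L * gG g)"
proof (induction xs)
  case Nil
  have "1 \<approx> scal 1 * (var_mon [] * gG \<one>\<^bsub>grp D\<^esub>)" using H.cong_sym[OF rel_one] by (simp add: var_mon_simps)
  then have "set [] \<subseteq> idx D \<and> \<one>\<^bsub>grp D\<^esub> \<in> Gcar \<and> prod_list (map gen []) \<approx> scal 1 * (var_mon [] * gG \<one>\<^bsub>grp D\<^esub>)" by simp
  then show ?case by blast
next
  case (Cons x xs)
  then obtain c L g where L: "set L \<subseteq> idx D" "g \<in> Gcar"
    and eq: "prod_list (map gen xs) \<approx> scal c * (var_mon L * gG g)" by auto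
  have xg: "x \<in> gens D" using Cons.prems by simp
  then have x: "gen x \<in> F" by (rule gen_in)
  have 1: "gen x * prod_list (map gen xs) \<approx> scal c * (gen x * (var_mon L * gG g))"
    using H.cong_mult[OF Hrefl[OF x] eq] by (simp only: mult.assoc[symmetric] scal_commute[of c "gen x"])
  from xg consider h where "x = Grp h" "h \<in> Gcar" | i where "x = Var i" "i \<in> idx D"
    by (auto simp: gens_def)
  then show ?case
  proof cases
    case 1
    have "gG h * var_mon L * gG g \<approx> (scal (chr_prod L h) * (var_mon L * gG h)) * gG g"
      by (intro H.cong_mult comm_var_mon 1 L Hrefl gG_in)
    then have a1: "gG h * (var_mon L * gG g) \<approx> scal (chr_prod L h) * (var_mon L * (gG h * gG g))"
      by (simp only: mult.assoc)
    have a2: "scal (chr_prod L h) * (var_mon L * (gG h * gG g)) \<approx> scal (chr_prod L h) * (var_mon L * gG (h \<otimes>\<^bsub>grp D\<^esub> g))"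
      by (intro H.cong_mult rel_mult 1 L Hrefl var_mon_in F_closed)
    have "scal c * (gen x * (var_mon L * gG g)) \<approx> scal c * (scal (chr_prod L h) * (var_mon L * gG (h \<otimes>\<^bsub>grp D\<^esub> g)))"
      unfolding 1 by (intro H.cong_mult H.cong_trans[OF a1 a2] Hrefl F_closed)
    from H.cong_trans[OF \<open>gen x * prod_list (map gen xs) \<approx> _\<close> this]
    have "prod_list (map gen (x # xs)) \<approx> scal (c * chr_prod L h) * (var_mon L * gG (h \<otimes>\<^bsub>grp D\<^esub> g))"
      by (simp add: scal_mult mult.assoc)
    moreover have "h \<otimes>\<^bsub>grp D\<^esub> g \<in> Gcar" using 1 L by simp
    ultimately show ?thesis using L(1) by blast
  next
    case 2
    have "prod_list (map gen (x # xs)) \<approx> scal c * (var_mon (i # L) * gG g)"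
      using \<open>gen x * prod_list (map gen xs) \<approx> _\<close> by (simp add: 2 var_mon_simps mult.assoc)
    moreover have "set (i # L) \<subseteq> idx D" using 2 L by simp
    ultimately show ?thesis using L(2) by blast
  qed
qed

lemma single_word:
  fixes c :: "'c::field"
  shows "Poly_Mapping.single (Word xs) c = scal c * prod_list (map gen xs)"
proof -
  have "prod_list (map gen xs) = Poly_Mapping.single (Word xs) (1::'c)"
    by (induction xs) (auto simp: gen_def mult_single plus_word_def single_one[symmetric] zero_word_def
        simp del: single_one)
  then show ?thesis by (simp add: scal_mult_single)
qed

lemma functional_eq_0:
  assumes f: "f \<in> dual_space D"
    and z: "\<And>L g. L \<in> std_lists \<Longrightarrow> g \<in> Gcar \<Longrightarrow> f (cls D (var_mon L * gG g)) = 0"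
  shows "f X = 0"
proof (cases "X \<in> carrier (HD D)")
  case True
  then obtain x where x: "x \<in> F" "X = cls D x" by (auto simp: carrier_HD)
  have "Poly_Mapping.keys x \<subseteq> words (gens D)" using x by (simp add: F_eq)
  then have "f (cls D x) = 0"
  proof (induction rule: supported_induct)
    case (single w c)
    obtain xs where w: "w = Word xs" by (cases w)
    with single have "set xs \<subseteq> gens D" by (simp add: words_def)
    then obtain d L g where L: "set L \<subseteq> idx D" "g \<in> Gcar"
      and eq: "prod_list (map gen xs) \<approx> scal d * (var_mon L * gG g)" using word_to_monomial by blast
    have F: "var_mon L * gG g \<in> F" by (intro F_closed var_mon_in gG_in L)
    have "Poly_Mapping.single w c \<approx> scal c * (scal d * (var_mon L * gG g))"
      unfolding w single_word by (intro H.cong_mult eq Hrefl F_closed)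
    then have "f (cls D (Poly_Mapping.single w c)) = f (cls D (scal c * (scal d * (var_mon L * gG g))))"
      by (rule arg_cong[OF cls_cong])
    also have "\<dots> = c * (d * f (cls D (var_mon L * gG g)))"
      using F by (simp add: dual_scal[OF f] F_closed)
    finally have "f (cls D (Poly_Mapping.single w c)) = c * (d * f (cls D (var_mon L * gG g)))" .
    then show ?case using vanish_on_monomials[OF f z L] by simp
  qed (simp_all add: dual_zero[OF f] dual_add[OF f] F_eq)
  then show ?thesis using x by simp
next
  case False
  then show ?thesis using f dual_outside by blast
qed

section \<open>Functionals concentrated on one monomial\<close>

text \<open>Such a functional is determined on standard monomials by \<open>A\<close> and \<open>\<phi>\<close>.  The list \<open>A\<close> is allowed to
  be nonstandard, and then all these values are \<open>0\<close>; this covers powers of \<open>\<xi>\<^sub>k\<close> of any size.\<close>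

definition concentrated :: "('g, 'k) functional \<Rightarrow> nat list \<Rightarrow> ('g \<Rightarrow> 'k) \<Rightarrow> bool"
  where "concentrated f A \<phi> \<longleftrightarrow> f \<in> dual_space D \<and>
    (\<forall>L\<in>std_lists. \<forall>g\<in>Gcar. f (cls D (var_mon L * gG g)) = (if L = A then \<phi> g else 0))"

lemma std_lists_splits:
  assumes "L \<in> std_lists" "(c, A, B) \<in> set (splits L)" shows "A \<in> std_lists" "B \<in> std_lists"
proof -
  have p: "mset L = mset A + mset B" "set A \<subseteq> set L" "set B \<subseteq> set L" "sorted L \<longrightarrow> sorted A \<and> sorted B"
    using splits_props[OF assms(2)] by auto
  have L: "sorted L" "set L \<subseteq> idx D" "\<And>k. k \<in> idx D \<Longrightarrow> count (mset L) k < mm D k"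
    using assms(1) by (auto simp: std_lists_def)
  have "count (mset A) k < mm D k" "count (mset B) k < mm D k" if "k \<in> idx D" for k
    using L(3)[OF that] p(1) by simp_all
  then show "A \<in> std_lists" "B \<in> std_lists"
    using L(1,2) p(2-4) unfolding std_lists_def by blast+
qed

text \<open>Of all terms of \<open>\<Delta>(v\<^sub>L g)\<close> only those with factors \<open>v\<^sub>A\<close> and \<open>v\<^sub>B\<close> contribute.  The left functional
  sees \<open>a\<^sub>B g\<close> instead of \<open>g\<close>, which makes no difference when its values are constant in the group
  element.\<close>

lemma conv_concentrated_value:
  assumes f: "concentrated f A (\<lambda>_. \<alpha>)" and h: "concentrated h B \<phi>" and L: "L \<in> std_lists" and g: "g \<in> Gcar"
  shows "conv D f h (cls D (var_mon L * gG g)) = coef L A B * \<alpha> * \<phi> g"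
proof -
  have fd: "f \<in> dual_space D" and hd: "h \<in> dual_space D" using f h by (auto simp: concentrated_def)
  have Li: "set L \<subseteq> idx D" using L by (simp add: std_lists_def)
  have "conv D f h (cls D (var_mon L * gG g)) = tens_eval f h (Delta (var_mon L * gG g))"
    by (intro conv_cls fd hd F_closed var_mon_in gG_in Li g)
  also have "\<dots> = (\<Sum>(c, A', B')\<leftarrow>splits L.
      c * (f (cls D (var_mon A' * gG (gel_prod B' \<otimes>\<^bsub>grp D\<^esub> g))) * h (cls D (var_mon B' * gG g))))"
    by (rule tens_eval_Delta_monomial[OF fd hd Li g])
  also have "\<dots> = (\<Sum>(c, A', B')\<leftarrow>splits L. (if A' = A \<and> B' = B then c else 0) * (\<alpha> * \<phi> g))"
  proof (intro arg_cong[of _ _ sum_list] map_cong refl, clarify)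
    fix c A' B' assume s: "(c, A', B') \<in> set (splits L)"
    have AB: "A' \<in> std_lists" "B' \<in> std_lists" using std_lists_splits[OF L s] .
    then have "gel_prod B' \<otimes>\<^bsub>grp D\<^esub> g \<in> Gcar" using g by (auto simp: std_lists_def intro!: grp.m_closed gel_prod_in)
    then show "c * (f (cls D (var_mon A' * gG (gel_prod B' \<otimes>\<^bsub>grp D\<^esub> g))) * h (cls D (var_mon B' * gG g)))
        = (if A' = A \<and> B' = B then c else 0) * (\<alpha> * \<phi> g)"
      using f h AB g by (simp add: concentrated_def)
  qed
  also have "\<dots> = (\<Sum>(c, A', B')\<leftarrow>splits L. (if A' = A \<and> B' = B then c else 0)) * (\<alpha> * \<phi> g)"
    unfolding sum_list_mult_const[symmetric] by (simp add: case_prod_unfold)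
  finally show ?thesis by (simp add: coef_def)
qed

text \<open>A sorted list is determined by its letters, so only one list \<open>K\<close> can be standard and split into
  \<open>A\<close> and \<open>B\<close>; its coefficient is all that remains of the comultiplication.\<close>

lemma conv_concentratedI:
  assumes f: "concentrated f A (\<lambda>_. \<alpha>)" and h: "concentrated h B \<phi>"
    and L: "\<And>L. L \<in> std_lists \<Longrightarrow> mset L = mset A + mset B \<Longrightarrow> L = K" and K: "coef K A B = \<beta>"
  shows "concentrated (conv D f h) K (\<lambda>g. \<alpha> * \<beta> * \<phi> g)"
  unfolding concentrated_def
proof (intro conjI ballI)
  show "conv D f h \<in> dual_space D" using f h by (intro conv_dual) (simp_all add: concentrated_def)
  fix L g assume Lg: "L \<in> std_lists" "g \<in> Gcar"
  have "coef L A B = (if L = K then \<beta> else 0)"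
    using L[OF Lg(1)] K coef_eq_0[of L A B] by (cases "mset L = mset A + mset B") auto
  then show "conv D f h (cls D (var_mon L * gG g)) = (if L = K then \<alpha> * \<beta> * \<phi> g else 0)"
    unfolding conv_concentrated_value[OF f h Lg] by simp
qed

lemma conv_concentrated_disjoint:
  assumes f: "concentrated f A (\<lambda>_. \<alpha>)" and h: "concentrated h B \<phi>" and "set A \<inter> set B = {}" "sorted (A @ B)"
  shows "concentrated (conv D f h) (A @ B) (\<lambda>g. \<alpha> * \<phi> g)"
proof -
  have "L = A @ B" if "L \<in> std_lists" "mset L = mset A + mset B" for L
    using that assms(4) by (intro sorted_mset_eqI) (simp_all add: std_lists_def)
  from conv_concentratedI[OF f h this coef_append[OF assms(3)]] show ?thesis by simp
qed

lemma concentrated_counit: "concentrated (counit D) [] (\<lambda>_. 1)"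
proof -
  have "eps (var_mon L * gG g) = (if L = [] then 1 else 0)" for L g
    by (cases L) (simp_all add: var_mon_simps eps_simps)
  then show ?thesis
    by (auto simp: concentrated_def counit_dual std_lists_def counit_cls F_closed var_mon_in gG_in)
qed

lemma concentrated_power:
  assumes "concentrated \<xi> [k] (\<lambda>_. 1)"
  shows "concentrated (\<xi> [^]\<^bsub>dual_alg D\<^esub> n) (replicate n k) (\<lambda>_. qfact (qq D k k) n)"
proof (induction n)
  case 0
  show ?case using concentrated_counit by (simp add: nat_pow_def dual_alg_def)
next
  case (Suc n)
  have p: "\<xi> [^]\<^bsub>dual_alg D\<^esub> Suc n = conv D (\<xi> [^]\<^bsub>dual_alg D\<^esub> n) \<xi>"
    by (simp add: nat_pow_def dual_alg_def)
  have "L = replicate (Suc n) k" if "L \<in> std_lists" "mset L = mset (replicate n k) + mset [k]" for L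
    using that by (intro sorted_mset_eqI) (simp_all add: std_lists_def)
  from conv_concentratedI[OF Suc assms this coef_replicate] show ?case
    unfolding p by (simp only: qfact_Suc mult_1_right)
qed

text \<open>Exponent vectors correspond to sorted lists.  The restriction to the indices in \<open>ks\<close> serves the
  induction along the ordered product defining \<open>\<xi>\<^sup>c\<close>.\<close>

definition exp_list_on :: "nat list \<Rightarrow> (nat \<Rightarrow> nat) \<Rightarrow> nat list"
  where "exp_list_on ks c = concat (map (\<lambda>k. replicate (c k) k) ks)"

lemma exp_list_on_simps: "exp_list_on [] c = []" "exp_list_on (k # ks) c = replicate (c k) k @ exp_list_on ks c"
  by (simp_all add: exp_list_on_def)

lemma set_exp_list_on: "set (exp_list_on ks c) \<subseteq> set ks"
  by (auto simp: exp_list_on_def split: if_splits)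

lemma sorted_exp_list_on: "sorted ks \<Longrightarrow> sorted (exp_list_on ks c)"
proof (induction ks)
  case (Cons k ks)
  then show ?case using set_exp_list_on[of ks c] by (auto simp: exp_list_on_simps sorted_append)
qed (simp add: exp_list_on_simps)

lemma count_exp_list_on: "distinct ks \<Longrightarrow> count (mset (exp_list_on ks c)) k = (if k \<in> set ks then c k else 0)"
  by (induction ks) (auto simp: exp_list_on_simps)

definition idx_list :: "nat list" where "idx_list = [1..<Suc (rank D)]"

lemma idx_list: "set idx_list = idx D" "sorted idx_list" "distinct idx_list"
  by (auto simp: idx_list_def simp del: upt_Suc)

abbreviation exp_list :: "(nat \<Rightarrow> nat) \<Rightarrow> nat list" where "exp_list \<equiv> exp_list_on idx_list"

lemma exp_list: "sorted (exp_list c)" "set (exp_list c) \<subseteq> idx D" "count (mset (exp_list c)) k = (if k \<in> idx D then c k else 0)"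
  by (fact sorted_exp_list_on[OF idx_list(2)] set_exp_list_on[of idx_list c, unfolded idx_list(1)]
      count_exp_list_on[OF idx_list(3), unfolded idx_list(1)])+

lemma exps_less: "c \<in> exps D \<Longrightarrow> k \<in> idx D \<Longrightarrow> c k < mm D k"
  unfolding exps_def by (drule PiE_mem) simp_all

lemma exp_list_std_lists: "c \<in> exps D \<Longrightarrow> exp_list c \<in> std_lists"
  unfolding std_lists_def mem_Collect_eq exp_list(3) using exps_less[of c] by (simp add: exp_list(1,2) del: One_nat_def)

lemma eq_exp_list_iff:
  assumes "sorted L" "set L \<subseteq> idx D"
  shows "L = exp_list c \<longleftrightarrow> (\<forall>k\<in>idx D. count (mset L) k = c k)"
proof
  assume c: "\<forall>k\<in>idx D. count (mset L) k = c k"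
  have "count (mset L) k = count (mset (exp_list c)) k" for k
  proof (cases "k \<in> idx D")
    case True
    then show ?thesis unfolding exp_list(3) if_P[OF True] by (rule bspec[OF c])
  next
    case False
    then have "k \<notin># mset L" using assms(2) by (metis set_mset_mset subsetD)
    then show ?thesis unfolding exp_list(3) if_not_P[OF False] by (simp only: count_eq_zero_iff not_False_eq_True)
  qed
  then show "L = exp_list c"
    by (intro sorted_mset_eqI assms(1) exp_list(1) multiset_eqI)
next
  assume "L = exp_list c"
  then show "\<forall>k\<in>idx D. count (mset L) k = c k" using exp_list(3)[of c] by (metis (full_types))
qed

lemma exp_list_eq_iff: "exp_list c = exp_list i \<longleftrightarrow> (\<forall>k\<in>idx D. c k = i k)"
  unfolding eq_exp_list_iff[OF exp_list(1,2)] exp_list(3) by (rule ball_cong[OF refl]) (simp only: if_True)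

lemma exp_list_inj: "c \<in> exps D \<Longrightarrow> i \<in> exps D \<Longrightarrow> exp_list c = exp_list i \<longleftrightarrow> c = i"
  unfolding exp_list_eq_iff exps_def by (metis PiE_ext)

lemma std_lists_exp_list: "L \<in> std_lists \<Longrightarrow> \<exists>c\<in>exps D. L = exp_list c"
proof -
  assume L: "L \<in> std_lists"
  let ?c = "\<lambda>k\<in>idx D. count (mset L) k"
  have "?c \<in> exps D" using L unfolding std_lists_def exps_def by (intro restrict_PiE_iff[THEN iffD2]) simp
  moreover have "L = exp_list ?c" using L by (subst eq_exp_list_iff) (simp_all add: std_lists_def)
  ultimately show ?thesis by blast
qed

lemma kdelta_exp_list: "kdelta D c i = (if exp_list c = exp_list i then 1 else 0)"
  unfolding exp_list_eq_iff kdelta_def by (auto simp: prod_zero_iff intro!: prod.neutral)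

lemma exp_list_zero: "exp_list (\<lambda>_. 0) = []"
  using eq_exp_list_iff[of "[]" "\<lambda>_. 0"] by simp

lemma exp_list_unit: "k \<in> idx D \<Longrightarrow> exp_list (unit_vec k) = [k]"
  by (rule sym, subst eq_exp_list_iff) (auto simp: unit_vec_def)

lemma cls_power: "x \<in> F \<Longrightarrow> cls D x [^]\<^bsub>HD D\<^esub> (n::nat) = cls D (x ^ n)"
proof (induction n)
  case 0 then show ?case by (simp add: nat_pow_def cls_one)
next
  case (Suc n)
  have "cls D x [^]\<^bsub>HD D\<^esub> Suc n = cls D x [^]\<^bsub>HD D\<^esub> n \<otimes>\<^bsub>HD D\<^esub> cls D x"
    by (simp add: nat_pow_def)
  then show ?case using Suc by (simp add: cls_mult F_power power_Suc2 del: power_Suc)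
qed

lemma std_eq:
  assumes g: "g \<in> Gcar" shows "std D i g = cls D (var_mon (exp_list i) * gG g)"
proof -
  have "foldr (\<lambda>k x. cls D (gV k) [^]\<^bsub>HD D\<^esub> i k \<otimes>\<^bsub>HD D\<^esub> x) ks \<one>\<^bsub>HD D\<^esub> = cls D (var_mon (exp_list_on ks i))"
    if "set ks \<subseteq> idx D" for ks
    using that
  proof (induction ks)
    case Nil then show ?case by (simp add: exp_list_on_simps var_mon_simps cls_one)
  next
    case (Cons k ks)
    have "var_mon (exp_list_on ks i) \<in> F" using Cons set_exp_list_on[of ks i] by (intro var_mon_in) auto
    moreover have "gV k \<in> F" using Cons by (intro gV_in) auto
    ultimately show ?case using Cons
      by (simp add: cls_power cls_mult F_power exp_list_on_simps var_mon_simps var_mon_replicate)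
  qed
  from this[of idx_list, OF eq_refl[OF idx_list(1)]] have "ord_prod (HD D) (rank D) (\<lambda>k. cls D (gV k) [^]\<^bsub>HD D\<^esub> i k) = cls D (var_mon (exp_list i))"
    unfolding ord_prod_def idx_list_def .
  moreover have "var_mon (exp_list i) \<in> F" by (intro var_mon_in exp_list)
  ultimately show ?thesis unfolding std_def using g by (simp add: cls_mult gG_in)
qed

text \<open>The description of functionals by values on the standard basis, translated into lists.\<close>

lemma concentrated_iff_std:
  "concentrated f (exp_list c) \<phi> \<longleftrightarrow> f \<in> dual_space D \<and>
    (\<forall>i\<in>exps D. \<forall>g\<in>Gcar. f (std D i g) = kdelta D c i * \<phi> g)"
proof -
  have "(\<forall>L\<in>std_lists. \<forall>g\<in>Gcar. f (cls D (var_mon L * gG g)) = (if L = exp_list c then \<phi> g else 0)) \<longleftrightarrow>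
      (\<forall>i\<in>exps D. \<forall>g\<in>Gcar. f (cls D (var_mon (exp_list i) * gG g)) = (if exp_list i = exp_list c then \<phi> g else 0))"
    using std_lists_exp_list exp_list_std_lists by metis
  also have "\<dots> \<longleftrightarrow> (\<forall>i\<in>exps D. \<forall>g\<in>Gcar. f (std D i g) = kdelta D c i * \<phi> g)"
    by (intro ball_cong refl) (auto simp: std_eq kdelta_exp_list)
  finally show ?thesis by (simp add: concentrated_def)
qed

lemma concentrated_xi_pow:
  assumes \<xi>: "\<And>k. k \<in> idx D \<Longrightarrow> concentrated (\<xi> k) [k] (\<lambda>_. 1)"
  shows "concentrated (xi_pow D \<xi> c) (exp_list c) (\<lambda>_. mfact D c)"
proof -
  have "concentrated (foldr (\<lambda>k x. \<xi> k [^]\<^bsub>dual_alg D\<^esub> c k \<otimes>\<^bsub>dual_alg D\<^esub> x) ks \<one>\<^bsub>dual_alg D\<^esub>) (exp_list_on ks c)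
      (\<lambda>_. \<Prod>k\<in>set ks. qfact (qq D k k) (c k))"
    if "set ks \<subseteq> idx D" "sorted ks" "distinct ks" for ks
    using that
  proof (induction ks)
    case Nil then show ?case using concentrated_counit by (simp add: dual_alg_def exp_list_on_simps)
  next
    case (Cons k ks)
    have m: "x \<otimes>\<^bsub>dual_alg D\<^esub> y = conv D x y" for x y by (simp add: dual_alg_def)
    have s: "sorted (exp_list_on (k # ks) c)" using Cons.prems(2) by (rule sorted_exp_list_on)
    have d: "set (replicate (c k) k) \<inter> set (exp_list_on ks c) = {}"
      using Cons.prems set_exp_list_on[of ks c] by auto
    have 1: "concentrated (\<xi> k [^]\<^bsub>dual_alg D\<^esub> c k) (replicate (c k) k) (\<lambda>_. qfact (qq D k k) (c k))"
      using Cons.prems by (intro concentrated_power \<xi>) auto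
    show ?case
      using conv_concentrated_disjoint[OF 1 Cons.IH d] s Cons.prems by (simp add: exp_list_on_simps m)
  qed
  from this[of idx_list] show ?thesis using idx_list unfolding xi_pow_def ord_prod_def mfact_def idx_list_def by simp
qed

subsection \<open>The dual space\<close>

lemma fscale_module: "Modules.module (fscale :: 'k \<Rightarrow> ('g, 'k) functional \<Rightarrow> _)"
  by unfold_locales (auto simp: fscale_def fun_eq_iff algebra_simps)

lemma dual_subspace: "module.subspace fscale (dual_space D)"
  unfolding module.subspace_def[OF fscale_module]
proof (intro conjI ballI allI)
  show "0 \<in> dual_space D" by (rule dual_spaceI) simp_all
  fix f h assume f: "f \<in> dual_space D" and h: "h \<in> dual_space D"
  show "f + h \<in> dual_space D"
    by (rule dual_spaceI) (simp_all add: dual_add[OF f] dual_add[OF h] dual_scal[OF f] dual_scal[OF h]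
        dual_outside[OF f] dual_outside[OF h] algebra_simps)
next
  fix c f assume f: "f \<in> dual_space D"
  show "fscale c f \<in> dual_space D"
    by (rule dual_spaceI) (simp_all add: fscale_def dual_add[OF f] dual_scal[OF f] dual_outside[OF f] algebra_simps)
qed

lemma finite_exps: "finite (exps D)"
  unfolding exps_def by (intro finite_PiE) auto

lemma mfact_nonzero: "c \<in> exps D \<Longrightarrow> mfact D c \<noteq> 0"
  using mm_ge qfact_nonzero by (fastforce simp: mfact_def exps_def mm_def PiE_def Pi_def)

text \<open>Evaluation at standard monomials recovers the coefficients of a linear combination, which gives
  independence; and the combination with coefficients \<open>f(v\<^sup>c g)\<close> agrees with \<open>f\<close> on the standard
  monomials, hence everywhere.\<close>

lemma dual_family_basis:
  assumes d: "\<And>c g. c \<in> exps D \<Longrightarrow> g \<in> Gcar \<Longrightarrow> b c g \<in> dual_space D"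
    and v: "\<And>c g i h. c \<in> exps D \<Longrightarrow> g \<in> Gcar \<Longrightarrow> i \<in> exps D \<Longrightarrow> h \<in> Gcar \<Longrightarrow>
      b c g (std D i h) = (if c = i \<and> g = h then 1 else 0)"
  defines "B \<equiv> {b c g | c g. c \<in> exps D \<and> g \<in> Gcar}"
  shows "\<not> module.dependent fscale B \<and> module.span fscale B = dual_space D"
proof -
  interpret fs: Modules.module "fscale :: 'k \<Rightarrow> ('g, 'k) functional \<Rightarrow> _" by (rule fscale_module)
  have "\<not> fs.dependent B"
  proof
    assume "fs.dependent B"
    then obtain t u v0 where t: "finite t" "t \<subseteq> B" "(\<Sum>f\<in>t. fscale (u f) f) = 0" "v0 \<in> t" "u v0 \<noteq> 0"
      unfolding fs.dependent_explicit by blast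
    then obtain c g where c: "v0 = b c g" "c \<in> exps D" "g \<in> Gcar" by (auto simp: B_def)
    have "0 = (\<Sum>f\<in>t. fscale (u f) f) (std D c g)" using t(3) by simp
    also have "\<dots> = (\<Sum>f\<in>t. u f * f (std D c g))" by (simp add: sum_fun_apply fscale_def)
    also have "\<dots> = (\<Sum>f\<in>t. if f = v0 then u v0 else 0)"
    proof (intro sum.cong refl)
      fix f assume "f \<in> t"
      then obtain c' g' where f: "f = b c' g'" "c' \<in> exps D" "g' \<in> Gcar" using t(2) by (auto simp: B_def)
      show "u f * f (std D c g) = (if f = v0 then u v0 else 0)"
        using v[OF f(2,3) c(2,3)] v[OF c(2,3) c(2,3)] f(1) c(1) by (cases "c' = c \<and> g' = g") auto
    qed
    also have "\<dots> = u v0" using t by simp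
    finally show False using t(5) by simp
  qed
  moreover have "fs.span B = dual_space D"
  proof
    show "fs.span B \<subseteq> dual_space D"
      using d by (intro fs.span_minimal dual_subspace) (auto simp: B_def)
    show "dual_space D \<subseteq> fs.span B"
    proof
      fix f assume f: "f \<in> dual_space D"
      define h where "h = (\<Sum>c\<in>exps D. \<Sum>g\<in>Gcar. fscale (f (std D c g)) (b c g))"
      have hs: "h \<in> fs.span B"
        unfolding h_def by (intro fs.span_sum fs.span_scale fs.span_base) (auto simp: B_def)
      have hd: "h \<in> dual_space D"
        unfolding h_def by (intro fs.subspace_sum[OF dual_subspace] fs.subspace_scale[OF dual_subspace] d)
      have hv: "h (std D i g) = f (std D i g)" if "i \<in> exps D" "g \<in> Gcar" for i g
      proof -
        have "h (std D i g) = (\<Sum>c\<in>exps D. \<Sum>g'\<in>Gcar. if c = i then if g' = g then f (std D i g) else 0 else 0)"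
          unfolding h_def sum_fun_apply fscale_def by (intro sum.cong refl) (auto simp: v that)
        also have "\<dots> = (\<Sum>c\<in>exps D. if c = i then f (std D i g) else 0)"
          using that grp.fin by (intro sum.cong refl) auto
        also have "\<dots> = f (std D i g)" using that finite_exps by simp
        finally show ?thesis .
      qed
      have df: "f - h \<in> dual_space D" by (rule fs.subspace_diff[OF dual_subspace f hd])
      have "(f - h) X = 0" for X
      proof (rule functional_eq_0[OF df])
        fix L g assume "L \<in> std_lists" and g: "g \<in> Gcar"
        then obtain c where "c \<in> exps D" "L = exp_list c" using std_lists_exp_list by blast
        then show "(f - h) (cls D (var_mon L * gG g)) = 0" using hv[of c g] g by (simp add: std_eq)
      qed
      then have "f = h" by (simp add: fun_eq_iff)
      then show "f \<in> fs.span B" using hs by simp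
    qed
  qed
  ultimately show ?thesis by blast
qed

end

lemma concentrated_eps_el:
  fixes D :: "('g, 'k::field_char_0) datum"
  assumes "qls D" and roots: "all_roots_of_1 TYPE('k)"
    and \<iota>: "\<And>\<gamma>. \<gamma> \<in> carrier (char_group (grp D)) \<Longrightarrow> qls.concentrated D (\<iota> \<gamma>) [] \<gamma>"
    and g: "g \<in> carrier (grp D)"
  shows "qls.concentrated D (eps_el D \<iota> g) [] (\<lambda>h. if g = h then 1 else 0)"
proof -
  interpret qls D by fact
  interpret fs: Modules.module "fscale :: 'k \<Rightarrow> ('g, 'k) functional \<Rightarrow> _" by (rule fscale_module)
  let ?C = "carrier (char_group (grp D)) :: ('g \<Rightarrow> 'k) set"
  have n: "(of_nat (card Gcar) :: 'k) \<noteq> 0" using grp.fin by (auto simp: card_gt_0_iff)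
  have "eps_el D \<iota> g \<in> dual_space D"
    unfolding eps_el_def using \<iota>
    by (intro fs.subspace_scale[OF dual_subspace] fs.subspace_sum[OF dual_subspace]) (auto simp: concentrated_def)
  moreover have "eps_el D \<iota> g (cls D (var_mon L * gG h)) = (if L = [] then if g = h then 1 else 0 else 0)"
    if "L \<in> std_lists" "h \<in> Gcar" for L h
  proof -
    have "eps_el D \<iota> g (cls D (var_mon L * gG h))
        = 1 / of_nat (card Gcar) * (\<Sum>\<gamma>\<in>?C. \<gamma> (inv\<^bsub>grp D\<^esub> g) * (if L = [] then \<gamma> h else 0))"
      unfolding eps_el_def fscale_def sum_fun_apply using \<iota> that
      by (intro arg_cong2[of _ _ _ _ "(*)"] sum.cong refl) (simp add: concentrated_def)
    then show ?thesis using grp.char_orthogonality[OF roots g that(2)] n by simp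
  qed
  ultimately show ?thesis by (simp add: concentrated_def)
qed

theorem proposition2p3:
  fixes D :: "('g, 'k::field_char_0) datum"
    and \<xi> :: "nat \<Rightarrow> ('g, 'k) functional"
    and \<iota> :: "('g \<Rightarrow> 'k) \<Rightarrow> ('g, 'k) functional"
  assumes roots: "all_roots_of_1 TYPE('k)"
    and datum: "qls_datum D"
    and xi_dual: "\<And>k. k \<in> idx D \<Longrightarrow> \<xi> k \<in> dual_space D"
    and xi_val: "\<And>k i g. k \<in> idx D \<Longrightarrow> i \<in> exps D \<Longrightarrow> g \<in> carrier (grp D) \<Longrightarrow>
      \<xi> k (std D i g) = kdelta D (unit_vec k) i"
    and iota_dual: "\<And>\<gamma>. \<gamma> \<in> carrier (char_group (grp D)) \<Longrightarrow> \<iota> \<gamma> \<in> dual_space D"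
    and iota_val: "\<And>\<gamma> i g. \<gamma> \<in> carrier (char_group (grp D)) \<Longrightarrow> i \<in> exps D \<Longrightarrow>
      g \<in> carrier (grp D) \<Longrightarrow> \<iota> \<gamma> (std D i g) = kdelta D (\<lambda>_. 0) i * \<gamma> g"
  shows "(\<forall>c\<in>exps D. \<forall>i\<in>exps D. \<forall>g\<in>carrier (grp D).
            xi_pow D \<xi> c (std D i g) = mfact D c * kdelta D c i) \<and>
         (let B = {dual_elem D \<xi> \<iota> c g | c g. c \<in> exps D \<and> g \<in> carrier (grp D)} in
            \<not> module.dependent fscale B \<and> module.span fscale B = dual_space D) \<and>
         (\<forall>c\<in>exps D. \<forall>g\<in>carrier (grp D). \<forall>i\<in>exps D. \<forall>h\<in>carrier (grp D).
            dual_elem D \<xi> \<iota> c g (std D i h) = (if c = i \<and> g = h then 1 else 0))"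
proof -
  interpret qls D by unfold_locales (rule datum)
  interpret fs: Modules.module "fscale :: 'k \<Rightarrow> ('g, 'k) functional \<Rightarrow> _" by (rule fscale_module)
  have \<xi>: "concentrated (\<xi> k) [k] (\<lambda>_. 1)" if "k \<in> idx D" for k
    using concentrated_iff_std[of "\<xi> k" "unit_vec k" "\<lambda>_. 1"] xi_dual[OF that] xi_val[OF that]
    by (simp add: exp_list_unit[OF that])
  have \<iota>: "concentrated (\<iota> \<gamma>) [] \<gamma>" if "\<gamma> \<in> carrier (char_group (grp D))" for \<gamma>
    using concentrated_iff_std[of "\<iota> \<gamma>" "\<lambda>_. 0" \<gamma>] iota_dual[OF that] iota_val[OF that]
    by (simp add: exp_list_zero)
  have pow: "concentrated (xi_pow D \<xi> c) (exp_list c) (\<lambda>_. mfact D c)" for c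
    by (rule concentrated_xi_pow[OF \<xi>])
  have eps_conc: "concentrated (eps_el D \<iota> g) [] (\<lambda>h. if g = h then 1 else 0)" if "g \<in> Gcar" for g
    by (rule concentrated_eps_el[OF qls_axioms roots \<iota> that])
  have m: "x \<otimes>\<^bsub>dual_alg D\<^esub> y = conv D x y" for x y by (simp add: dual_alg_def)
  have prod: "concentrated (conv D (xi_pow D \<xi> c) (eps_el D \<iota> g)) (exp_list c) (\<lambda>h. mfact D c * (if g = h then 1 else 0))"
    if "g \<in> Gcar" for c g
    using conv_concentrated_disjoint[OF pow eps_conc[OF that]] exp_list(1)[of c] by simp
  have dd: "dual_elem D \<xi> \<iota> c g \<in> dual_space D" if "g \<in> Gcar" for c g
    unfolding dual_elem_def m
    using prod[OF that] by (intro fs.subspace_scale[OF dual_subspace]) (simp add: concentrated_def)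
  have dv: "dual_elem D \<xi> \<iota> c g (std D i h) = (if c = i \<and> g = h then 1 else 0)"
    if "c \<in> exps D" "g \<in> Gcar" "i \<in> exps D" "h \<in> Gcar" for c g i h
  proof -
    have "conv D (xi_pow D \<xi> c) (eps_el D \<iota> g) (std D i h) = kdelta D c i * (mfact D c * (if g = h then 1 else 0))"
      using prod[OF that(2), of c] that unfolding concentrated_iff_std by blast
    then show ?thesis
      using mfact_nonzero[OF that(1)] exp_list_inj[OF that(1,3)]
      by (auto simp: dual_elem_def m fscale_def kdelta_exp_list)
  qed
  have "xi_pow D \<xi> c (std D i g) = mfact D c * kdelta D c i"
    if "c \<in> exps D" "i \<in> exps D" "g \<in> Gcar" for c i g
    using pow[of c] that unfolding concentrated_iff_std by (simp add: mult.commute)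
  then show ?thesis
    using dual_family_basis[of "dual_elem D \<xi> \<iota>", OF dd dv] dv by (auto simp: Let_def)
qed

end
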